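(* Let $n,n'\in N^+$ with $\{n',n\}=c>0$, and let $b,b'\in(1/\delta_0)\mathbb{Z}$, where $c/4\in(1/\delta_0)\mathbb{Z}$. Then, in $G$, $$\begin{aligned} [n']_{c/4,b'}\,[n]_{c,b} =&\ \Bigl(\overrightarrow{\prod_{p\ge0}}\,[(2p+1)n+4pn']_{c,\,(2p+1)b+4pb'}\,[(p+1)n+(2p+1)n']_{c/4,\,(p+1)b+(2p+1)b'}\Bigr)\\ &\times[n+2n']_{c/2,\,b+2b'}\\ &\times\Bigl(\prod_{p\ge0}[2^p(n+2n')]_{2^{p-1}c,\,2^p(b+2b')-2^{p-1}c}\,[2^p(n+2n')]_{2^{p-1}c,\,2^p(b+2b')+2^{p-1}c}\Bigr)\\ &\times\Bigl(\overleftarrow{\prod_{p\ge0}}\,[(2p+1)n+(4p+4)n']_{c,\,(2p+1)b+(4p+4)b'}\,[pn+(2p+1)n']_{c/4,\,pb+(2p+1)b'}\Bigr). \end{aligned}$$ In particular, when $r=2$, $(\delta_1,\delta_2)=(1,4)$ and $\{e_2,e_1\}=1$, taking $n=e_1$, $n'=e_2$, $c=1$, $b=b'=0$ gives $$\begin{aligned} [e_2]_{\frac14,0}[e_1]_{1,0} =&\ \Bigl(\overrightarrow{\prod_{p\ge0}}[(2p+1)e_1+4pe_2]_{1,0}[(p+1)e_1+(2p+1)e_2]_{\frac14,0}\Bigr)\\ &\times[e_1+2e_2]_{\frac12,0}\prod_{j\ge0}[2^j(e_1+2e_2)]_{2^{j-1},-2^{j-1}}[2^j(e_1+2e_2)]_{2^{j-1},2^{j-1}}\\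 &\times\Bigl(\overleftarrow{\prod_{p\ge0}}[(2p+1)e_1+(4p+4)e_2]_{1,0}[pe_1+(2p+1)e_2]_{\frac14,0}\Bigr). \end{aligned}$$
   Context: Fixed data: $N$ is a lattice of finite rank $r$ with basis $(e_1,\dots,e_r)$; $\{\cdot,\cdot\}:N\times N\to\mathbb{Q}$ is a skew-symmetric bilinear form; $\delta_1,\dots,\delta_r$ are positive integers such that $N^\circ=\bigoplus_i\mathbb{Z}\,\delta_ie_i$ satisfies $\{N^\circ,N\}\subset\mathbb{Z}$. Let $\delta_0=\mathrm{lcm}(\delta_1,\dots,\delta_r)$; then $\{\cdot,\cdot\}$ takes values in $(1/\delta_0)\mathbb{Z}$. Let $N^+=\{\sum_i a_ie_i\mid a_i\in\mathbb{Z}_{\ge0},\ \sum_i a_i>0\}$ and $\deg(\sum_i a_ie_i)=\sum_i a_i$. Let $q$ be an indeterminate, $[\alpha]_q=\frac{q^\alpha-q^{-\alpha}}{q-q^{-1}}$ for $\alpha\in(1/\delta_0)\mathbb{Z}$. Let $\mathfrak{g}=\bigoplus_{n\in N^+}\mathbb{Q}(q^{1/\delta_0})X_n$ be the Lie algebra over $\mathbb{Q}(q^{1/\delta_0})$ with $[X_n,X_{n'}]=[\{n,n'\}]_q X_{n+n'}$, $\widehat{\mathfrak{g}}$ its completion with respect to $\deg$, and $G=\exp(\widehat{\mathfrak{g}})$ with the Baker–Campbell–Hausdorff product. Let $G^{>\ell}$ be the normal subgroup of elements $\exp(\sum_{\deg n>\ell}c_nX_n)$; infinite products in $G$ are understood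 as limits with respect to the quotients $G/G^{>\ell}$ (in each of which only finitely many factors are nontrivial). Quantum dilogarithm elements, for $n\in N^+$, $a\in(1/\delta_0)\mathbb{Z}_{>0}$, $b\in(1/\delta_0)\mathbb{Z}$: $$[n]_{a,b}:=\Psi_{a,b}[n]=\exp\Bigl(\sum_{j=1}^\infty\frac{(-1)^{j+1}}{j\,[ja]_q}q^{jb}X_{jn}\Bigr)\in G.$$ $\overrightarrow{\prod}$ (resp. $\overleftarrow{\prod}$) denotes the ordered product with the index $p$ increasing from left to right (resp. from right to left); the two factors displayed for each fixed $p$ are kept in the displayed order. *)

theory Defs
  imports
    "HOL-Analysis.Finite_Cartesian_Product"
    "HOL-Computational_Algebra.Fraction_Field"
    "HOL-Computational_Algebra.Polynomial"
    "HOL-Algebra.Coset"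
begin

text \<open>The lattice \<open>N\<close> is \<open>\<int>\<^sup>r\<close>, with the basis indexed by a finite type.\<close>

type_synonym 'r latt = "int ^ 'r"

definition basis_vec :: "'r::finite \<Rightarrow> 'r latt" where
  "basis_vec i = axis i 1"

definition latt_deg :: "'r::finite latt \<Rightarrow> int" where
  "latt_deg n = (\<Sum>i\<in>UNIV. n $ i)"

definition latt_pos :: "'r::finite latt set" where
  "latt_pos = {n. (\<forall>i. 0 \<le> n $ i) \<and> 0 < latt_deg n}"

definition latt_circ :: "('r::finite \<Rightarrow> nat) \<Rightarrow> 'r latt set" where
  "latt_circ \<delta> = {x. \<forall>i. int (\<delta> i) dvd x $ i}"

definition fixed_data :: "('r::finite latt \<Rightarrow> 'r latt \<Rightarrow> rat) \<Rightarrow> ('r \<Rightarrow> nat) \<Rightarrow> bool" where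
  "fixed_data \<omega> \<delta> \<longleftrightarrow>
     (\<forall>x y z. \<omega> (x + y) z = \<omega> x z + \<omega> y z) \<and>
     (\<forall>x y z. \<omega> x (y + z) = \<omega> x y + \<omega> x z) \<and>
     (\<forall>x y. \<omega> x y = - \<omega> y x) \<and>
     (\<forall>i. 0 < \<delta> i) \<and>
     (\<forall>x\<in>latt_circ \<delta>. \<forall>y. \<omega> x y \<in> \<int>)"

definition delta0 :: "('r::finite \<Rightarrow> nat) \<Rightarrow> nat" where
  "delta0 \<delta> = Lcm (range \<delta>)"

definition frac_ints :: "('r::finite \<Rightarrow> nat) \<Rightarrow> rat set" where
  "frac_ints \<delta> = {\<alpha>. \<alpha> * of_nat (delta0 \<delta>) \<in> \<int>}"

text \<open>The field \<open>\<rat>(q\<^bsup>1/\<delta>\<^sub>0\<^esup>)\<close> is the field of rational functions over \<open>\<rat>\<close> in the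
  indeterminate \<open>qroot\<close>, which plays the role of \<open>q\<^bsup>1/\<delta>\<^sub>0\<^esup>\<close>.\<close>

type_synonym qfield = "rat poly fract"

definition qroot :: qfield where
  "qroot = Fract [:0, 1:] 1"

text \<open>\<open>qpow \<delta> \<alpha>\<close> is \<open>q\<^bsup>\<alpha>\<^esup>\<close>. It is meaningful only for \<open>\<alpha> \<in> (1/\<delta>\<^sub>0)\<int>\<close>, where the floor is
  exact.\<close>

definition qpow :: "('r::finite \<Rightarrow> nat) \<Rightarrow> rat \<Rightarrow> qfield" where
  "qpow \<delta> \<alpha> = qroot powi \<lfloor>\<alpha> * of_nat (delta0 \<delta>)\<rfloor>"

definition qnum :: "('r::finite \<Rightarrow> nat) \<Rightarrow> rat \<Rightarrow> qfield" where
  "qnum \<delta> \<alpha> = (qpow \<delta> \<alpha> - qpow \<delta> (- \<alpha>)) / (qpow \<delta> 1 - qpow \<delta> (- 1))"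

text \<open>Each degree contains only finitely many elements of \<open>N\<^sup>+\<close>, so the completion of the Lie
  algebra consists of all formal sums \<open>\<Sum> c\<^sub>n X\<^sub>n\<close> over \<open>n \<in> N\<^sup>+\<close>. Such a sum is encoded by its
  coefficient function \<open>n \<mapsto> c\<^sub>n\<close>, extended by \<open>0\<close> outside \<open>N\<^sup>+\<close>.\<close>

type_synonym 'r formal = "'r latt \<Rightarrow> qfield"

definition lie_hat :: "'r::finite formal set" where
  "lie_hat = {X. \<forall>n. n \<notin> latt_pos \<longrightarrow> X n = 0}"

definition X_gen :: "'r::finite latt \<Rightarrow> 'r formal" where
  "X_gen n = (\<lambda>m. if m = n then 1 else 0)"

text \<open>The continuous bilinear extension of
  \<open>[X\<^sub>n, X\<^bsub>n'\<^esub>] = [{n,n'}]\<^sub>q X\<^bsub>n+n'\<^esub>\<close>; cf. \<open>lie_bracket_X_gen\<close> below.\<close>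

definition lie_bracket ::
  "('r::finite latt \<Rightarrow> 'r latt \<Rightarrow> rat) \<Rightarrow> ('r \<Rightarrow> nat) \<Rightarrow> 'r formal \<Rightarrow> 'r formal \<Rightarrow> 'r formal"
where
  "lie_bracket \<omega> \<delta> X Y = (\<lambda>m.
     \<Sum>(n, n')\<in>{(n, n'). n \<in> latt_pos \<and> n' \<in> latt_pos \<and> n + n' = m}.
       X n * Y n' * qnum \<delta> (\<omega> n n'))"

text \<open>\<open>[x\<^sub>1, [x\<^sub>2, \<dots> [x\<^bsub>k-1\<^esub>, x\<^sub>k] \<dots>]]\<close>\<close>

fun nested_bracket ::
  "('r::finite latt \<Rightarrow> 'r latt \<Rightarrow> rat) \<Rightarrow> ('r \<Rightarrow> nat) \<Rightarrow> 'r formal list \<Rightarrow> 'r formal"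
where
  "nested_bracket \<omega> \<delta> [] = (\<lambda>_. 0)"
| "nested_bracket \<omega> \<delta> [x] = x"
| "nested_bracket \<omega> \<delta> (x # y # zs) = lie_bracket \<omega> \<delta> x (nested_bracket \<omega> \<delta> (y # zs))"

text \<open>The Baker--Campbell--Hausdorff series in Dynkin's form,
  \[ \sum_{k\ge1} \frac{(-1)^{k-1}}{k} \sum_{r_i+s_i>0}
     \frac{[X^{r_1}Y^{s_1}\cdots X^{r_k}Y^{s_k}]}{(\sum_i (r_i+s_i))\,\prod_i r_i!\,s_i!}, \]
  where the bracket is right-normed. The list \<open>ps\<close> is \<open>[(r\<^sub>1,s\<^sub>1), \<dots>, (r\<^sub>k,s\<^sub>k)]\<close>. A bracket of
  length \<open>l\<close> has no component in degrees below \<open>l\<close>, so only brackets of length at most \<open>deg n\<close>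
  contribute to the coefficient of \<open>X\<^sub>n\<close>.\<close>

definition dynkin_len :: "(nat \<times> nat) list \<Rightarrow> nat" where
  "dynkin_len ps = (\<Sum>(r, s)\<leftarrow>ps. r + s)"

definition dynkin_index :: "nat \<Rightarrow> (nat \<times> nat) list set" where
  "dynkin_index d = {ps. ps \<noteq> [] \<and> (\<forall>(r, s)\<in>set ps. 0 < r + s) \<and> dynkin_len ps \<le> d}"

definition dynkin_coeff :: "(nat \<times> nat) list \<Rightarrow> qfield" where
  "dynkin_coeff ps =
     (- 1) ^ (length ps - 1) /
     (of_nat (length ps) * of_nat (dynkin_len ps) * (\<Prod>(r, s)\<leftarrow>ps. fact r * fact s))"

definition dynkin_word :: "'a \<Rightarrow> 'a \<Rightarrow> (nat \<times> nat) list \<Rightarrow> 'a list" where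
  "dynkin_word X Y ps = concat (map (\<lambda>(r, s). replicate r X @ replicate s Y) ps)"

definition bch ::
  "('r::finite latt \<Rightarrow> 'r latt \<Rightarrow> rat) \<Rightarrow> ('r \<Rightarrow> nat) \<Rightarrow> 'r formal \<Rightarrow> 'r formal \<Rightarrow> 'r formal"
where
  "bch \<omega> \<delta> X Y = (\<lambda>n.
     \<Sum>ps\<in>dynkin_index (nat (latt_deg n)).
       dynkin_coeff ps * nested_bracket \<omega> \<delta> (dynkin_word X Y ps) n)"

text \<open>The element \<open>exp(X)\<close> of \<open>G\<close> is represented by \<open>X\<close> itself.\<close>

definition exp_group ::
  "('r::finite latt \<Rightarrow> 'r latt \<Rightarrow> rat) \<Rightarrow> ('r \<Rightarrow> nat) \<Rightarrow> 'r formal monoid"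
where
  "exp_group \<omega> \<delta> = \<lparr>carrier = lie_hat, mult = bch \<omega> \<delta>, one = (\<lambda>_. 0)\<rparr>"

definition exp_group_gt :: "nat \<Rightarrow> 'r::finite formal set" where
  "exp_group_gt l = {X \<in> lie_hat. \<forall>n. latt_deg n \<le> int l \<longrightarrow> X n = 0}"

definition qdilog :: "('r::finite \<Rightarrow> nat) \<Rightarrow> 'r latt \<Rightarrow> rat \<Rightarrow> rat \<Rightarrow> 'r formal" where
  "qdilog \<delta> n a b = (\<lambda>m.
     \<Sum>j\<in>{j::nat. 1 \<le> j \<and> int j *s n = m}.
       (- 1) ^ (j + 1) / (of_nat j * qnum \<delta> (of_nat j * a)) * qpow \<delta> (of_nat j * b))"

text \<open>\<open>rprod G F k\<close> is \<open>F 0 \<otimes> F 1 \<otimes> \<dots> \<otimes> F (k-1)\<close> and \<open>lprod G F k\<close> is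
  \<open>F (k-1) \<otimes> \<dots> \<otimes> F 1 \<otimes> F 0\<close>.\<close>

primrec rprod :: "('a, 'm) monoid_scheme \<Rightarrow> (nat \<Rightarrow> 'a) \<Rightarrow> nat \<Rightarrow> 'a" where
  "rprod G F 0 = \<one>\<^bsub>G\<^esub>"
| "rprod G F (Suc k) = rprod G F k \<otimes>\<^bsub>G\<^esub> F k"

primrec lprod :: "('a, 'm) monoid_scheme \<Rightarrow> (nat \<Rightarrow> 'a) \<Rightarrow> nat \<Rightarrow> 'a" where
  "lprod G F 0 = \<one>\<^bsub>G\<^esub>"
| "lprod G F (Suc k) = F k \<otimes>\<^bsub>G\<^esub> lprod G F k"

text \<open>Convergence with respect to the quotients: for every \<open>l\<close>, the sequence eventually has the same
  class in \<open>G/G\<^bsup>>l\<^esup>\<close> as the limit.\<close>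

definition exp_group_lim ::
  "('r::finite latt \<Rightarrow> 'r latt \<Rightarrow> rat) \<Rightarrow> ('r \<Rightarrow> nat) \<Rightarrow> (nat \<Rightarrow> 'r formal) \<Rightarrow> 'r formal \<Rightarrow> bool"
where
  "exp_group_lim \<omega> \<delta> P g \<longleftrightarrow>
     g \<in> carrier (exp_group \<omega> \<delta>) \<and>
     (\<forall>l. \<forall>\<^sub>F k in sequentially.
        exp_group_gt l #>\<^bsub>exp_group \<omega> \<delta>\<^esub> P k = exp_group_gt l #>\<^bsub>exp_group \<omega> \<delta>\<^esub> g)"

definition has_rprod ::
  "('r::finite latt \<Rightarrow> 'r latt \<Rightarrow> rat) \<Rightarrow> ('r \<Rightarrow> nat) \<Rightarrow> (nat \<Rightarrow> 'r formal) \<Rightarrow> 'r formal \<Rightarrow> bool"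
where
  "has_rprod \<omega> \<delta> F g \<longleftrightarrow> exp_group_lim \<omega> \<delta> (rprod (exp_group \<omega> \<delta>) F) g"

definition has_lprod ::
  "('r::finite latt \<Rightarrow> 'r latt \<Rightarrow> rat) \<Rightarrow> ('r \<Rightarrow> nat) \<Rightarrow> (nat \<Rightarrow> 'r formal) \<Rightarrow> 'r formal \<Rightarrow> bool"
where
  "has_lprod \<omega> \<delta> F g \<longleftrightarrow> exp_group_lim \<omega> \<delta> (lprod (exp_group \<omega> \<delta>) F) g"

text \<open>All sums over sets used above are finite.\<close>

lemma finite_latt_decomp:
  "finite {(n, n'). n \<in> latt_pos \<and> n' \<in> latt_pos \<and> n + n' = (m::'r::finite latt)}"
proof -
  let ?V = "{n::'r latt. \<forall>i. n $ i \<in> {0..m $ i}}"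
  have "?V \<subseteq> vec_lambda ` (PiE UNIV (\<lambda>i. {0..m $ i}))"
  proof
    fix n :: "'r latt" assume "n \<in> ?V"
    then have "(\<lambda>i. n $ i) \<in> PiE UNIV (\<lambda>i. {0..m $ i})" by auto
    then show "n \<in> vec_lambda ` (PiE UNIV (\<lambda>i. {0..m $ i}))"
      by (metis image_eqI vec_nth_inverse)
  qed
  moreover have "finite (PiE (UNIV::'r set) (\<lambda>i. {0..m $ i}))"
    by (rule finite_PiE) auto
  ultimately have "finite ?V" using finite_subset by blast
  then have "finite (?V \<times> ?V)" by blast
  moreover have "{(n, n'). n \<in> latt_pos \<and> n' \<in> latt_pos \<and> n + n' = m} \<subseteq> ?V \<times> ?V"
    by (auto simp: latt_pos_def)
  ultimately show ?thesis using finite_subset by blast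
qed

lemma dynkin_len_bounds:
  assumes "\<forall>(r, s)\<in>set ps. 0 < r + s"
  shows "length ps \<le> dynkin_len ps" and "set ps \<subseteq> {..dynkin_len ps} \<times> {..dynkin_len ps}"
proof -
  have "length ps \<le> dynkin_len ps \<and> set ps \<subseteq> {..dynkin_len ps} \<times> {..dynkin_len ps}"
    using assms
  proof (induction ps)
    case Nil
    show ?case by simp
  next
    case (Cons p ps)
    obtain r s where p: "p = (r, s)" by (cases p)
    have len: "dynkin_len (p # ps) = r + s + dynkin_len ps" by (simp add: p dynkin_len_def)
    have "0 < r + s" using Cons.prems by (simp add: p)
    moreover have "length ps \<le> dynkin_len ps" "set ps \<subseteq> {..dynkin_len ps} \<times> {..dynkin_len ps}"
      using Cons by simp_all
    moreover have "{..dynkin_len ps} \<times> {..dynkin_len ps} \<subseteq>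
        {..dynkin_len (p # ps)} \<times> {..dynkin_len (p # ps)}"
      unfolding len by (intro Sigma_mono) auto
    ultimately show ?case using len by (auto simp: p)
  qed
  then show "length ps \<le> dynkin_len ps" "set ps \<subseteq> {..dynkin_len ps} \<times> {..dynkin_len ps}"
    by blast+
qed

lemma finite_dynkin_index: "finite (dynkin_index d)"
proof -
  have "dynkin_index d \<subseteq> {ps. set ps \<subseteq> {..d} \<times> {..d} \<and> length ps \<le> d}"
  proof
    fix ps assume "ps \<in> dynkin_index d"
    then have "\<forall>(r, s)\<in>set ps. 0 < r + s" "dynkin_len ps \<le> d"
      by (auto simp: dynkin_index_def)
    moreover from this have "{..dynkin_len ps} \<times> {..dynkin_len ps} \<subseteq> {..d} \<times> {..d}"
      by (intro Sigma_mono) auto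
    ultimately show "ps \<in> {ps. set ps \<subseteq> {..d} \<times> {..d} \<and> length ps \<le> d}"
      using dynkin_len_bounds[of ps] by (simp add: subset_trans[where B="{..dynkin_len ps} \<times> {..dynkin_len ps}"])
  qed
  then show ?thesis
    by (rule finite_subset) (intro finite_lists_length_le finite_cartesian_product finite_atMost)
qed

lemma qdilog_scale:
  assumes "n \<in> latt_pos" "1 \<le> j"
  shows "qdilog \<delta> n a b (int j *s n) =
    (- 1) ^ (j + 1) / (of_nat j * qnum \<delta> (of_nat j * a)) * qpow \<delta> (of_nat j * b)"
proof -
  have "(\<Sum>i\<in>UNIV. n $ i) \<noteq> 0" using assms(1) by (simp add: latt_pos_def latt_deg_def)
  then obtain i where i: "n $ i \<noteq> 0" by (meson sum.neutral)
  have "int j' *s n = int j *s n \<longleftrightarrow> j' = j" for j'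
  proof
    assume "int j' *s n = int j *s n"
    then have "(int j' *s n) $ i = (int j *s n) $ i" by simp
    then show "j' = j" using i by simp
  qed simp
  with assms(2) have "{j'::nat. 1 \<le> j' \<and> int j' *s n = int j *s n} = {j}" by auto
  then show ?thesis by (simp add: qdilog_def)
qed

lemma lie_bracket_X_gen:
  fixes n n' :: "'r::finite latt"
  assumes "n \<in> latt_pos" "n' \<in> latt_pos"
  shows "lie_bracket \<omega> \<delta> (X_gen n) (X_gen n') = (\<lambda>m. qnum \<delta> (\<omega> n n') * X_gen (n + n') m)"
proof
  fix m :: "'r latt"
  let ?S = "{(n, n'). n \<in> latt_pos \<and> n' \<in> latt_pos \<and> n + n' = m}"
  have "lie_bracket \<omega> \<delta> (X_gen n) (X_gen n') m =
      (\<Sum>p\<in>?S. if p = (n, n') then qnum \<delta> (\<omega> n n') else 0)"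
    unfolding lie_bracket_def by (rule sum.cong) (auto simp: X_gen_def split: if_splits)
  also have "\<dots> = (if (n, n') \<in> ?S then qnum \<delta> (\<omega> n n') else 0)"
    using finite_latt_decomp[of m] by (rule sum.delta)
  also have "\<dots> = qnum \<delta> (\<omega> n n') * X_gen (n + n') m"
    using assms by (auto simp: X_gen_def)
  finally show "lie_bracket \<omega> \<delta> (X_gen n) (X_gen n') m = qnum \<delta> (\<omega> n n') * X_gen (n + n') m" .
qed

end

theory Submission
  imports Defs "HOL-Computational_Algebra.Formal_Power_Series"
begin

text \<open>
  Put \<open>v = q\<^bsup>c/4\<^esup>\<close>. The Lie algebra spanned by the \<open>X\<^bsub>in+jn'\<^esub>\<close> embeds, via commutators, into the
  completed quantum plane \<open>yx = v\<^sup>8xy\<close>, and Dynkin's series becomes \<open>log (exp X exp Y)\<close>: with a central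
  variable \<open>t\<close> and \<open>g = exp (tX) exp (tY)\<close>, the expansion
  \<open>t (log g)' = \<Sum>\<^sub>k (-1)\<^sup>k/(k+1) (Ad g - 1)\<^sup>k (t g' g\<^sup>-\<^sup>1)\<close> is Dynkin's series term by term.
  A quantum dilogarithm becomes a series \<open>\<Psi>\<^sub>s\<close> with \<open>\<Psi>\<^sub>s(s\<^sup>2p) = (1+sp) \<Psi>\<^sub>s(p)\<close>.

  Both sides of the identity are solutions of \<open>\<sigma>U = (1+vy) U\<close> with the same \<open>y\<^sup>0\<close> part, where \<open>\<sigma>\<close>
  scales \<open>y\<close> by \<open>v\<^sup>2\<close>; such a solution is unique. For the left side this is immediate. For the right
  side, the left-going product \<open>C\<close> is characterised by a first order difference equation
  \<open>\<tau>C = (1 + \<phi>(z) y) C\<close> in the coordinates \<open>z = xy\<^sup>2\<close> (normally ordered) and \<open>y\<close>, with \<open>\<phi>\<close> an explicit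
  rational function. The same solution intertwines the Hamiltonian \<open>1 + v(w+y)\<close>, \<open>w = xy\<close>, with a
  simpler one, and this yields the self-similarity \<open>C = \<gamma>(C) K\<close>, \<open>\<gamma>\<close> being the shear \<open>y \<mapsto> zy\<close>, which
  unrolls into the infinite product. The right-going product is its mirror image under \<open>w \<leftrightarrow> y\<close>, and the
  central factor is a function of \<open>z\<close> that solves the remaining scalar difference equation.
\<close>

text \<open>The factors on both sides of the centre accumulate at the ray of n + 2n', so no finite
  rearrangement of dilogarithms reaches the central block; a difference equation with a unique
  solution takes the place of rearrangement. It also dictates the functions involved. The central
  factor, a function of z on that ray, satisfies M(u^2 z) = f(z) M(z) with u = v^2: the dilogarithm
  \<open>psi u\<close> supplies the numerator 1 + uz of f, the doubling product supplies the
  denominator (1 - z)(1 - u^2 z). Since y M(z) = M(v^8 z) y, and v^8 = u^4, carrying y across M(z)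
  costs a factor f(z) f(u^2 z); for f(z) M(z) (1 + phi(z) y) to equal (f(z) + vy) M(z), phi(z) has
  to be v f(u^2 z). Beyond f(0) = 1, the shape of f enters the intertwining relation only through
  the scalar identity \<open>ff_identity\<close>.\<close>

section \<open>The completed quantum plane\<close>

text \<open>Exponents of the monomials \<open>x\<^sup>a y\<^sup>b t\<^sup>c\<close>. The central variable \<open>t\<close> serves only to prove Dynkin's
  formula; it does not count towards the degree \<open>dg\<close>.\<close>

datatype expo = Expo (xdeg: nat) (ydeg: nat) (tdeg: nat)

instantiation expo :: cancel_comm_monoid_add
begin

definition "0 = Expo 0 0 0"
definition "m + n = Expo (xdeg m + xdeg n) (ydeg m + ydeg n) (tdeg m + tdeg n)"
definition "m - n = Expo (xdeg m - xdeg n) (ydeg m - ydeg n) (tdeg m - tdeg n)"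

instance
  by standard (auto simp: zero_expo_def plus_expo_def minus_expo_def)

end

lemma expo_add [simp]: "Expo a b c + Expo a' b' c' = Expo (a + a') (b + b') (c + c')"
  by (simp add: plus_expo_def)

lemma expo_sel_add [simp]:
  "xdeg (m + n) = xdeg m + xdeg n" "ydeg (m + n) = ydeg m + ydeg n" "tdeg (m + n) = tdeg m + tdeg n"
  by (simp_all add: plus_expo_def)

lemma expo_sel_zero [simp]: "xdeg 0 = 0" "ydeg 0 = 0" "tdeg 0 = 0"
  by (simp_all add: zero_expo_def)

lemma Expo_eq_0 [simp]: "Expo a b c = 0 \<longleftrightarrow> a = 0 \<and> b = 0 \<and> c = 0"
  by (simp add: zero_expo_def)

text \<open>With \<open>x\<close> for n and \<open>y\<close> for n', the pairing of in+jn' with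
  i'n+j'n' is \<open>c\<close> times this form. Its antisymmetry makes the commutator of two
  monomials their product monomial times the numerator of a q-number.\<close>

definition frm :: "expo \<Rightarrow> expo \<Rightarrow> int" where
  "frm m m' = int (ydeg m) * int (xdeg m') - int (xdeg m) * int (ydeg m')"

definition dg :: "expo \<Rightarrow> nat" where
  "dg m = xdeg m + ydeg m"

lemma frm_add_left: "frm (m + m') n = frm m n + frm m' n"
  and frm_add_right: "frm n (m + m') = frm n m + frm n m'"
  by (simp_all add: frm_def algebra_simps)

lemma frm_zero [simp]: "frm 0 m = 0" "frm m 0 = 0"
  by (simp_all add: frm_def)

lemma frm_self [simp]: "frm m m = 0"
  by (simp add: frm_def)

lemma frm_swap: "frm m n = - frm n m"
  by (simp add: frm_def)

lemma dg_add [simp]: "dg (m + m') = dg m + dg m'"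
  by (simp add: dg_def)

lemma dg_zero [simp]: "dg 0 = 0"
  by (simp add: dg_def)

section \<open>Sums over the splittings of an exponent\<close>

definition decomp :: "expo \<Rightarrow> (expo \<times> expo) set" where
  "decomp m = {(m1, m2). m1 + m2 = m}"

lemma finite_below: "finite {m1::expo. \<exists>m2. m1 + m2 = m}"
proof (rule finite_subset)
  show "{m1::expo. \<exists>m2. m1 + m2 = m} \<subseteq>
      (\<lambda>(a, b, c). Expo a b c) ` ({..xdeg m} \<times> {..ydeg m} \<times> {..tdeg m})"
  proof
    fix m1 assume "m1 \<in> {m1::expo. \<exists>m2. m1 + m2 = m}"
    then have "(xdeg m1, ydeg m1, tdeg m1) \<in> {..xdeg m} \<times> {..ydeg m} \<times> {..tdeg m}"
      by auto
    then show "m1 \<in> (\<lambda>(a, b, c). Expo a b c) ` ({..xdeg m} \<times> {..ydeg m} \<times> {..tdeg m})"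
      by (rule rev_image_eqI) simp
  qed
qed auto

lemma finite_decomp [simp]: "finite (decomp m)"
proof (rule finite_subset)
  show "decomp m \<subseteq> {m1. \<exists>m2. m1 + m2 = m} \<times> {m1. \<exists>m2. m1 + m2 = m}"
    unfolding decomp_def by auto (metis add.commute)
  show "finite ({m1. \<exists>m2. m1 + m2 = m} \<times> {m1. \<exists>m2. m1 + m2 = m})"
    using finite_below by blast
qed

lemma sum_decomp_fst_delta:
  fixes h :: "expo \<Rightarrow> expo \<Rightarrow> 'a::comm_monoid_add"
  shows "(\<Sum>(m1, m2)\<in>decomp m. if m1 = n then h m1 m2 else 0) =
    (if \<exists>m2. n + m2 = m then h n (m - n) else 0)"
proof (cases "\<exists>m2. n + m2 = m")
  case True
  then obtain m2 where m2: "n + m2 = m" by blast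
  have "(\<Sum>p\<in>decomp m. case p of (m1, m2) \<Rightarrow> if m1 = n then h m1 m2 else 0) =
     (\<Sum>p\<in>decomp m. if p = (n, m2) then h n m2 else 0)"
    by (rule sum.cong) (use m2 in \<open>auto simp: decomp_def split: if_splits\<close>)
  also have "\<dots> = (if (n, m2) \<in> decomp m then h n m2 else 0)"
    by (simp only: sum.delta finite_decomp)
  also have "\<dots> = h n m2" using m2 by (simp add: decomp_def)
  finally show ?thesis using m2 by auto
next
  case False
  then show ?thesis by (auto simp: decomp_def intro!: sum.neutral)
qed

lemma sum_decomp_swap:
  "(\<Sum>(m1, m2)\<in>decomp m. h m1 m2) = (\<Sum>(m1, m2)\<in>decomp m. h m2 m1)"
  by (rule sum.reindex_bij_witness[of _ prod.swap prod.swap]) (auto simp: decomp_def add.commute)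

lemma sum_decomp_assoc:
  "(\<Sum>(m12, m3)\<in>decomp m. \<Sum>(m1, m2)\<in>decomp m12. h m1 m2 m3) =
   (\<Sum>(m1, m23)\<in>decomp m. \<Sum>(m2, m3)\<in>decomp m23. h m1 m2 m3)"
proof -
  have "(\<Sum>p\<in>decomp m. \<Sum>(m1, m2)\<in>decomp (fst p). h m1 m2 (snd p)) =
    (\<Sum>(p, r)\<in>(SIGMA p:decomp m. decomp (fst p)). h (fst r) (snd r) (snd p))"
    by (subst sum.Sigma[symmetric]) (auto simp: case_prod_unfold)
  also have "\<dots> = (\<Sum>(p, r)\<in>(SIGMA p:decomp m. decomp (snd p)). h (fst p) (fst r) (snd r))"
    by (rule sum.reindex_bij_witness[of _ "\<lambda>(p, r). ((fst p + fst r, snd r), (fst p, fst r))"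
          "\<lambda>(p, r). ((fst r, snd r + snd p), (snd r, snd p))"])
       (auto simp: decomp_def add.assoc)
  also have "\<dots> = (\<Sum>p\<in>decomp m. \<Sum>(m2, m3)\<in>decomp (snd p). h (fst p) m2 m3)"
    by (subst sum.Sigma[symmetric]) (auto simp: case_prod_unfold)
  finally show ?thesis by (simp add: case_prod_unfold)
qed

text \<open>Inside the quantum plane the indeterminate itself plays the role of \<open>q\<^bsup>c/4\<^esup>\<close>; the actual value, a
  power of \<open>qroot\<close>, is substituted afterwards by \<open>theta\<close>. This keeps the plane a fixed type.\<close>

abbreviation v :: qfield where "v \<equiv> qroot"

lemma qroot_power: "qroot ^ k = Fract (monom 1 k) 1"
  proof (induction k)
  case (Suc k)
  then show ?case by (simp add: qroot_def monom_Suc)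
qed (simp add: One_fract_def)

lemma qroot_nonzero [simp]: "qroot \<noteq> 0"
  by (simp add: qroot_def Zero_fract_def eq_fract)

lemma qroot_power_neq_1 [simp]: "0 < k \<Longrightarrow> qroot ^ k \<noteq> 1"
  unfolding qroot_power One_fract_def
  by (auto simp: eq_fract monom_eq_1_iff)

definition vp :: "int \<Rightarrow> qfield" where "vp i = v powi i"

lemma vp_add: "vp (i + j) = vp i * vp j"
  by (simp add: vp_def power_int_add)

lemma vp_0 [simp]: "vp 0 = 1"
  by (simp add: vp_def)

lemma vp_of_nat: "vp (int k) = v ^ k"
  by (simp add: vp_def)

lemma vp_nonzero [simp]: "vp i \<noteq> 0"
  by (simp add: vp_def)

lemma vp_minus: "vp (- i) = inverse (vp i)"
  by (simp add: vp_def power_int_minus)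

text \<open>\<open>cf F m\<close> is the coefficient of the normally ordered monomial \<open>e\<^sub>m\<close>, where
  \<open>e\<^sub>m e\<^sub>n = v\<^bsup>4 frm m n\<^esup> e\<^bsub>m+n\<^esub>\<close>.\<close>

typedef qplane = "UNIV :: (expo \<Rightarrow> qfield) set"
  morphisms cf Abs_qplane ..

lemma qplane_eqI: "(\<And>m. cf F m = cf G m) \<Longrightarrow> F = G"
  using cf_inject by blast

lemma cf_Abs [simp]: "cf (Abs_qplane h) = h"
  by (simp add: Abs_qplane_inverse)

instantiation qplane :: ring_1
begin

definition "0 = Abs_qplane (\<lambda>_. 0)"
definition "1 = Abs_qplane (\<lambda>m. if m = 0 then 1 else 0)"
definition "F + G = Abs_qplane (\<lambda>m. cf F m + cf G m)"
definition "F - G = Abs_qplane (\<lambda>m. cf F m - cf G m)"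
definition "- F = Abs_qplane (\<lambda>m. - cf F m)"
definition "F * G = Abs_qplane (\<lambda>m. \<Sum>(m1, m2)\<in>decomp m. cf F m1 * cf G m2 * vp (4 * frm m1 m2))"

instance
proof
  fix F G H :: qplane
  show "F + G + H = F + (G + H)" "F + G = G + F" "0 + F = F" "- F + F = 0" "F - G = F + - G"
    by (rule qplane_eqI; simp add: plus_qplane_def zero_qplane_def minus_qplane_def uminus_qplane_def)+
  show "(F + G) * H = F * H + G * H" "F * (G + H) = F * G + F * H"
    by (rule qplane_eqI; simp add: plus_qplane_def times_qplane_def case_prod_unfold
        sum.distrib[symmetric] algebra_simps)+
  show "(0::qplane) \<noteq> 1"
  proof
    assume "(0::qplane) = 1"
    then have "cf 0 0 = cf 1 0" by simp
    then show False by (simp add: zero_qplane_def one_qplane_def)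
  qed
  show one_left: "1 * F = F"
  proof (rule qplane_eqI)
    fix m
    have "cf (1 * F) m = (\<Sum>(m1, m2)\<in>decomp m. if m1 = 0 then cf F m2 else 0)"
      unfolding times_qplane_def one_qplane_def cf_Abs
      by (rule sum.cong) auto
    also have "\<dots> = cf F m" by (subst sum_decomp_fst_delta) (simp)
    finally show "cf (1 * F) m = cf F m" .
  qed
  show "F * 1 = F"
  proof (rule qplane_eqI)
    fix m
    have "cf (F * 1) m = (\<Sum>(m1, m2)\<in>decomp m. if m2 = 0 then cf F m1 else 0)"
      unfolding times_qplane_def one_qplane_def cf_Abs
      by (rule sum.cong) auto
    also have "\<dots> = (\<Sum>(m1, m2)\<in>decomp m. if m1 = 0 then cf F m2 else 0)"
      by (rule sum_decomp_swap)
    also have "\<dots> = cf F m" by (subst sum_decomp_fst_delta) (simp)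
    finally show "cf (F * 1) m = cf F m" .
  qed
  show "F * G * H = F * (G * H)"
  proof (rule qplane_eqI)
    fix m
    \<comment> \<open>Bilinearity of \<open>frm\<close> gives both bracketings the same exponent, so
      only the index set has to be reassociated.\<close>
    let ?h = "\<lambda>m1 m2 m3. cf F m1 * cf G m2 * cf H m3 * vp (4 * (frm m1 m2 + frm m1 m3 + frm m2 m3))"
    have "cf (F * G * H) m = (\<Sum>(m12, m3)\<in>decomp m. \<Sum>(m1, m2)\<in>decomp m12. ?h m1 m2 m3)"
      unfolding times_qplane_def cf_Abs
      by (auto intro!: sum.cong simp: sum_distrib_right sum_distrib_left case_prod_unfold decomp_def
          frm_add_left vp_add ring_distribs mult_ac)
    also have "\<dots> = (\<Sum>(m1, m23)\<in>decomp m. \<Sum>(m2, m3)\<in>decomp m23. ?h m1 m2 m3)"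
      by (rule sum_decomp_assoc)
    also have "\<dots> = cf (F * (G * H)) m"
      unfolding times_qplane_def cf_Abs
      by (auto intro!: sum.cong simp: sum_distrib_right sum_distrib_left case_prod_unfold decomp_def
          frm_add_right vp_add ring_distribs mult_ac)
    finally show "cf (F * G * H) m = cf (F * (G * H)) m" .
  qed
qed

end

lemma cf_zero [simp]: "cf 0 m = 0"
  and cf_one: "cf 1 m = (if m = 0 then 1 else 0)"
  and cf_add [simp]: "cf (F + G) m = cf F m + cf G m"
  and cf_diff [simp]: "cf (F - G) m = cf F m - cf G m"
  and cf_uminus [simp]: "cf (- F) m = - cf F m"
  and cf_mult: "cf (F * G) m = (\<Sum>(m1, m2)\<in>decomp m. cf F m1 * cf G m2 * vp (4 * frm m1 m2))"
  by (simp_all add: zero_qplane_def one_qplane_def plus_qplane_def minus_qplane_def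
      uminus_qplane_def times_qplane_def)

lemma cf_sum [simp]: "cf (\<Sum>i\<in>I. f i) m = (\<Sum>i\<in>I. cf (f i) m)"
  by (induction I rule: infinite_finite_induct) simp_all

section \<open>Monomials and scalars\<close>

definition mon :: "expo \<Rightarrow> qplane" where
  "mon n = Abs_qplane (\<lambda>m. if m = n then 1 else 0)"

lemma cf_mon: "cf (mon n) m = (if m = n then 1 else 0)"
  by (simp add: mon_def)

lemma cf_mon_mult: "cf (mon n * F) m =
    (if \<exists>m2. n + m2 = m then cf F (m - n) * vp (4 * frm n (m - n)) else 0)"
proof -
  have "cf (mon n * F) m = (\<Sum>(m1, m2)\<in>decomp m. if m1 = n then cf F m2 * vp (4 * frm m1 m2) else 0)"
    unfolding cf_mult cf_mon by (rule sum.cong) auto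
  then show ?thesis by (subst (asm) sum_decomp_fst_delta) simp
qed

lemma cf_mon_mult_add [simp]: "cf (mon n * F) (n + m) = cf F m * vp (4 * frm n m)"
  by (subst cf_mon_mult) auto

text \<open>Scalars enter as central ring elements, so every linearity statement stays inside one
  ring.\<close>

definition kc :: "qfield \<Rightarrow> qplane" where
  "kc a = Abs_qplane (\<lambda>m. if m = 0 then a else 0)"

lemma cf_kc: "cf (kc a) m = (if m = 0 then a else 0)"
  by (simp add: kc_def)

lemma cf_kc_mult [simp]: "cf (kc a * F) m = a * cf F m"
proof -
  have "cf (kc a * F) m = (\<Sum>(m1, m2)\<in>decomp m. if m1 = 0 then a * cf F m2 else 0)"
    unfolding cf_mult cf_kc by (rule sum.cong) auto
  also have "\<dots> = a * cf F m" by (subst sum_decomp_fst_delta) simp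
  finally show ?thesis .
qed

lemma kc_commute: "F * kc a = kc a * F"
proof (rule qplane_eqI)
  fix m
  have "cf (F * kc a) m = (\<Sum>(m1, m2)\<in>decomp m. if m2 = 0 then a * cf F m1 else 0)"
    unfolding cf_mult cf_kc by (rule sum.cong) auto
  also have "\<dots> = (\<Sum>(m1, m2)\<in>decomp m. if m1 = 0 then a * cf F m2 else 0)"
    by (rule sum_decomp_swap)
  also have "\<dots> = a * cf F m" by (subst sum_decomp_fst_delta) simp
  finally show "cf (F * kc a) m = cf (kc a * F) m" by simp
qed

lemma kc_left_commute: "F * (kc a * G) = kc a * (F * G)"
  by (metis kc_commute mult.assoc)

lemma kc_0 [simp]: "kc 0 = 0"
  and kc_1 [simp]: "kc 1 = 1"
  and kc_add: "kc (a + b) = kc a + kc b"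
  and kc_diff: "kc (a - b) = kc a - kc b"
  and kc_uminus: "kc (- a) = - kc a"
  and kc_mult: "kc (a * b) = kc a * kc b"
  by (rule qplane_eqI; simp add: cf_kc cf_one)+

lemma kc_sum: "kc (\<Sum>i\<in>I. f i) = (\<Sum>i\<in>I. kc (f i))"
  by (induction I rule: infinite_finite_induct) (simp_all add: kc_add)

lemma kc_mult_left: "kc a * (kc b * F) = kc (a * b) * F"
  by (simp add: kc_mult mult.assoc)

lemma mon_mult: "mon m * mon n = kc (vp (4 * frm m n)) * mon (m + n)"
proof (rule qplane_eqI)
  fix k
  show "cf (mon m * mon n) k = cf (kc (vp (4 * frm m n)) * mon (m + n)) k"
    by (auto simp: cf_mon_mult cf_mon)
qed

lemma mon_0 [simp]: "mon 0 = 1"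
  by (rule qplane_eqI) (simp add: cf_mon cf_one)

lemma mon_power: "mon (Expo a b c) ^ k = mon (Expo (k * a) (k * b) (k * c))"
proof (induction k)
  case 0
  show ?case by (simp add: zero_expo_def[symmetric])
next
  case (Suc k)
  have "frm (Expo a b c) (Expo (k * a) (k * b) (k * c)) = 0" by (simp add: frm_def)
  then show ?case using Suc by (simp add: mon_mult)
qed

section \<open>The degree filtration\<close>

definition ge :: "nat \<Rightarrow> qplane \<Rightarrow> bool" where
  "ge l F \<longleftrightarrow> (\<forall>m. dg m < l \<longrightarrow> cf F m = 0)"

lemma ge_0 [simp]: "ge 0 F"
  by (simp add: ge_def)

lemma ge_zero [simp]: "ge l 0"
  by (simp add: ge_def)

lemma ge_mono: "ge l F \<Longrightarrow> k \<le> l \<Longrightarrow> ge k F"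
  by (simp add: ge_def)

lemma ge_add: "ge l F \<Longrightarrow> ge l G \<Longrightarrow> ge l (F + G)"
  and ge_diff: "ge l F \<Longrightarrow> ge l G \<Longrightarrow> ge l (F - G)"
  and ge_uminus: "ge l F \<Longrightarrow> ge l (- F)"
  and ge_kc_mult: "ge l F \<Longrightarrow> ge l (kc a * F)"
  by (simp_all add: ge_def)

lemma ge_sum: "(\<And>i. i \<in> I \<Longrightarrow> ge l (f i)) \<Longrightarrow> ge l (\<Sum>i\<in>I. f i)"
  by (simp add: ge_def)

lemma ge_mult:
  assumes "ge k F" "ge l G"
  shows "ge (k + l) (F * G)"
  unfolding ge_def
proof (intro allI impI)
  fix m assume m: "dg m < k + l"
  have "cf F m1 * cf G m2 * vp (4 * frm m1 m2) = 0" if "(m1, m2) \<in> decomp m" for m1 m2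
  proof -
    have "dg m1 + dg m2 = dg m" using that by (auto simp: decomp_def)
    then have "dg m1 < k \<or> dg m2 < l" using m by linarith
    then show ?thesis using assms by (auto simp: ge_def)
  qed
  then show "cf (F * G) m = 0" unfolding cf_mult by (auto intro!: sum.neutral)
qed

lemma ge_mult_left: "ge l G \<Longrightarrow> ge l (F * G)"
  using ge_mult[of 0 F l G] by simp

lemma ge_mult_right: "ge l F \<Longrightarrow> ge l (F * G)"
  using ge_mult[of l F 0 G] by simp

lemma ge_power: "ge 1 p \<Longrightarrow> ge k (p ^ k)"
proof (induction k)
  case (Suc k)
  then show ?case using ge_mult[of 1 p k "p ^ k"] by simp
qed simp

lemma ge_mon: "ge l (mon m) \<longleftrightarrow> l \<le> dg m"
  by (auto simp: ge_def cf_mon not_less[symmetric])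

lemma qplane_eq_ge: "(\<And>l. ge l (F - G)) \<Longrightarrow> F = G"
proof (rule qplane_eqI)
  fix m assume "\<And>l. ge l (F - G)"
  then have "ge (Suc (dg m)) (F - G)" .
  then show "cf F m = cf G m" by (simp add: ge_def)
qed

section \<open>Convergent infinite sums\<close>

notation fps_nth (infixl \<open>$$\<close> 75)

text \<open>Otherwise the premises \<open>ge 1 p\<close> below are not in simp normal form.\<close>

declare One_nat_def [simp del]

text \<open>Meaningful only if the \<open>k\<close>-th term has order at least \<open>k\<close>.\<close>

definition psum :: "(nat \<Rightarrow> qplane) \<Rightarrow> qplane" where
  "psum s = Abs_qplane (\<lambda>m. \<Sum>k\<le>dg m. cf (s k) m)"

text \<open>Terms with index beyond \<open>dg m\<close> vanish at \<open>m\<close>, so any larger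
  cutoff gives the same value; a common cutoff is what allows different sums to be compared.\<close>

lemma cf_psum:
  assumes "\<And>k. ge k (s k)" "dg m \<le> N"
  shows "cf (psum s) m = (\<Sum>k\<le>N. cf (s k) m)"
proof -
  have "(\<Sum>k\<le>N. cf (s k) m) = (\<Sum>k\<le>dg m. cf (s k) m)"
    by (rule sum.mono_neutral_right) (use assms in \<open>auto simp: ge_def\<close>)
  then show ?thesis by (simp add: psum_def)
qed

lemma psum_approx:
  assumes "\<And>k. ge k (s k)"
  shows "ge N (psum s - (\<Sum>k<N. s k))"
  unfolding ge_def
proof (intro allI impI)
  fix m assume m: "dg m < N"
  then obtain M where N: "N = Suc M" by (cases N) auto
  then have "cf (psum s) m = (\<Sum>k\<le>M. cf (s k) m)" using assms m by (intro cf_psum) auto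
  then show "cf (psum s - (\<Sum>k<N. s k)) m = 0" by (simp add: N lessThan_Suc_atMost)
qed

lemma psum_unique:
  assumes "\<And>k. ge k (s k)" "\<And>N. ge N (F - (\<Sum>k<N. s k))"
  shows "F = psum s"
proof (rule qplane_eq_ge)
  fix l
  have "F - psum s = (F - (\<Sum>k<l. s k)) - (psum s - (\<Sum>k<l. s k))" by simp
  then show "ge l (F - psum s)" using ge_diff[OF assms(2) psum_approx[OF assms(1)]] by metis
qed

lemma psum_cong: "(\<And>k. s k = s' k) \<Longrightarrow> psum s = psum s'"
proof -
  assume "\<And>k. s k = s' k"
  then have "s = s'" by (rule ext)
  then show ?thesis by simp
qed

lemma ge_psum:
  assumes "\<And>k. ge k (s k)" "\<And>k. ge l (s k)"
  shows "ge l (psum s)"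
  using assms by (simp add: ge_def psum_def)

text \<open>An additive map that does not lower the order is continuous for the filtration, hence
  commutes with convergent sums.\<close>

lemma psum_map:
  assumes s: "\<And>k. ge k (s k)"
    and add: "\<And>F G. \<phi> (F + G) = \<phi> F + \<phi> G"
    and ge: "\<And>l F. ge l F \<Longrightarrow> ge l (\<phi> F)"
  shows "\<phi> (psum s) = psum (\<lambda>k. \<phi> (s k))"
proof (rule psum_unique)
  show "ge k (\<phi> (s k))" for k using s ge by blast
  have zero: "\<phi> 0 = 0" using add[of 0 0] by simp
  have diff: "\<phi> (F - G) = \<phi> F - \<phi> G" for F G using add[of "F - G" G] by simp
  have sum: "\<phi> (\<Sum>k<N. s k) = (\<Sum>k<N. \<phi> (s k))" for N
    by (induction N) (simp_all add: zero add)
  show "ge N (\<phi> (psum s) - (\<Sum>k<N. \<phi> (s k)))" for N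
    unfolding sum[symmetric] diff[symmetric] by (intro ge psum_approx s)
qed

lemma psum_mult_left: "(\<And>k. ge k (s k)) \<Longrightarrow> F * psum s = psum (\<lambda>k. F * s k)"
  by (rule psum_map) (simp_all add: distrib_left ge_mult_left)

lemma psum_mult_right: "(\<And>k. ge k (s k)) \<Longrightarrow> psum s * F = psum (\<lambda>k. s k * F)"
  by (rule psum_map[where \<phi> = "\<lambda>G. G * F"]) (simp_all add: distrib_right ge_mult_right)

lemma psum_add: "psum s + psum s' = psum (\<lambda>k. s k + s' k)"
  by (rule qplane_eqI) (simp add: psum_def sum.distrib)

lemma psum_diff: "psum s - psum s' = psum (\<lambda>k. s k - s' k)"
  by (rule qplane_eqI) (simp add: psum_def sum_subtractf)

lemma psum_Suc:
  assumes "\<And>k. ge k (s k)"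
  shows "psum s = s 0 + psum (\<lambda>k. s (Suc k))"
proof (rule qplane_eqI)
  fix m
  have "ge k (s (Suc k))" for k by (rule ge_mono[OF assms]) simp
  then have "cf (psum (\<lambda>k. s (Suc k))) m = (\<Sum>k\<le>dg m. cf (s (Suc k)) m)"
    by (rule cf_psum) simp
  moreover have "cf (psum s) m = (\<Sum>k\<le>Suc (dg m). cf (s k) m)" by (rule cf_psum[OF assms]) simp
  ultimately show "cf (psum s) m = cf (s 0 + psum (\<lambda>k. s (Suc k))) m"
    by (simp only: sum.atMost_Suc_shift cf_add)
qed

lemma psum_mult:
  assumes s: "\<And>k. ge k (s k)" and t: "\<And>k. ge k (t k)"
  shows "psum s * psum t = psum (\<lambda>n. \<Sum>i\<le>n. s i * t (n - i))"
proof (rule psum_unique)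
  have st: "ge (i + j) (s i * t j)" for i j using ge_mult s t by blast
  show "ge k (\<Sum>i\<le>k. s i * t (k - i))" for k
  proof (rule ge_sum)
    fix i assume "i \<in> {..k}"
    then show "ge k (s i * t (k - i))" using st[of i "k - i"] by simp
  qed
  fix N
  let ?S = "\<Sum>i<N. s i" and ?T = "\<Sum>j<N. t j"
  have 1: "ge N (psum s * psum t - ?S * ?T)"
  proof -
    have "psum s * psum t - ?S * ?T = (psum s - ?S) * psum t + ?S * (psum t - ?T)"
      by (simp add: algebra_simps)
    then show ?thesis
      using ge_add[OF ge_mult_right[OF psum_approx[OF s]] ge_mult_left[OF psum_approx[OF t]]] by metis
  qed
  \<comment> \<open>The square of index pairs exceeds the triangle i + j < N only by products of
    order at least N.\<close>
  have 2: "ge N (?S * ?T - (\<Sum>k<N. \<Sum>i\<le>k. s i * t (k - i)))"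
  proof -
    have "(\<Sum>k<N. \<Sum>i\<le>k. s i * t (k - i)) = (\<Sum>(i, j)\<in>{(i, j). i + j < N}. s i * t j)"
      by (rule sum.triangle_reindex[symmetric])
    moreover have "?S * ?T = (\<Sum>(i, j)\<in>{..<N} \<times> {..<N}. s i * t j)"
      by (simp add: sum_product sum.cartesian_product)
    moreover have "(\<Sum>(i, j)\<in>{..<N} \<times> {..<N}. s i * t j) =
       (\<Sum>(i, j)\<in>({..<N} \<times> {..<N}) - {(i, j). i + j < N}. s i * t j) + (\<Sum>(i, j)\<in>{(i, j). i + j < N}. s i * t j)"
      by (rule sum.subset_diff) auto
    ultimately have "?S * ?T - (\<Sum>k<N. \<Sum>i\<le>k. s i * t (k - i)) =
        (\<Sum>(i, j)\<in>({..<N} \<times> {..<N}) - {(i, j). i + j < N}. s i * t j)" by simp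
    moreover have "ge N (\<Sum>(i, j)\<in>({..<N} \<times> {..<N}) - {(i, j). i + j < N}. s i * t j)"
      by (rule ge_sum) (auto simp: not_less intro: ge_mono[OF st])
    ultimately show ?thesis by metis
  qed
  show "ge N (psum s * psum t - (\<Sum>k<N. \<Sum>i\<le>k. s i * t (k - i)))"
    using ge_add[OF 1 2] by simp
qed

section \<open>Substitution into power series, exponential and logarithm\<close>

definition ev :: "qfield fps \<Rightarrow> qplane \<Rightarrow> qplane" where
  "ev F p = psum (\<lambda>k. kc (F $$ k) * p ^ k)"

context
  fixes p :: qplane
  assumes p: "ge 1 p"
begin

notation fps_nth (infixl \<open>$$\<close> 75)

lemma ge_ev_term: "ge k (kc a * p ^ k)"
  by (intro ge_kc_mult ge_power p)

lemma ev_add: "ev (F + G) p = ev F p + ev G p"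
  unfolding ev_def psum_add by (simp add: kc_add distrib_right)

lemma ev_diff: "ev (F - G) p = ev F p - ev G p"
  unfolding ev_def psum_diff by (simp add: kc_diff left_diff_distrib)

lemma ev_mult: "ev (F * G) p = ev F p * ev G p"
proof -
  have "ev F p * ev G p = psum (\<lambda>n. \<Sum>i\<le>n. kc (F $$ i) * p ^ i * (kc (G $$ (n - i)) * p ^ (n - i)))"
    unfolding ev_def by (rule psum_mult) (rule ge_ev_term)+
  also have "\<dots> = ev (F * G) p" unfolding ev_def
  proof (rule psum_cong)
    fix n
    have "kc (F $$ i) * p ^ i * (kc (G $$ (n - i)) * p ^ (n - i)) = kc (F $$ i * G $$ (n - i)) * p ^ n"
      if "i \<le> n" for i
    proof -
      have "kc (F $$ i) * p ^ i * (kc (G $$ (n - i)) * p ^ (n - i)) =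
         kc (F $$ i) * (p ^ i * kc (G $$ (n - i))) * p ^ (n - i)" by (simp add: mult.assoc)
      also have "\<dots> = kc (F $$ i * G $$ (n - i)) * (p ^ i * p ^ (n - i))"
        by (subst kc_commute) (simp add: kc_mult mult.assoc)
      finally show ?thesis using that by (simp add: power_add[symmetric])
    qed
    then show "(\<Sum>i\<le>n. kc (F $$ i) * p ^ i * (kc (G $$ (n - i)) * p ^ (n - i))) = kc ((F * G) $$ n) * p ^ n"
      by (simp add: fps_mult_nth kc_sum sum_distrib_right atLeast0AtMost)
  qed
  finally show ?thesis by simp
qed

lemma ev_finite:
  assumes "\<And>k. k > N \<Longrightarrow> F $$ k = 0"
  shows "ev F p = (\<Sum>k\<le>N. kc (F $$ k) * p ^ k)"
proof (rule qplane_eqI)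
  fix m
  have "cf (ev F p) m = (\<Sum>k\<le>max N (dg m). cf (kc (F $$ k) * p ^ k) m)"
    unfolding ev_def by (rule cf_psum) (auto intro: ge_ev_term)
  also have "\<dots> = (\<Sum>k\<le>N. cf (kc (F $$ k) * p ^ k) m)"
    by (rule sum.mono_neutral_right) (auto simp: assms)
  finally show "cf (ev F p) m = cf (\<Sum>k\<le>N. kc (F $$ k) * p ^ k) m" by simp
qed

lemma ev_const [simp]: "ev (fps_const a) p = kc a"
  by (subst ev_finite[where N = 0]) auto

lemma ev_one [simp]: "ev 1 p = 1"
  using ev_const[of 1] by simp

lemma ev_X [simp]: "ev fps_X p = p"
  by (subst ev_finite[where N = 1]) (auto simp: One_nat_def)

lemma ev_power: "ev (F ^ k) p = ev F p ^ k"
  by (induction k) (simp_all add: ev_mult)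

lemma ge_ev: "F $$ 0 = 0 \<Longrightarrow> ge 1 (ev F p)"
  unfolding ev_def
proof (rule ge_psum)
  fix k assume "F $$ 0 = 0"
  then show "ge 1 (kc (F $$ k) * p ^ k)"
    using ge_mono[OF ge_power[OF p, of k], of 1] by (cases k) (auto intro: ge_kc_mult)
qed (rule ge_ev_term)

text \<open>At a fixed monomial all sums may be cut at its degree, after which exchanging the
  summations is finite.\<close>

lemma ev_compose:
  assumes G: "G $$ 0 = 0"
  shows "ev (F oo G) p = ev F (ev G p)"
proof (rule qplane_eqI)
  fix m
  let ?N = "dg m"
  have g: "ge 1 (ev G p)" by (rule ge_ev[OF G])
  have "cf (ev F (ev G p)) m = (\<Sum>k\<le>?N. F $$ k * cf (ev (G ^ k) p) m)"
    unfolding ev_power unfolding ev_def[of F] by (simp add: psum_def)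
  also have "\<dots> = (\<Sum>k\<le>?N. F $$ k * (\<Sum>j\<le>?N. G ^ k $$ j * cf (p ^ j) m))"
    by (simp add: ev_def psum_def)
  also have "\<dots> = (\<Sum>j\<le>?N. (\<Sum>k\<le>?N. F $$ k * G ^ k $$ j) * cf (p ^ j) m)"
    by (simp add: sum_distrib_left sum_distrib_right mult.assoc) (rule sum.swap)
  also have "\<dots> = (\<Sum>j\<le>?N. (F oo G) $$ j * cf (p ^ j) m)"
  proof (rule sum.cong[OF refl])
    fix j assume j: "j \<in> {..?N}"
    have "(\<Sum>k\<le>?N. F $$ k * G ^ k $$ j) = (\<Sum>k\<le>j. F $$ k * G ^ k $$ j)"
      by (rule sum.mono_neutral_right) (use j G in \<open>auto simp: startsby_zero_power_prefix\<close>)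
    then show "(\<Sum>k\<le>?N. F $$ k * G ^ k $$ j) * cf (p ^ j) m = (F oo G) $$ j * cf (p ^ j) m"
      by (simp add: fps_compose_nth atLeast0AtMost)
  qed
  also have "\<dots> = cf (ev (F oo G) p) m" by (simp add: ev_def psum_def)
  finally show "cf (ev (F oo G) p) m = cf (ev F (ev G p)) m" by simp
qed

lemma ev_scale: "ev F (kc a * p) = ev (F oo (fps_const a * fps_X)) p"
  by (subst ev_compose) (simp_all add: ev_mult)

lemma ev_intertwine:
  assumes "ge 1 p'" "c * p = p' * c"
  shows "c * ev F p = ev F p' * c"
proof -
  have pw: "c * p ^ k = p' ^ k * c" for k
    by (induction k) (simp_all add: assms(2) mult.assoc, metis assms(2) mult.assoc)
  have "c * ev F p = psum (\<lambda>k. c * (kc (F $$ k) * p ^ k))"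
    unfolding ev_def by (rule psum_mult_left) (rule ge_ev_term)
  also have "\<dots> = psum (\<lambda>k. kc (F $$ k) * p' ^ k * c)"
    by (simp add: kc_left_commute pw mult.assoc)
  also have "\<dots> = ev F p' * c"
    unfolding ev_def by (rule psum_mult_right[symmetric]) (intro ge_kc_mult ge_power assms)
  finally show ?thesis .
qed

text \<open>Compatibility with the powers of \<open>p\<close> stands in for multiplicativity, so
  that the lemma also covers anti-automorphisms and \<open>at1\<close>, which is multiplicative only
  on series bounded in \<open>t\<close>.\<close>

lemma ev_map:
  assumes add: "\<And>F G. \<phi> (F + G) = \<phi> F + \<phi> G"
    and scale: "\<And>a F. \<phi> (kc a * F) = kc a * \<phi> F"
    and ge: "\<And>l F. ge l F \<Longrightarrow> ge l (\<phi> F)"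
    and pow: "\<And>k. \<phi> (p ^ k) = \<phi> p ^ k"
  shows "\<phi> (ev F p) = ev F (\<phi> p)"
  unfolding ev_def by (subst psum_map[where \<phi> = \<phi>, OF ge_ev_term add ge]) (simp_all add: scale pow)

end

definition pexp :: "qplane \<Rightarrow> qplane" where "pexp X = ev (fps_exp 1) X"

definition plog :: "qplane \<Rightarrow> qplane" where "plog g = ev (fps_ln 1) (g - 1)"

lemma ge_pexp: "ge 1 X \<Longrightarrow> ge 1 (pexp X - 1)"
  using ge_ev[of X "fps_exp 1 - 1"] by (simp add: pexp_def ev_diff)

lemma ge_plog: "ge 1 (g - 1) \<Longrightarrow> ge 1 (plog g)"
  by (simp add: plog_def ge_ev)

lemma fps_ln_compose: "fps_ln 1 oo (fps_exp 1 - 1) = (fps_X :: qfield fps)"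
  "(fps_exp 1 - 1) oo fps_ln 1 = (fps_X :: qfield fps)"
  by (simp_all add: fps_ln_fps_exp_inv fps_inv fps_inv_right)

lemma plog_pexp: "ge 1 X \<Longrightarrow> plog (pexp X) = X"
  using ev_compose[of X "fps_exp 1 - 1" "fps_ln 1"]
  by (simp add: pexp_def plog_def ev_diff fps_ln_compose)

lemma pexp_plog: "ge 1 (g - 1) \<Longrightarrow> pexp (plog g) = g"
proof -
  assume g: "ge 1 (g - 1)"
  have "ev (fps_exp 1 - 1) (plog g) = g - 1"
    using ev_compose[OF g, of "fps_ln 1" "fps_exp 1 - 1"] g
    by (simp add: plog_def fps_ln_compose)
  moreover have "ev (fps_exp 1 - 1) (plog g) = pexp (plog g) - 1"
    by (simp add: pexp_def ev_diff ge_plog[OF g])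
  ultimately show ?thesis by simp
qed

lemma pexp_minus: "ge 1 X \<Longrightarrow> pexp X * pexp (- X) = 1"
proof -
  assume X: "ge 1 X"
  have "pexp (- X) = ev (fps_exp (-1)) X"
    using ev_scale[OF X, of "fps_exp 1" "-1"] by (simp add: pexp_def kc_uminus fps_exp_compose_linear)
  then show ?thesis using ev_mult[OF X, of "fps_exp 1" "fps_exp (-1)"]
    by (simp add: pexp_def fps_exp_add_mult[symmetric] X)
qed

lemma ge_mult_one:
  assumes "ge 1 (g - 1)" "ge 1 (h - 1)"
  shows "ge 1 (g * h - 1)"
proof -
  have "g * h - 1 = (g - 1) * h + (h - 1)" by (simp add: algebra_simps)
  then show ?thesis using ge_add[OF ge_mult_right[OF assms(1)] assms(2)] by metis
qed

section \<open>Dynkin's formula\<close>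

definition br :: "qplane \<Rightarrow> qplane \<Rightarrow> qplane" where
  "br x W = x * W - W * x"

lemma br_add: "br x (V + W) = br x V + br x W"
  by (simp add: br_def algebra_simps)

lemma br_zero [simp]: "br x 0 = 0"
  by (simp add: br_def)

lemma br_self [simp]: "br x x = 0"
  by (simp add: br_def)

lemma br_kc: "br x (kc a * W) = kc a * br x W"
  by (simp add: br_def right_diff_distrib kc_left_commute mult.assoc)

lemma ge_br: "ge k x \<Longrightarrow> ge l W \<Longrightarrow> ge (k + l) (br x W)"
  unfolding br_def using ge_mult[of k x l W] ge_mult[of l W k x] by (auto intro!: ge_diff simp: add.commute)

lemma br_pow_add: "(br x ^^ k) (V + W) = (br x ^^ k) V + (br x ^^ k) W"
  by (induction k) (simp_all add: br_add)

lemma br_pow_kc: "(br x ^^ k) (kc a * W) = kc a * (br x ^^ k) W"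
  by (induction k) (simp_all add: br_kc)

lemma br_pow_zero [simp]: "(br x ^^ k) 0 = 0"
  by (induction k) simp_all

lemma br_pow_self: "0 < k \<Longrightarrow> (br x ^^ k) x = 0"
  by (cases k) (simp_all add: funpow_Suc_right del: funpow.simps)

lemma ge_br_pow: "ge 1 x \<Longrightarrow> ge l W \<Longrightarrow> ge (k + l) ((br x ^^ k) W)"
proof (induction k)
  case (Suc k)
  then show ?case using ge_br[of 1 x "k + l" "(br x ^^ k) W"] by (simp add: One_nat_def)
qed simp

text \<open>Left and right multiplication by \<open>x\<close> commute, so a power of their
  difference expands binomially.\<close>

lemma br_pow_binomial:
  "(br x ^^ k) W = (\<Sum>i\<le>k. kc (of_nat (k choose i) * (- 1) ^ (k - i)) * (x ^ i * W * x ^ (k - i)))"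
proof (induction k)
  case (Suc k)
  define c :: "nat \<Rightarrow> nat \<Rightarrow> qfield" where "c k i = of_nat (k choose i) * (- 1) ^ (k - i)" for k i
  define T where "T i = x ^ i * W * x ^ (Suc k - i)" for i
  have IH: "(br x ^^ k) W = (\<Sum>i\<le>k. kc (c k i) * (x ^ i * W * x ^ (k - i)))"
    using Suc by (simp add: c_def)
  have 1: "x * (\<Sum>i\<le>k. kc (c k i) * (x ^ i * W * x ^ (k - i))) = (\<Sum>i\<le>k. kc (c k i) * T (Suc i))"
    unfolding sum_distrib_left T_def by (rule sum.cong) (simp_all add: kc_left_commute mult.assoc)
  have 2: "(\<Sum>i\<le>k. kc (c k i) * (x ^ i * W * x ^ (k - i))) * x = (\<Sum>i\<le>k. kc (c k i) * T i)"
    unfolding sum_distrib_right T_def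
    by (rule sum.cong) (simp_all add: mult.assoc Suc_diff_le power_commutes)
  have 3: "(\<Sum>i\<le>k. kc (c k i) * T i) = kc (c k 0) * T 0 + (\<Sum>i\<le>k. kc (c k (Suc i)) * T (Suc i))"
  proof -
    have "(\<Sum>i\<le>k. kc (c k i) * T i) = (\<Sum>i\<le>Suc k. kc (c k i) * T i)"
      by (simp add: c_def binomial_eq_0)
    then show ?thesis by (simp only: sum.atMost_Suc_shift)
  qed
  have 4: "c (Suc k) (Suc i) = c k i - c k (Suc i)" if "i \<le> k" for i
  proof (cases "i = k")
    case False
    then have "k - i = Suc (k - Suc i)" using that by simp
    then show ?thesis by (simp add: c_def algebra_simps)
  qed (simp add: c_def)
  have "(br x ^^ Suc k) W = (\<Sum>i\<le>k. kc (c k i) * T (Suc i)) - (kc (c k 0) * T 0 + (\<Sum>i\<le>k. kc (c k (Suc i)) * T (Suc i)))"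
    unfolding funpow.simps comp_def IH br_def 1 2 using 3 by simp
  also have "\<dots> = kc (- c k 0) * T 0 + (\<Sum>i\<le>k. kc (c (Suc k) (Suc i)) * T (Suc i))"
  proof -
    have "(\<Sum>i\<le>k. kc (c (Suc k) (Suc i)) * T (Suc i)) =
        (\<Sum>i\<le>k. kc (c k i) * T (Suc i)) - (\<Sum>i\<le>k. kc (c k (Suc i)) * T (Suc i))"
      unfolding sum_subtractf[symmetric]
      by (rule sum.cong) (simp_all add: 4 kc_diff left_diff_distrib)
    then show ?thesis by (simp add: kc_uminus)
  qed
  also have "- c k 0 = c (Suc k) 0" by (simp add: c_def)
  also have "kc (c (Suc k) 0) * T 0 + (\<Sum>i\<le>k. kc (c (Suc k) (Suc i)) * T (Suc i)) = (\<Sum>i\<le>Suc k. kc (c (Suc k) i) * T i)"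
    by (simp only: sum.atMost_Suc_shift)
  finally show ?case unfolding c_def T_def .
qed simp

text \<open>Hadamard's formula: conjugation by exp x is the exponential of the bracket with
  \<open>x\<close>. The Cauchy product of the two exponentials groups into the binomial expansions
  of the iterated brackets.\<close>

lemma conj_pexp:
  assumes x: "ge 1 x"
  shows "pexp x * W * pexp (- x) = psum (\<lambda>r. kc (1 / fact r) * (br x ^^ r) W)"
proof -
  have e1: "pexp x = psum (\<lambda>i. kc (1 / fact i) * x ^ i)"
    by (simp add: pexp_def ev_def)
  have "ev (fps_exp 1) (kc (- 1) * x) = ev (fps_exp (- 1)) x"
    by (subst ev_scale[OF x]) (simp add: fps_exp_compose_linear)
  then have e2: "pexp (- x) = psum (\<lambda>j. kc ((- 1) ^ j / fact j) * x ^ j)"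
    by (simp add: pexp_def ev_def kc_uminus)
  have g: "ge k (kc a * x ^ k)" for k a by (intro ge_kc_mult ge_power x)
  have "pexp x * W * pexp (- x) = psum (\<lambda>i. kc (1 / fact i) * x ^ i * W) * psum (\<lambda>j. kc ((- 1) ^ j / fact j) * x ^ j)"
    unfolding e1 e2 by (subst psum_mult_right[OF g]) simp
  also have "\<dots> = psum (\<lambda>n. \<Sum>i\<le>n. (kc (1 / fact i) * x ^ i * W) * (kc ((- 1) ^ (n - i) / fact (n - i)) * x ^ (n - i)))"
    by (rule psum_mult) (intro ge_mult_right g g)+
  also have "\<dots> = psum (\<lambda>r. kc (1 / fact r) * (br x ^^ r) W)"
  proof (rule psum_cong)
    fix n
    have "kc (1 / fact i) * x ^ i * W * (kc ((- 1) ^ (n - i) / fact (n - i)) * x ^ (n - i)) =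
      kc (1 / fact n) * (kc (of_nat (n choose i) * (- 1) ^ (n - i)) * (x ^ i * W * x ^ (n - i)))"
      if "i \<le> n" for i
    proof -
      have "kc (1 / fact i) * x ^ i * W * (kc ((- 1) ^ (n - i) / fact (n - i)) * x ^ (n - i)) =
        kc ((- 1) ^ (n - i) / fact (n - i)) * (kc (1 / fact i) * x ^ i * W * x ^ (n - i))"
        by (rule kc_left_commute)
      also have "\<dots> = kc ((- 1) ^ (n - i) / fact (n - i) * (1 / fact i)) * (x ^ i * W * x ^ (n - i))"
        by (simp only: kc_mult mult.assoc)
      also have "(- 1) ^ (n - i) / fact (n - i) * (1 / fact i) = 1 / fact n * ((of_nat (n choose i) :: qfield) * (- 1) ^ (n - i))"
        using that by (simp add: binomial_fact field_simps)
      finally show ?thesis by (simp only: kc_mult mult.assoc)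
    qed
    then show "(\<Sum>i\<le>n. (kc (1 / fact i) * x ^ i * W) * (kc ((- 1) ^ (n - i) / fact (n - i)) * x ^ (n - i))) =
        kc (1 / fact n) * (br x ^^ n) W"
      unfolding br_pow_binomial sum_distrib_left by (intro sum.cong) auto
  qed
  finally show ?thesis .
qed

text \<open>The derivation \<open>t d/dt\<close>.\<close>

definition tD :: "qplane \<Rightarrow> qplane" where
  "tD F = Abs_qplane (\<lambda>m. of_nat (tdeg m) * cf F m)"

lemma cf_tD [simp]: "cf (tD F) m = of_nat (tdeg m) * cf F m"
  by (simp add: tD_def)

lemma tD_add: "tD (F + G) = tD F + tD G"
  and tD_diff: "tD (F - G) = tD F - tD G"
  and tD_kc: "tD (kc a * F) = kc a * tD F"
  and tD_one [simp]: "tD 1 = 0"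
  by (rule qplane_eqI; simp add: cf_one algebra_simps)+

lemma ge_tD: "ge l F \<Longrightarrow> ge l (tD F)"
  by (simp add: ge_def)

lemma tD_mult: "tD (F * G) = tD F * G + F * tD G"
  by (rule qplane_eqI)
     (auto intro!: sum.cong simp: cf_mult sum_distrib_left sum.distrib[symmetric] decomp_def algebra_simps)

lemma tD_power_Suc: "tD (p ^ Suc k) = (\<Sum>i\<le>k. p ^ i * tD p * p ^ (k - i))"
proof (induction k)
  case (Suc k)
  have "tD (p ^ Suc (Suc k)) = tD (p ^ Suc k) * p + p ^ Suc k * tD p"
    by (subst power_Suc2) (simp only: tD_mult)
  also have "tD (p ^ Suc k) * p = (\<Sum>i\<le>k. p ^ i * tD p * p ^ (Suc k - i))"
    unfolding Suc sum_distrib_right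
    by (rule sum.cong) (simp_all add: mult.assoc Suc_diff_le power_commutes)
  finally show ?case by simp
qed simp

lemma tD_psum: "(\<And>k. ge k (s k)) \<Longrightarrow> tD (psum s) = psum (\<lambda>k. tD (s k))"
  by (rule psum_map) (simp_all add: tD_add ge_tD)

text \<open>By the second hypothesis \<open>x\<close> is homogeneous of degree one in
  \<open>t\<close>; so it commutes with its derivative and the commutative rule applies.\<close>

lemma tD_pexp:
  assumes "ge 1 x" "tD x = x"
  shows "tD (pexp x) = x * pexp x"
proof -
  have pw: "tD (x ^ k) = kc (of_nat k) * x ^ k" for k
  proof (induction k)
    case (Suc k)
    then show ?case by (simp add: tD_mult assms(2) kc_left_commute kc_add distrib_right)
  qed simp
  have g: "ge k (kc a * x ^ k)" for k a by (intro ge_kc_mult ge_power assms)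
  have "tD (pexp x) = psum (\<lambda>k. kc (1 / fact k * of_nat k) * x ^ k)"
    unfolding pexp_def ev_def by (subst tD_psum[OF g]) (simp only: tD_kc pw kc_mult mult.assoc fps_exp_nth power_one of_nat_fact)
  also have "\<dots> = psum (\<lambda>k. kc (1 / fact (Suc k) * of_nat (Suc k)) * x ^ Suc k)"
    by (subst psum_Suc) (simp_all only: g, simp)
  also have "\<dots> = psum (\<lambda>k. x * (kc (1 / fact k) * x ^ k))"
    by (rule psum_cong) (simp add: kc_left_commute del: of_nat_Suc)
  also have "\<dots> = x * pexp x"
    unfolding pexp_def ev_def by (subst psum_mult_left[OF g]) simp
  finally show ?thesis .
qed

text \<open>Both sides are the integral of x^i (1-x)^j over the unit interval; the induction step is
  x^i (1-x)^(j+1) = x^i (1-x)^j - x^(i+1) (1-x)^j.\<close>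

lemma beta_sum:
  "(\<Sum>s\<le>j. (- 1) ^ s * of_nat (j choose s) / of_nat (i + s + 1)) =
    (fact i * fact j / fact (i + j + 1) :: 'a::field_char_0)"
proof (induction j arbitrary: i)
  case 0
  have "(fact (i + 1) :: 'a) = of_nat (i + 1) * fact i" by (simp add: One_nat_def)
  then show ?case by (simp del: fact_Suc)
next
  case (Suc j)
  let ?a = "\<lambda>j i s. (- 1) ^ s * of_nat (j choose s) / of_nat (i + s + 1) :: 'a"
  have "(\<Sum>s\<le>Suc j. ?a (Suc j) i s) = ?a (Suc j) i 0 + (\<Sum>s\<le>j. ?a (Suc j) i (Suc s))"
    by (rule sum.atMost_Suc_shift)
  also have "\<dots> = ?a j i 0 + (\<Sum>s\<le>j. ?a j i (Suc s)) - (\<Sum>s\<le>j. ?a j (Suc i) s)"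
    by (simp add: add_divide_distrib diff_divide_distrib ring_distribs sum.distrib sum_negf sum_subtractf)
  also have "?a j i 0 + (\<Sum>s\<le>j. ?a j i (Suc s)) = (\<Sum>s\<le>Suc j. ?a j i s)"
    by (rule sum.atMost_Suc_shift[symmetric])
  also have "\<dots> = (\<Sum>s\<le>j. ?a j i s)" by simp
  also have "\<dots> - (\<Sum>s\<le>j. ?a j (Suc i) s) = fact i * fact j / fact (i + j + 1) - fact (Suc i) * fact j / fact (Suc i + j + 1)"
    by (simp only: Suc)
  also have "\<dots> = fact i * fact (Suc j) / fact (i + Suc j + 1)"
  proof -
    have alg: "A / F - x * A / (d * F) = A * y / (d * F)" if "F \<noteq> 0" "d \<noteq> 0" "d = x + y" for A F x y d :: 'a
    proof -
      have "A / F = d * A / (d * F)" using that by simp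
      then show ?thesis using that by (simp add: diff_divide_distrib[symmetric] algebra_simps)
    qed
    have F: "(fact (i + Suc j + 1) :: 'a) = of_nat (i + j + 2) * fact (i + j + 1)"
      using fact_Suc[of "i + j + 1"] by simp
    have d: "(of_nat (i + j + 2) :: 'a) \<noteq> 0" by (simp only: of_nat_eq_0_iff)
    have "fact i * fact j / fact (i + j + 1) - of_nat (Suc i) * (fact i * fact j) / (of_nat (i + j + 2) * fact (i + j + 1)) =
        fact i * fact j * of_nat (Suc j) / (of_nat (i + j + 2) * fact (i + j + 1) :: 'a)"
      by (rule alg) (use d in simp_all)
    then show ?thesis using F by (simp add: mult_ac)
  qed
  finally show ?case .
qed

text \<open>With \<open>p = g - 1\<close>, both sides are combinations of the elements \<open>p\<^sup>i (tD p) p\<^sup>j\<close>, and comparing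
  coefficients reduces the claim to \<open>beta_sum\<close>.\<close>

lemma tD_plog:
  assumes g: "ge 1 (g - 1)" and inv: "g * g' = 1" "g' * g = 1"
  defines "Om \<equiv> \<lambda>W. g * W * g' - W"
  shows "tD (plog g) = psum (\<lambda>k. kc ((- 1) ^ k / of_nat (Suc k)) * (Om ^^ k) (tD g * g'))"
proof -
  define p where "p = g - 1"
  define W where "W = tD p"
  define B where "B i j = p ^ i * W * p ^ j" for i j
  define G :: "nat \<Rightarrow> qfield fps" where "G k = Abs_fps (\<lambda>l. of_nat (k + l choose l) * (- 1) ^ l)" for k
  define c :: "nat \<Rightarrow> nat \<Rightarrow> qfield" where "c k i = of_nat (k choose i) * (- 1) ^ (k - i)" for k i
  define a :: "nat \<Rightarrow> qfield" where "a k = (- 1) ^ k / of_nat (Suc k)" for k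
  have p: "ge 1 p" using g by (simp add: p_def)
  have gp: "g = 1 + p" by (simp add: p_def)
  have W: "W = tD g" by (simp add: W_def p_def tD_diff)
  have geB: "ge (i + j) (B i j)" for i j
    unfolding B_def using ge_mult[OF ge_mult_right[OF ge_power[OF p]] ge_power[OF p]] .
  have pw: "g ^ n * g' ^ n = 1" for n
  proof (induction n)
    case (Suc n)
    have "g ^ Suc n * g' ^ Suc n = g ^ n * (g * g') * g' ^ n"
      by (simp only: power_Suc2[of g] power_Suc[of g'] mult.assoc)
    then show ?case using Suc inv by simp
  qed simp
  \<comment> \<open>On S g'^(k+1) the operator \<open>Om\<close> acts as the bracket with
    \<open>p\<close> on S, at the cost of one more factor \<open>g'\<close>. Its powers thus become
    iterated brackets.\<close>
  have Om_br: "(Om ^^ k) (W * g') = (br p ^^ k) W * g' ^ Suc k" for k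
  proof (induction k)
    case (Suc k)
    let ?S = "(br p ^^ k) W"
    have "g' ^ Suc k = g * g' ^ Suc (Suc k)" using inv by (simp add: mult.assoc[symmetric])
    then have "Om (?S * g' ^ Suc k) = g * (?S * g' ^ Suc k) * g' - ?S * (g * g' ^ Suc (Suc k))"
      unfolding Om_def by metis
    also have "\<dots> = (g * ?S - ?S * g) * g' ^ Suc (Suc k)"
      by (simp add: algebra_simps power_commutes)
    also have "g * ?S - ?S * g = br p ?S" by (simp add: br_def gp algebra_simps)
    finally show ?case using Suc by simp
  qed simp
  have G_inv: "g' ^ Suc k = ev (G k) p" for k
  proof -
    have "inverse ((1 - fps_const (- 1) * fps_X) ^ Suc k) = (G k :: qfield fps)"
      by (subst one_minus_const_fps_X_neg_power') (simp_all add: G_def)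
    then have "G k * (1 + fps_X) ^ Suc k = 1"
      using inverse_mult_eq_1[of "(1 + fps_X) ^ Suc k :: qfield fps"] by (simp flip: fps_const_neg)
    then have "ev (G k) p * g ^ Suc k = 1"
      using p by (metis ev_add ev_X ev_mult ev_one ev_power gp)
    then have "ev (G k) p * (g ^ Suc k * g' ^ Suc k) = g' ^ Suc k"
      by (simp only: mult.assoc[symmetric] mult_1_left)
    then show ?thesis by (simp only: pw mult_1_right)
  qed
  have lhs: "tD (plog g) = psum (\<lambda>k. kc (a k) * (\<Sum>i\<le>k. B i (k - i)))"
  proof -
    have t: "ge k (kc e * p ^ k)" for k e by (intro ge_kc_mult ge_power p)
    have "tD (plog g) = psum (\<lambda>k. kc (fps_ln 1 $$ k) * tD (p ^ k))"
      unfolding plog_def ev_def p_def[symmetric] by (subst tD_psum[OF t]) (simp only: tD_kc)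
    also have "\<dots> = kc (fps_ln 1 $$ 0) * tD (p ^ 0) + psum (\<lambda>k. kc (fps_ln 1 $$ Suc k) * tD (p ^ Suc k))"
      by (rule psum_Suc) (intro ge_kc_mult ge_tD ge_power p)
    also have "\<dots> = psum (\<lambda>k. kc (a k) * (\<Sum>i\<le>k. B i (k - i)))"
      unfolding tD_power_Suc by (simp add: fps_ln_nth a_def B_def W_def)
    finally show ?thesis .
  qed
  have "psum (\<lambda>k. kc (a k) * (\<Sum>i\<le>k. B i (k - i))) = psum (\<lambda>k. kc (a k) * (Om ^^ k) (W * g'))"
  proof (rule qplane_eqI)
    fix m
    let ?N = "dg m"
    define b where "b i j = cf (B i j) m" for i j
    have b0: "b i j = 0" if "i + j > ?N" for i j using geB[of i j] that by (simp add: ge_def b_def)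
    define h where "h k i l = a k * (c k i * (G k $$ l * b i (k - i + l)))" for k i l
    have cfOm: "cf ((Om ^^ k) (W * g')) m = (\<Sum>i\<le>k. c k i * (\<Sum>l\<le>?N. G k $$ l * b i (k - i + l)))" for k
    proof -
      have BG: "cf (B i j * ev (G k) p) m = (\<Sum>l\<le>?N. G k $$ l * b i (j + l))" for i j
      proof -
        have "B i j * ev (G k) p = psum (\<lambda>l. B i j * (kc (G k $$ l) * p ^ l))"
          unfolding ev_def by (rule psum_mult_left) (intro ge_kc_mult ge_power p)
        also have "\<dots> = psum (\<lambda>l. kc (G k $$ l) * B i (j + l))"
          by (rule psum_cong) (simp add: kc_left_commute B_def mult.assoc power_add)
        finally show ?thesis by (simp add: psum_def b_def)
      qed
      have "(Om ^^ k) (W * g') = (\<Sum>i\<le>k. kc (c k i) * (B i (k - i) * ev (G k) p))"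
        unfolding Om_br G_inv br_pow_binomial by (simp add: sum_distrib_right mult.assoc c_def B_def)
      then show ?thesis by (simp add: BG)
    qed
    have "cf (psum (\<lambda>k. kc (a k) * (Om ^^ k) (W * g'))) m = (\<Sum>k\<le>?N. \<Sum>i\<le>k. \<Sum>l\<le>?N. h k i l)"
      by (simp add: psum_def cfOm h_def sum_distrib_left)
    also have "\<dots> = (\<Sum>k\<le>?N. \<Sum>i\<le>k. \<Sum>l\<le>?N - k. h k i l)"
      by (intro sum.cong refl sum.mono_neutral_right) (auto simp: h_def intro!: b0)
    also have "\<dots> = (\<Sum>(k, i, l)\<in>(SIGMA k:{..?N}. {..k} \<times> {..?N - k}). h k i l)"
      by (simp add: sum.Sigma[symmetric])
    \<comment> \<open>Regrouping by the total power n = k + l of \<open>p\<close>: the element p^i W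
      p^(n-i) arises once for each s = k - i, and the sum over s is the one evaluated by
      \<open>beta_sum\<close>.\<close>
    also have "\<dots> = (\<Sum>(n, i, s)\<in>(SIGMA n:{..?N}. SIGMA i:{..n}. {..n - i}). h (i + s) i (n - i - s))"
      by (rule sum.reindex_bij_witness[of _ "\<lambda>(n, i, s). (i + s, i, n - i - s)" "\<lambda>(k, i, l). (k + l, i, k - i)"])
         auto
    also have "\<dots> = (\<Sum>n\<le>?N. \<Sum>i\<le>n. \<Sum>s\<le>n - i. h (i + s) i (n - i - s))"
      by (simp add: sum.Sigma[symmetric])
    also have "\<dots> = (\<Sum>n\<le>?N. \<Sum>i\<le>n. a n * b i (n - i))"
    proof (intro sum.cong refl)
      fix n i :: nat assume "i \<in> {..n}"
      then obtain j where n: "n = i + j" using le_Suc_ex by auto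
      have "h (i + s) i (n - i - s) = (- 1) ^ n * (fact n / (fact i * fact j)) * b i j *
          ((- 1) ^ s * of_nat (j choose s) / of_nat (i + s + 1))" if "s \<le> j" for s
      proof -
        have ch: "of_nat (i + s choose i) * of_nat (n choose (j - s)) = (fact n / (fact i * fact j) * of_nat (j choose s) :: qfield)"
          using that by (simp add: n binomial_fact field_simps)
        have sg: "(- 1) ^ (i + s) * (- 1) ^ s * (- 1) ^ (j - s) = ((- 1) ^ n * (- 1) ^ s :: qfield)"
        proof -
          have "even (i + s + s + (j - s)) \<longleftrightarrow> even (n + s)" using that by (auto simp: n)
          then have "(- 1) ^ (i + s + s + (j - s)) = ((- 1) ^ (n + s) :: qfield)"
            by (simp add: minus_one_power_iff)
          then show ?thesis by (simp only: power_add)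
        qed
        have "h (i + s) i (n - i - s) = ((- 1) ^ (i + s) * (- 1) ^ s * (- 1) ^ (j - s)) / of_nat (i + s + 1) *
            (of_nat (i + s choose i) * of_nat (n choose (j - s))) * b i j"
          using that by (simp add: h_def a_def c_def G_def n mult_ac add_ac)
        then show ?thesis unfolding ch sg by (simp add: mult_ac)
      qed
      then have "(\<Sum>s\<le>n - i. h (i + s) i (n - i - s)) = (- 1) ^ n * (fact n / (fact i * fact j)) * b i j *
          (\<Sum>s\<le>j. (- 1) ^ s * of_nat (j choose s) / of_nat (i + s + 1))"
        unfolding sum_distrib_left by (intro sum.cong) (auto simp: n)
      also have "\<dots> = (- 1) ^ n * (fact n / (fact (Suc n))) * b i j"
        unfolding beta_sum by (simp add: n One_nat_def del: fact_Suc)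
      also have "(fact n / fact (Suc n) :: qfield) = 1 / of_nat (Suc n)" by (simp del: of_nat_Suc)
      finally show "(\<Sum>s\<le>n - i. h (i + s) i (n - i - s)) = a n * b i (n - i)"
        by (simp add: a_def n)
    qed
    also have "\<dots> = cf (psum (\<lambda>k. kc (a k) * (\<Sum>i\<le>k. B i (k - i)))) m"
      by (simp add: psum_def b_def sum_distrib_left)
    finally show "cf (psum (\<lambda>k. kc (a k) * (\<Sum>i\<le>k. B i (k - i)))) m =
        cf (psum (\<lambda>k. kc (a k) * (Om ^^ k) (W * g'))) m" by simp
  qed
  then show ?thesis using lhs unfolding W a_def by simp
qed

lemma psum_psum:
  assumes a: "\<And>r s. ge (r + s) (a r s)"
  shows "psum (\<lambda>r. psum (a r)) = psum (\<lambda>n. \<Sum>r\<le>n. a r (n - r))"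
proof (rule qplane_eqI)
  fix m
  let ?N = "dg m"
  have z: "cf (a r s) m = 0" if "\<not> r + s \<le> ?N" for r s
    using a[of r s] that by (simp add: ge_def)
  have "cf (psum (\<lambda>r. psum (a r))) m = (\<Sum>(r, s)\<in>{..?N} \<times> {..?N}. cf (a r s) m)"
    by (simp add: psum_def sum.cartesian_product)
  also have "\<dots> = (\<Sum>(r, s)\<in>{(r, s). r + s \<le> ?N}. cf (a r s) m)"
    by (rule sum.mono_neutral_right) (auto, use z in blast)
  also have "\<dots> = (\<Sum>n\<le>?N. \<Sum>r\<le>n. cf (a r (n - r)) m)"
    by (rule sum.triangle_reindex_eq)
  also have "\<dots> = cf (psum (\<lambda>n. \<Sum>r\<le>n. a r (n - r))) m" by (simp add: psum_def)
  finally show "cf (psum (\<lambda>r. psum (a r))) m = cf (psum (\<lambda>n. \<Sum>r\<le>n. a r (n - r))) m" .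
qed

section \<open>Sums over Dynkin words\<close>

fun nbr :: "qplane list \<Rightarrow> qplane" where
  "nbr [] = 0"
| "nbr [x] = x"
| "nbr (x # y # zs) = br x (nbr (y # zs))"

lemma nbr_Cons: "ws \<noteq> [] \<Longrightarrow> nbr (x # ws) = br x (nbr ws)"
  by (cases ws) simp_all

lemma nbr_replicate: "ws \<noteq> [] \<Longrightarrow> nbr (replicate r x @ ws) = (br x ^^ r) (nbr ws)"
  by (induction r) (simp_all add: nbr_Cons)

definition block_wt :: "nat \<Rightarrow> nat \<Rightarrow> qfield" where
  "block_wt r s = 1 / (fact r * fact s)"

definition word_wt :: "(nat \<times> nat) list \<Rightarrow> qfield" where
  "word_wt ps = (\<Prod>(r, s)\<leftarrow>ps. block_wt r s)"

text \<open>Blocks and letters are counted separately: the number of blocks less one is the power of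
  \<open>Ad g - 1\<close>, the number of letters is the power of \<open>t\<close>.\<close>

definition words :: "nat \<Rightarrow> nat \<Rightarrow> (nat \<times> nat) list set" where
  "words k d = {ps. length ps = k \<and> (\<forall>(r, s)\<in>set ps. 0 < r + s) \<and> dynkin_len ps = d}"

definition word_sum :: "qplane \<Rightarrow> qplane \<Rightarrow> nat \<Rightarrow> nat \<Rightarrow> qplane" where
  "word_sum X Y k d = (\<Sum>ps\<in>words k d. kc (word_wt ps) * nbr (dynkin_word X Y ps))"

lemma finite_words: "finite (words k d)"
proof (rule finite_subset)
  show "words k d \<subseteq> insert [] (dynkin_index d)" by (auto simp: words_def dynkin_index_def)
qed (simp add: finite_dynkin_index)

lemma words_empty:
  assumes "d < k"
  shows "words k d = {}"
proof (rule equals0I)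
  fix ps assume "ps \<in> words k d"
  then have "length ps = k" "dynkin_len ps = d" "length ps \<le> dynkin_len ps"
    by (auto simp: words_def intro!: dynkin_len_bounds(1))
  with assms show False by simp
qed

lemma dynkin_word_ne: "ps \<in> words (Suc k) d \<Longrightarrow> dynkin_word X Y ps \<noteq> []"
  by (cases ps) (auto simp: words_def dynkin_word_def)

text \<open>The leading block is split off. Its length starts at 1 because empty blocks are
  excluded, and this missing zeroth term is what subtracts the identity in
  \<open>Ad g - 1\<close>.\<close>

lemma word_sum_Suc:
  "word_sum X Y (Suc (Suc k)) d =
    (\<Sum>n\<in>{1..d}. \<Sum>r\<le>n. kc (block_wt r (n - r)) * (br X ^^ r) ((br Y ^^ (n - r)) (word_sum X Y (Suc k) (d - n))))"
proof -
  let ?h = "\<lambda>ps. kc (word_wt ps) * nbr (dynkin_word X Y ps)"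
  have step: "?h ((r, s) # ps) = kc (block_wt r s) * (br X ^^ r) ((br Y ^^ s) (?h ps))"
    if "ps \<in> words (Suc k) e" for r s ps e
  proof -
    have "nbr (dynkin_word X Y ((r, s) # ps)) = (br X ^^ r) ((br Y ^^ s) (nbr (dynkin_word X Y ps)))"
      using dynkin_word_ne[OF that, of X Y] by (simp add: dynkin_word_def nbr_replicate)
    then show ?thesis by (simp add: word_wt_def br_pow_kc kc_mult mult.assoc)
  qed
  have "word_sum X Y (Suc (Suc k)) d =
     (\<Sum>(n, r, ps)\<in>(SIGMA n:{1..d}. {..n} \<times> words (Suc k) (d - n)). ?h ((r, n - r) # ps))"
    unfolding word_sum_def
    by (rule sum.reindex_bij_witness[of _ "\<lambda>(n, r, ps). (r, n - r) # ps"
          "\<lambda>ps. (fst (hd ps) + snd (hd ps), fst (hd ps), tl ps)"])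
       (auto simp: words_def dynkin_len_def length_Suc_conv)
  also have "\<dots> = (\<Sum>n\<in>{1..d}. \<Sum>r\<le>n. \<Sum>ps\<in>words (Suc k) (d - n). ?h ((r, n - r) # ps))"
    by (simp add: sum.Sigma[symmetric] finite_words)
  also have "\<dots> = (\<Sum>n\<in>{1..d}. \<Sum>r\<le>n. kc (block_wt r (n - r)) * (br X ^^ r) ((br Y ^^ (n - r)) (word_sum X Y (Suc k) (d - n))))"
  proof (intro sum.cong refl)
    fix n r
    have lin: "(\<Sum>ps\<in>S. kc c * (br X ^^ r) ((br Y ^^ s) (f ps))) = kc c * (br X ^^ r) ((br Y ^^ s) (\<Sum>ps\<in>S. f ps))"
      for S :: "(nat \<times> nat) list set" and c f s
      by (induction S rule: infinite_finite_induct) (simp_all add: br_pow_add distrib_left)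
    show "(\<Sum>ps\<in>words (Suc k) (d - n). ?h ((r, n - r) # ps)) =
       kc (block_wt r (n - r)) * (br X ^^ r) ((br Y ^^ (n - r)) (word_sum X Y (Suc k) (d - n)))"
      unfolding word_sum_def lin[symmetric] by (rule sum.cong[OF refl], rule step)
  qed
  finally show ?thesis .
qed

text \<open>A right-normed bracket whose last two letters coincide is zero, which eliminates all but
  two shapes of the final block.\<close>

lemma nbr_block:
  "nbr (replicate r X @ replicate s Y) =
    (if s = 0 then if r = 1 then X else 0 else if s = 1 then (br X ^^ r) Y else 0)"
proof (cases s)
  case 0
  show ?thesis
  proof (cases r)
    case (Suc r')
    have "replicate r X = replicate r' X @ [X]" using Suc by (simp add: replicate_append_same)
    then have "nbr (replicate r X) = (br X ^^ r') X"
      using nbr_replicate[of "[X]" r' X] by simp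
    then show ?thesis using 0 Suc br_pow_self[of r' X] by (cases "r' = 0") (auto simp: One_nat_def)
  qed (simp add: 0 One_nat_def)
next
  case (Suc s')
  have "nbr (replicate s Y) = (br Y ^^ s') Y"
    using nbr_replicate[of "[Y]" s' Y] Suc by (simp add: replicate_append_same)
  then show ?thesis using Suc nbr_replicate[of "replicate s Y" r X] br_pow_self[of s' Y]
    by (cases s') (auto simp: One_nat_def)
qed

lemma word_sum_one:
  "word_sum X Y 1 0 = 0"
  "word_sum X Y 1 (Suc d) = (if d = 0 then X else 0) + kc (1 / fact d) * (br X ^^ d) Y"
proof -
  have "words 1 0 = {}" by (rule words_empty) simp
  then show "word_sum X Y 1 0 = 0" by (simp add: word_sum_def)
  let ?h = "\<lambda>r s. kc (block_wt r s) * nbr (replicate r X @ replicate s Y)"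
  have "word_sum X Y 1 (Suc d) = (\<Sum>r\<le>Suc d. ?h r (Suc d - r))"
    unfolding word_sum_def
    by (rule sum.reindex_bij_witness[of _ "\<lambda>r. [(r, Suc d - r)]" "\<lambda>ps. fst (hd ps)"])
       (auto simp: words_def dynkin_len_def length_Suc_conv One_nat_def word_wt_def dynkin_word_def,
        (metis diff_add_inverse)+)
  also have "\<dots> = ?h (Suc d) 0 + ?h d 1 + (\<Sum>r<d. ?h r (Suc d - r))"
    by (simp add: lessThan_Suc_atMost[symmetric] One_nat_def)
  also have "(\<Sum>r<d. ?h r (Suc d - r)) = 0"
    by (rule sum.neutral) (auto simp: nbr_block One_nat_def)
  also have "?h (Suc d) 0 + ?h d 1 + 0 = (if d = 0 then X else 0) + kc (1 / fact d) * (br X ^^ d) Y"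
    by (simp only: nbr_block) (simp add: block_wt_def One_nat_def)
  finally show "word_sum X Y 1 (Suc d) = (if d = 0 then X else 0) + kc (1 / fact d) * (br X ^^ d) Y" .
qed

lemma ge_nbr:
  assumes "\<And>x. x \<in> set ws \<Longrightarrow> ge 1 x"
  shows "ge (length ws) (nbr ws)"
  using assms
proof (induction ws rule: nbr.induct)
  case (3 x y zs)
  then show ?case using ge_br[of 1 x "length (y # zs)" "nbr (y # zs)"] by (simp add: One_nat_def)
qed (simp_all add: One_nat_def)

lemma set_dynkin_word: "set (dynkin_word X Y ps) \<subseteq> {X, Y}"
  by (auto simp: dynkin_word_def)

lemma length_dynkin_word: "length (dynkin_word X Y ps) = dynkin_len ps"
  by (induction ps) (auto simp: dynkin_word_def dynkin_len_def)

lemma ge_nbr_dynkin_word: "ge 1 X \<Longrightarrow> ge 1 Y \<Longrightarrow> ge (dynkin_len ps) (nbr (dynkin_word X Y ps))"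
  using ge_nbr[of "dynkin_word X Y ps"] set_dynkin_word[of X Y ps] length_dynkin_word[of X Y ps] by auto

lemma ge_word_sum: "ge 1 X \<Longrightarrow> ge 1 Y \<Longrightarrow> ge d (word_sum X Y k d)"
  unfolding word_sum_def
  by (intro ge_sum ge_kc_mult) (use ge_nbr_dynkin_word in \<open>force simp: words_def\<close>)

section \<open>Recording the length of words by the central variable\<close>

definition flat :: "qplane \<Rightarrow> bool" where
  "flat F \<longleftrightarrow> (\<forall>m. tdeg m \<noteq> 0 \<longrightarrow> cf F m = 0)"

lemma flat_diff: "flat F \<Longrightarrow> flat G \<Longrightarrow> flat (F - G)"
  and flat_kc_mult: "flat F \<Longrightarrow> flat (kc a * F)"
  and flat_0 [simp]: "flat 0"
  by (simp_all add: flat_def)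

lemma flat_sum: "(\<And>i. i \<in> I \<Longrightarrow> flat (f i)) \<Longrightarrow> flat (\<Sum>i\<in>I. f i)"
  by (simp add: flat_def)

lemma flat_mult: "flat F \<Longrightarrow> flat G \<Longrightarrow> flat (F * G)"
  unfolding flat_def cf_mult by (auto intro!: sum.neutral simp: decomp_def)

lemma flat_nbr: "(\<And>x. x \<in> set ws \<Longrightarrow> flat x) \<Longrightarrow> flat (nbr ws)"
  by (induction ws rule: nbr.induct) (simp_all add: br_def flat_diff flat_mult)

lemma flat_word_sum: "flat X \<Longrightarrow> flat Y \<Longrightarrow> flat (word_sum X Y k d)"
  unfolding word_sum_def using set_dynkin_word[of X Y]
  by (intro flat_sum flat_kc_mult flat_nbr) auto

definition tt :: qplane where "tt = mon (Expo 0 0 1)"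

lemma tt_power: "tt ^ k = mon (Expo 0 0 k)"
  by (simp add: tt_def mon_power)

lemma tt_commute: "F * tt ^ k = tt ^ k * F"
proof (rule qplane_eqI)
  fix m
  have "cf (F * tt ^ k) m = (\<Sum>(m1, m2)\<in>decomp m. cf F m2 * cf (mon (Expo 0 0 k)) m1 * vp (4 * frm m2 m1))"
    unfolding cf_mult tt_power by (rule sum_decomp_swap)
  also have "\<dots> = cf (tt ^ k * F) m"
    unfolding cf_mult tt_power by (rule sum.cong) (auto simp: cf_mon frm_def)
  finally show "cf (F * tt ^ k) m = cf (tt ^ k * F) m" .
qed

lemma cf_tt_flat:
  assumes "flat F"
  shows "cf (tt ^ k * F) m = (if tdeg m = k then cf F (Expo (xdeg m) (ydeg m) 0) else 0)"
proof (cases "\<exists>m2. Expo 0 0 k + m2 = m")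
  case True
  then obtain m2 where m2: "m = Expo 0 0 k + m2" by blast
  show ?thesis
  proof (cases "tdeg m2 = 0")
    case True
    then have "m2 = Expo (xdeg m2) (ydeg m2) 0" by (cases m2) simp
    then show ?thesis using True by (simp add: m2 tt_power frm_def)
  next
    case False
    then show ?thesis using assms by (simp add: m2 tt_power flat_def)
  qed
next
  case False
  have "tdeg m \<noteq> k"
  proof
    assume "tdeg m = k"
    then have "Expo 0 0 k + Expo (xdeg m) (ydeg m) 0 = m" by (cases m) simp
    then show False using False by blast
  qed
  then show ?thesis using False by (simp add: tt_power cf_mon_mult)
qed

lemma br_tt: "br (tt * X) (tt ^ d * W) = tt ^ Suc d * br X W"
proof -
  have 1: "X * tt ^ d = tt ^ d * X" "W * tt = tt * W" for X W d
    using tt_commute[of _ 1] by (simp_all add: tt_commute)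
  have "tt * X * (tt ^ d * W) = tt * (X * tt ^ d) * W" "tt ^ d * W * (tt * X) = tt ^ d * (W * tt) * X"
    by (simp_all only: mult.assoc)
  then show ?thesis unfolding 1 br_def
    by (simp add: right_diff_distrib mult.assoc power_commutes power_Suc2[symmetric] flip: mult.assoc)
qed

lemma br_pow_tt: "(br (tt * X) ^^ k) (tt ^ d * W) = tt ^ (k + d) * (br X ^^ k) W"
  by (induction k) (simp_all add: br_tt del: power_Suc)

context
  fixes X Y :: qplane
  assumes X: "ge 1 X" "flat X" and Y: "ge 1 Y" "flat Y"
begin

abbreviation (input) "gprod \<equiv> pexp (tt * X) * pexp (tt * Y)"
abbreviation (input) "ginv \<equiv> pexp (- (tt * Y)) * pexp (- (tt * X))"

lemma ge_tX: "ge 1 (tt * X)" "ge 1 (tt * Y)"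
  using X Y by (simp_all add: ge_mult_left)

lemma tD_tt: "flat W \<Longrightarrow> tD (tt * W) = tt * W"
  by (rule qplane_eqI) (use cf_tt_flat[of W 1] in simp)

lemma g_inverse: "gprod * ginv = 1" "ginv * gprod = 1"
proof -
  have i: "pexp p * pexp (- p) = 1" "pexp (- p) * pexp p = 1" if "ge 1 p" for p
    using pexp_minus[OF that] pexp_minus[OF ge_uminus[OF that]] by simp_all
  have "gprod * ginv = pexp (tt * X) * (pexp (tt * Y) * pexp (- (tt * Y))) * pexp (- (tt * X))"
    by (simp only: mult.assoc)
  then show "gprod * ginv = 1" by (simp add: i ge_tX)
  have "ginv * gprod = pexp (- (tt * Y)) * (pexp (- (tt * X)) * pexp (tt * X)) * pexp (tt * Y)"
    by (simp only: mult.assoc)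
  then show "ginv * gprod = 1" by (simp add: i ge_tX)
qed

lemma ge_g: "ge 1 (gprod - 1)"
  by (intro ge_mult_one ge_pexp ge_tX)

lemma conj_g:
  "gprod * W * ginv = psum (\<lambda>n. \<Sum>r\<le>n. kc (block_wt r (n - r)) * (br (tt * X) ^^ r) ((br (tt * Y) ^^ (n - r)) W))"
proof -
  let ?x = "tt * X" and ?y = "tt * Y"
  have gb: "ge r ((br p ^^ r) V)" if "ge 1 p" for p V r
    using ge_br_pow[OF that, of 0 V r] by simp
  have gx: "ge l ((br ?x ^^ r) V)" if "ge l V" for r l V
    by (rule ge_mono[OF ge_br_pow[OF ge_tX(1) that]]) simp
  have "gprod * W * ginv = pexp ?x * (pexp ?y * W * pexp (- ?y)) * pexp (- ?x)" by (simp only: mult.assoc)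
  also have "\<dots> = psum (\<lambda>r. kc (1 / fact r) * (br ?x ^^ r) (psum (\<lambda>s. kc (1 / fact s) * (br ?y ^^ s) W)))"
    unfolding conj_pexp[OF ge_tX(1)] conj_pexp[OF ge_tX(2)] ..
  also have "\<dots> = psum (\<lambda>r. psum (\<lambda>s. kc (block_wt r s) * (br ?x ^^ r) ((br ?y ^^ s) W)))"
  proof (rule psum_cong)
    fix r
    have "kc (1 / fact r) * (br ?x ^^ r) (psum (\<lambda>s. kc (1 / fact s) * (br ?y ^^ s) W)) =
       psum (\<lambda>s. kc (1 / fact r) * (br ?x ^^ r) (kc (1 / fact s) * (br ?y ^^ s) W))"
      by (rule psum_map[where \<phi> = "\<lambda>V. kc (1 / fact r) * (br ?x ^^ r) V"])
         (auto simp: br_pow_add distrib_left intro!: ge_kc_mult gb gx ge_tX)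
    also have "\<dots> = psum (\<lambda>s. kc (block_wt r s) * (br ?x ^^ r) ((br ?y ^^ s) W))"
    proof (rule psum_cong)
      fix s
      have "block_wt r s = 1 / fact r * (1 / fact s)" by (simp add: block_wt_def)
      then show "kc (1 / fact r) * (br ?x ^^ r) (kc (1 / fact s) * (br ?y ^^ s) W) =
         kc (block_wt r s) * (br ?x ^^ r) ((br ?y ^^ s) W)"
        by (simp only: br_pow_kc kc_mult mult.assoc)
    qed
    finally show "kc (1 / fact r) * (br ?x ^^ r) (psum (\<lambda>s. kc (1 / fact s) * (br ?y ^^ s) W)) =
       psum (\<lambda>s. kc (block_wt r s) * (br ?x ^^ r) ((br ?y ^^ s) W))" .
  qed
  also have "\<dots> = psum (\<lambda>n. \<Sum>r\<le>n. kc (block_wt r (n - r)) * (br ?x ^^ r) ((br ?y ^^ (n - r)) W))"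
    by (rule psum_psum) (intro ge_kc_mult ge_br_pow ge_tX gb)
  finally show ?thesis .
qed

text \<open>In the last block \<open>X\<^sup>rY\<^sup>s\<close> of a Dynkin word only \<open>(r, s) = (1, 0)\<close> and \<open>s = 1\<close> survive, which gives
  the two summands of \<open>tD g g\<^sup>-\<^sup>1 = tX + g (tY) g\<^sup>-\<^sup>1\<close>; each preceding block is one application of
  \<open>Ad g - 1\<close>.\<close>

lemma logderiv_words:
  "((\<lambda>W. gprod * W * ginv - W) ^^ k) (tD gprod * ginv) = psum (\<lambda>d. tt ^ d * word_sum X Y (Suc k) d)"
proof (induction k)
  case 0
  let ?x = "tt * X" and ?y = "tt * Y"
  have "?y * pexp ?y = pexp ?y * ?y"
    unfolding pexp_def by (rule ev_intertwine) (simp_all add: ge_tX)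
  then have "tD gprod = ?x * gprod + gprod * ?y"
    unfolding tD_mult tD_pexp[OF ge_tX(1) tD_tt[OF X(2)]] tD_pexp[OF ge_tX(2) tD_tt[OF Y(2)]]
    by (simp add: mult.assoc)
  then have "tD gprod * ginv = ?x * (gprod * ginv) + gprod * ?y * ginv" by (simp only: distrib_right mult.assoc)
  also have "\<dots> = ?x + pexp ?x * (?y * (pexp ?y * pexp (- ?y))) * pexp (- ?x)"
  proof -
    have "gprod * ?y * ginv = pexp ?x * (pexp ?y * ?y) * pexp (- ?y) * pexp (- ?x)"
      by (simp only: mult.assoc)
    also have "\<dots> = pexp ?x * (?y * (pexp ?y * pexp (- ?y))) * pexp (- ?x)"
      unfolding \<open>?y * pexp ?y = pexp ?y * ?y\<close>[symmetric] by (simp only: mult.assoc)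
    finally show ?thesis by (simp only: g_inverse mult_1_right)
  qed
  also have "\<dots> = ?x + psum (\<lambda>d. kc (1 / fact d) * (br ?x ^^ d) ?y)"
    by (simp add: pexp_minus ge_tX conj_pexp)
  also have "\<dots> = psum (\<lambda>d. tt ^ Suc d * word_sum X Y 1 (Suc d))"
  proof -
    have 1: "kc (1 / fact d) * (br ?x ^^ d) ?y = tt ^ Suc d * (kc (1 / fact d) * (br X ^^ d) Y)" for d
      using br_pow_tt[where X = X and k = d and d = 1 and W = Y] by (simp add: kc_left_commute One_nat_def)
    have 2: "?x = psum (\<lambda>d. if d = 0 then ?x else 0)"
      by (rule qplane_eqI) (simp add: psum_def if_distrib[of "\<lambda>F. cf F _"] cong: if_cong)
    show ?thesis unfolding 1 by (subst 2, subst psum_add, rule psum_cong)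
      (auto simp: word_sum_one distrib_left)
  qed
  also have "\<dots> = psum (\<lambda>d. tt ^ d * word_sum X Y 1 d)"
    by (subst (2) psum_Suc) (simp_all add: word_sum_one ge_mult_left ge_word_sum X Y)
  finally show ?case by (simp add: One_nat_def)
next
  case (Suc k)
  let ?x = "tt * X" and ?y = "tt * Y"
  let ?A = "\<lambda>n W. \<Sum>r\<le>n. kc (block_wt r (n - r)) * (br ?x ^^ r) ((br ?y ^^ (n - r)) W)"
  let ?w = "word_sum X Y (Suc k)"
  have gA: "ge (n + l) (?A n W)" if "ge l W" for n W l
  proof (intro ge_sum ge_kc_mult)
    fix r assume "r \<in> {..n}"
    then show "ge (n + l) ((br ?x ^^ r) ((br ?y ^^ (n - r)) W))"
      using ge_br_pow[OF ge_tX(1) ge_br_pow[OF ge_tX(2) that, of "n - r"], of r] by simp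
  qed
  have gw: "ge d (tt ^ d * ?w d)" for d by (intro ge_mult_left ge_word_sum X Y)
  have Om: "gprod * W * ginv - W = psum (\<lambda>n. if n = 0 then 0 else ?A n W)" for W
  proof -
    have "psum (\<lambda>n. ?A n W) = ?A 0 W + psum (\<lambda>n. ?A (Suc n) W)"
      by (rule psum_Suc) (use gA[of 0 W] in simp)
    moreover have "psum (\<lambda>n. if n = 0 then 0 else ?A n W) = psum (\<lambda>n. ?A (Suc n) W)"
      by (subst psum_Suc) (use gA[of 0 W] in simp_all)
    ultimately show ?thesis unfolding conj_g by (simp add: block_wt_def)
  qed
  have Aadd: "?A n (V + W) = ?A n V + ?A n W" for n V W
    by (simp add: br_pow_add distrib_left sum.distrib)
  have "((\<lambda>W. gprod * W * ginv - W) ^^ Suc k) (tD gprod * ginv) = psum (\<lambda>n. if n = 0 then 0 else ?A n (psum (\<lambda>d. tt ^ d * ?w d)))"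
    unfolding funpow.simps comp_def Suc by (rule Om)
  also have "\<dots> = psum (\<lambda>n. psum (\<lambda>d. if n = 0 then 0 else ?A n (tt ^ d * ?w d)))"
  proof (rule psum_cong)
    fix n
    have "ge l (?A n W)" if "ge l W" for l W using gA[OF that, of n] ge_mono by (meson le_add2)
    then have "?A n (psum (\<lambda>d. tt ^ d * ?w d)) = psum (\<lambda>d. ?A n (tt ^ d * ?w d))"
      by (intro psum_map[where \<phi> = "?A n"] gw Aadd)
    then show "(if n = 0 then 0 else ?A n (psum (\<lambda>d. tt ^ d * ?w d))) = psum (\<lambda>d. if n = 0 then 0 else ?A n (tt ^ d * ?w d))"
      by (auto simp: psum_def zero_qplane_def)
  qed
  also have "\<dots> = psum (\<lambda>e. \<Sum>n\<le>e. if n = 0 then 0 else ?A n (tt ^ (e - n) * ?w (e - n)))"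
    by (rule psum_psum) (use gA[OF gw] in auto)
  also have "\<dots> = psum (\<lambda>e. tt ^ e * word_sum X Y (Suc (Suc k)) e)"
  proof (rule psum_cong)
    fix e
    have "?A n (tt ^ (e - n) * ?w (e - n)) =
        tt ^ e * (\<Sum>r\<le>n. kc (block_wt r (n - r)) * (br X ^^ r) ((br Y ^^ (n - r)) (?w (e - n))))" if "n \<le> e" for n
      unfolding sum_distrib_left
      by (rule sum.cong) (use that in \<open>auto simp: br_pow_tt kc_left_commute\<close>)
    then have "(\<Sum>n\<in>{1..e}. ?A n (tt ^ (e - n) * ?w (e - n))) = tt ^ e * word_sum X Y (Suc (Suc k)) e"
      unfolding word_sum_Suc sum_distrib_left[of _ _ "{1..e}"] by (intro sum.cong) auto
    moreover have "(\<Sum>n\<le>e. if n = 0 then 0 else ?A n (tt ^ (e - n) * ?w (e - n))) =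
        (\<Sum>n\<in>{1..e}. ?A n (tt ^ (e - n) * ?w (e - n)))"
      by (rule sum.mono_neutral_cong_right) (auto simp: One_nat_def)
    ultimately show "(\<Sum>n\<le>e. if n = 0 then 0 else ?A n (tt ^ (e - n) * ?w (e - n))) =
        tt ^ e * word_sum X Y (Suc (Suc k)) e" by simp
  qed
  finally show ?case .
qed

lemma tD_plog_g:
  "tD (plog gprod) = psum (\<lambda>k. kc ((- 1) ^ k / of_nat (Suc k)) * psum (\<lambda>d. tt ^ d * word_sum X Y (Suc k) d))"
  unfolding tD_plog[OF ge_g g_inverse] logderiv_words ..

text \<open>At the power c of \<open>t\<close> the derivation multiplies by c; dividing by it
  produces the total length in the denominator of Dynkin's coefficients.\<close>

lemma cf_plog_g:
  assumes "tdeg m = 0" "0 < c"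
  shows "cf (plog gprod) (Expo (xdeg m) (ydeg m) c) =
    (\<Sum>k<c. (- 1) ^ k / (of_nat (Suc k) * of_nat c) * cf (word_sum X Y (Suc k) c) m)"
proof -
  let ?m = "Expo (xdeg m) (ydeg m) c"
  let ?N = "max c (dg m)"
  have m: "Expo (xdeg m) (ydeg m) 0 = m" using assms(1) by (cases m) simp
  have dgm: "dg ?m = dg m" by (simp add: dg_def)
  have gd: "ge d (tt ^ d * word_sum X Y (Suc k) d)" for d k by (intro ge_mult_left ge_word_sum X Y)
  have inner: "cf (psum (\<lambda>d. tt ^ d * word_sum X Y (Suc k) d)) ?m = cf (word_sum X Y (Suc k) c) m" for k
  proof -
    have "cf (psum (\<lambda>d. tt ^ d * word_sum X Y (Suc k) d)) ?m =
        (\<Sum>d\<le>?N. cf (tt ^ d * word_sum X Y (Suc k) d) ?m)"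
      by (rule cf_psum[OF gd]) (simp add: dgm)
    also have "\<dots> = (\<Sum>d\<le>?N. if d = c then cf (word_sum X Y (Suc k) c) m else 0)"
      by (rule sum.cong) (auto simp: cf_tt_flat flat_word_sum X Y m)
    finally show ?thesis by simp
  qed
  \<comment> \<open>More than \<open>k\<close> letters are needed to fill k + 1 nonempty blocks, so
    the k-th term has order above k and the outer sum converges.\<close>
  have geOm: "ge k (psum (\<lambda>d. tt ^ d * word_sum X Y (Suc k) d))" for k
  proof (rule ge_psum[OF gd])
    fix d
    show "ge k (tt ^ d * word_sum X Y (Suc k) d)"
    proof (cases "d < Suc k")
      case True
      then show ?thesis by (simp add: word_sum_def words_empty)
    next
      case False
      then show ?thesis using ge_mono[OF gd, of k d k] by simp
    qed
  qed
  have "of_nat c * cf (plog gprod) ?m = cf (tD (plog gprod)) ?m" by simp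
  also have "\<dots> = (\<Sum>k\<le>?N. (- 1) ^ k / of_nat (Suc k) * cf (word_sum X Y (Suc k) c) m)"
    unfolding tD_plog_g by (subst cf_psum[where N = ?N]) (simp_all only: cf_kc_mult inner ge_kc_mult geOm dgm max.cobounded2)
  also have "\<dots> = (\<Sum>k<c. (- 1) ^ k / of_nat (Suc k) * cf (word_sum X Y (Suc k) c) m)"
    by (rule sum.mono_neutral_right) (auto simp: word_sum_def words_empty)
  finally have "cf (plog gprod) ?m = (\<Sum>k<c. (- 1) ^ k / of_nat (Suc k) * cf (word_sum X Y (Suc k) c) m) / of_nat c"
    using assms(2) by (simp add: nonzero_eq_divide_eq mult.commute)
  then show ?thesis by (simp add: sum_divide_distrib del: of_nat_Suc)
qed

end

text \<open>Setting \<open>t = 0\<close>, and setting \<open>t = 1\<close>; the latter is meaningful only when the degree in \<open>t\<close> is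
  bounded by the degree in \<open>x\<close> and \<open>y\<close>.\<close>

definition at0 :: "qplane \<Rightarrow> qplane" where
  "at0 F = Abs_qplane (\<lambda>m. if tdeg m = 0 then cf F m else 0)"

definition at1 :: "qplane \<Rightarrow> qplane" where
  "at1 F = Abs_qplane (\<lambda>m. if tdeg m = 0 then \<Sum>c\<le>dg m. cf F (Expo (xdeg m) (ydeg m) c) else 0)"

definition tbdd :: "qplane \<Rightarrow> bool" where
  "tbdd F \<longleftrightarrow> (\<forall>m. dg m < tdeg m \<longrightarrow> cf F m = 0)"

lemma cf_at0: "cf (at0 F) m = (if tdeg m = 0 then cf F m else 0)"
  by (simp add: at0_def)

lemma cf_at1: "cf (at1 F) m = (if tdeg m = 0 then \<Sum>c\<le>dg m. cf F (Expo (xdeg m) (ydeg m) c) else 0)"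
  by (simp add: at1_def)

lemma at0_add: "at0 (F + G) = at0 F + at0 G"
  and at0_diff: "at0 (F - G) = at0 F - at0 G"
  and at0_kc: "at0 (kc a * F) = kc a * at0 F"
  and at0_one: "at0 1 = 1"
  by (rule qplane_eqI; simp add: cf_at0 cf_one)+

lemma at0_mult: "at0 (F * G) = at0 F * at0 G"
proof (rule qplane_eqI)
  fix m
  show "cf (at0 (F * G)) m = cf (at0 F * at0 G) m"
  proof (cases "tdeg m = 0")
    case True
    then show ?thesis unfolding cf_at0[of "F * G"] cf_mult
      by (auto intro!: sum.cong simp: cf_at0 decomp_def)
  next
    case False
    then show ?thesis unfolding cf_at0[of "F * G"] cf_mult
      by (auto intro!: sum.neutral simp: cf_at0 decomp_def)
  qed
qed

lemma at0_power: "at0 (F ^ k) = at0 F ^ k"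
  by (induction k) (simp_all add: at0_one at0_mult)

lemma ge_at0: "ge l F \<Longrightarrow> ge l (at0 F)"
  by (simp add: ge_def cf_at0)

lemma at0_ev: "ge 1 p \<Longrightarrow> at0 (ev F p) = ev F (at0 p)"
  by (rule ev_map) (simp_all add: at0_add at0_kc ge_at0 at0_power)

lemma at1_add: "at1 (F + G) = at1 F + at1 G"
  and at1_diff: "at1 (F - G) = at1 F - at1 G"
  and at1_kc: "at1 (kc a * F) = kc a * at1 F"
  by (rule qplane_eqI; simp add: cf_at1 sum.distrib sum_subtractf sum_distrib_left)+

lemma at1_flat: "flat F \<Longrightarrow> at1 F = F"
proof (rule qplane_eqI)
  fix m assume F: "flat F"
  show "cf (at1 F) m = cf F m"
  proof (cases "tdeg m = 0")
    case True
    then have m: "Expo (xdeg m) (ydeg m) 0 = m" by (cases m) simp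
    have "(\<Sum>c\<le>dg m. cf F (Expo (xdeg m) (ydeg m) c)) = (\<Sum>c\<le>dg m. if c = 0 then cf F m else 0)"
      by (rule sum.cong) (use F m in \<open>auto simp: flat_def\<close>)
    then show ?thesis using True by (simp add: cf_at1)
  qed (use F in \<open>simp add: cf_at1 flat_def\<close>)
qed

lemma flat_one [simp]: "flat 1"
  by (simp add: flat_def cf_one)

lemma at1_tt: "flat X \<Longrightarrow> ge 1 X \<Longrightarrow> at1 (tt * X) = X"
proof (rule qplane_eqI)
  fix m assume X: "flat X" "ge 1 X"
  have cf: "cf (tt * X) (Expo a b c) = (if c = 1 then cf X (Expo a b 0) else 0)" for a b c
    using cf_tt_flat[OF X(1), of 1 "Expo a b c"] by simp
  show "cf (at1 (tt * X)) m = cf X m"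
  proof (cases "tdeg m = 0")
    case True
    then have m: "Expo (xdeg m) (ydeg m) 0 = m" by (cases m) simp
    show ?thesis
    proof (cases "dg m = 0")
      case True
      then show ?thesis using X by (simp add: cf_at1 cf ge_def)
    next
      case False
      then show ?thesis using True by (simp add: cf_at1 cf m)
    qed
  qed (use X in \<open>simp add: cf_at1 flat_def\<close>)
qed

lemma ge_at1: "ge l F \<Longrightarrow> ge l (at1 F)"
  by (auto simp: ge_def cf_at1 dg_def intro!: sum.neutral)

lemma tbdd_mult: "tbdd F \<Longrightarrow> tbdd G \<Longrightarrow> tbdd (F * G)"
  unfolding tbdd_def
proof (intro allI impI)
  fix m assume FG: "\<forall>m. dg m < tdeg m \<longrightarrow> cf F m = 0" "\<forall>m. dg m < tdeg m \<longrightarrow> cf G m = 0"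
    and m: "dg m < tdeg m"
  have "cf F m1 * cf G m2 * vp (4 * frm m1 m2) = 0" if "(m1, m2) \<in> decomp m" for m1 m2
  proof -
    have "dg m1 + dg m2 < tdeg m1 + tdeg m2" using that m by (auto simp: decomp_def)
    then have "dg m1 < tdeg m1 \<or> dg m2 < tdeg m2" by linarith
    then show ?thesis using FG by auto
  qed
  then show "cf (F * G) m = 0" unfolding cf_mult by (auto intro!: sum.neutral)
qed

lemma tbdd_flat: "flat F \<Longrightarrow> tbdd F"
  by (simp add: flat_def tbdd_def)

lemma tbdd_diff: "tbdd F \<Longrightarrow> tbdd G \<Longrightarrow> tbdd (F - G)"
  by (simp add: tbdd_def)

lemma tbdd_power: "tbdd F \<Longrightarrow> tbdd (F ^ k)"
  by (induction k) (simp_all add: tbdd_flat tbdd_mult)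

lemma tbdd_ev: "tbdd p \<Longrightarrow> tbdd (ev F p)"
  using tbdd_power[of p] by (simp add: tbdd_def ev_def psum_def)

lemma tbdd_tt: "flat X \<Longrightarrow> ge 1 X \<Longrightarrow> tbdd (tt * X)"
  using cf_tt_flat[of X 1] by (auto simp: tbdd_def ge_def dg_def)

text \<open>The bounds allow the triangle c1 + c2 \<le> dg m to be replaced by the rectangle c1
  \<le> dg m1, c2 \<le> dg m2, since all other entries vanish; over the rectangle the double sum
  factors.\<close>

lemma at1_mult:
  assumes F: "tbdd F" and G: "tbdd G"
  shows "at1 (F * G) = at1 F * at1 G"
proof (rule qplane_eqI)
  fix m
  show "cf (at1 (F * G)) m = cf (at1 F * at1 G) m"
  proof (cases "tdeg m = 0")
    case False
    then show ?thesis unfolding cf_at1[of "F * G"] cf_mult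
      by (auto intro!: sum.neutral simp: cf_at1 decomp_def)
  next
    case True
    let ?E = "\<lambda>m c. Expo (xdeg m) (ydeg m) c"
    let ?h = "\<lambda>m1 m2. cf F m1 * cf G m2 * vp (4 * frm m1 m2)"
    have z: "?h (?E m1 c1) (?E m2 c2) = 0" if "dg m1 < c1 \<or> dg m2 < c2" for m1 m2 c1 c2
      using that F G by (auto simp: tbdd_def dg_def)
    have frmE: "frm (?E m1 c1) (?E m2 c2) = frm m1 m2" for m1 m2 c1 c2 by (simp add: frm_def)
    have "cf (at1 (F * G)) m = (\<Sum>c\<le>dg m. \<Sum>(m1, m2)\<in>decomp (?E m c). ?h m1 m2)"
      using True by (simp add: cf_at1 cf_mult)
    also have "\<dots> = (\<Sum>(c, m1, m2)\<in>(SIGMA c:{..dg m}. decomp (?E m c)). ?h m1 m2)"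
      by (simp add: sum.Sigma)
    also have "\<dots> = (\<Sum>(m12, c12)\<in>(SIGMA m12:decomp m. {(c1, c2). c1 + c2 \<le> dg m}).
        ?h (?E (fst m12) (fst c12)) (?E (snd m12) (snd c12)))"
      by (rule sum.reindex_bij_witness[of _
            "\<lambda>(m12, c12). (fst c12 + snd c12, ?E (fst m12) (fst c12), ?E (snd m12) (snd c12))"
            "\<lambda>(c, m1, m2). ((?E m1 0, ?E m2 0), (tdeg m1, tdeg m2))"])
         (use True in \<open>auto simp: decomp_def plus_expo_def expo.expand\<close>)
    also have "\<dots> = (\<Sum>m12\<in>decomp m. \<Sum>c12\<in>{(c1, c2). c1 + c2 \<le> dg m}.
        ?h (?E (fst m12) (fst c12)) (?E (snd m12) (snd c12)))"
    proof (rule sum.Sigma[symmetric])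
      have "finite {(c1, c2). c1 + c2 \<le> dg m}"
        by (rule finite_subset[of _ "{..dg m} \<times> {..dg m}"]) auto
      then show "\<forall>x\<in>decomp m. finite {(c1, c2). c1 + c2 \<le> dg m}" by blast
    qed simp
    also have "\<dots> = (\<Sum>(m1, m2)\<in>decomp m. \<Sum>c12\<in>{..dg m1} \<times> {..dg m2}.
        ?h (?E m1 (fst c12)) (?E m2 (snd c12)))"
    proof (rule sum.cong[OF refl], clarify)
      fix m1 m2 assume "(m1, m2) \<in> decomp m"
      then have d: "dg m = dg m1 + dg m2" by (auto simp: decomp_def)
      show "(\<Sum>c12\<in>{(c1, c2). c1 + c2 \<le> dg m}. ?h (?E (fst (m1, m2)) (fst c12)) (?E (snd (m1, m2)) (snd c12))) =
        (\<Sum>c12\<in>{..dg m1} \<times> {..dg m2}. ?h (?E m1 (fst c12)) (?E m2 (snd c12)))"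
      proof (rule sum.mono_neutral_cong_right)
        show "finite {(c1, c2). c1 + c2 \<le> dg m}"
          by (rule finite_subset[of _ "{..dg m} \<times> {..dg m}"]) auto
        show "\<forall>i\<in>{(c1, c2). c1 + c2 \<le> dg m} - {..dg m1} \<times> {..dg m2}.
            ?h (?E (fst (m1, m2)) (fst i)) (?E (snd (m1, m2)) (snd i)) = 0"
        proof
          fix i assume "i \<in> {(c1, c2). c1 + c2 \<le> dg m} - {..dg m1} \<times> {..dg m2}"
          then have "dg m1 < fst i \<or> dg m2 < snd i" by (auto simp: not_le)
          then show "?h (?E (fst (m1, m2)) (fst i)) (?E (snd (m1, m2)) (snd i)) = 0"
            using z[of m1 "fst i" m2 "snd i"] by simp
        qed
      qed (auto simp: d)
    qed
    also have "\<dots> = (\<Sum>(m1, m2)\<in>decomp m. cf (at1 F) m1 * cf (at1 G) m2 * vp (4 * frm m1 m2))"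
    proof (rule sum.cong[OF refl], clarify)
      fix m1 m2 assume "(m1, m2) \<in> decomp m"
      then have "tdeg m1 = 0" "tdeg m2 = 0" using True by (auto simp: decomp_def)
      then show "(\<Sum>c12\<in>{..dg m1} \<times> {..dg m2}. ?h (?E m1 (fst c12)) (?E m2 (snd c12))) =
          cf (at1 F) m1 * cf (at1 G) m2 * vp (4 * frm m1 m2)"
        unfolding frmE sum_distrib_right[symmetric]
        by (simp add: cf_at1 sum_product sum.cartesian_product case_prod_unfold)
    qed
    finally show ?thesis by (simp add: cf_mult)
  qed
qed

lemma at1_power: "tbdd F \<Longrightarrow> at1 (F ^ k) = at1 F ^ k"
  by (induction k) (simp_all add: at1_flat at1_mult tbdd_power)

lemma at1_ev: "tbdd p \<Longrightarrow> ge 1 p \<Longrightarrow> at1 (ev F p) = ev F (at1 p)"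
  by (rule ev_map) (simp_all add: at1_add at1_kc ge_at1 at1_power)

text \<open>A coefficient at t = 1 is the sum of those at all powers of \<open>t\<close>. The power
  0 contributes nothing because the product of exponentials is 1 at t = 0. The cutoff
  \<open>N\<close> may exceed \<open>dg m\<close> because it will be the lattice degree of in+jn',
  which can be larger than i + j.\<close>

theorem dynkin_formula:
  assumes X: "ge 1 X" "flat X" and Y: "ge 1 Y" "flat Y" and m: "tdeg m = 0" "dg m \<le> N"
  shows "(\<Sum>ps\<in>dynkin_index N. dynkin_coeff ps * cf (nbr (dynkin_word X Y ps)) m) =
    cf (plog (pexp X * pexp Y)) m"
proof -
  let ?g = "pexp (tt * X) * pexp (tt * Y)"
  have gX: "ge 1 (tt * X)" "ge 1 (tt * Y)" using X Y by (simp_all add: ge_mult_left)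
  have bX: "tbdd (tt * X)" "tbdd (tt * Y)" using X Y by (simp_all add: tbdd_tt)
  have g1: "ge 1 (?g - 1)" by (intro ge_mult_one ge_pexp gX)
  have bg: "tbdd ?g" unfolding pexp_def by (intro tbdd_mult tbdd_ev bX)
  have "at1 ?g = pexp X * pexp Y"
    unfolding pexp_def by (simp add: at1_mult tbdd_ev bX gX at1_ev at1_tt X Y)
  then have at1: "at1 (plog ?g) = plog (pexp X * pexp Y)"
    unfolding plog_def by (subst at1_ev) (simp_all add: tbdd_diff bg tbdd_flat g1 at1_diff at1_flat)
  have "at0 (tt * W) = 0" if "flat W" for W
    by (rule qplane_eqI) (use cf_tt_flat[OF that, of 1] in \<open>simp add: cf_at0\<close>)
  moreover have ev0: "ev F 0 = kc (F $$ 0)" for F :: "qfield fps"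
    by (rule qplane_eqI) (simp add: ev_def psum_def power_0_left cf_one cf_kc if_distrib[of "\<lambda>F. cf F _"] cong: if_cong)
  ultimately have "at0 ?g = 1"
    unfolding pexp_def by (simp add: at0_mult at0_ev gX X Y)
  then have at0: "at0 (plog ?g) = 0"
    unfolding plog_def by (subst at0_ev) (simp_all add: g1 at0_diff at0_one ev0)
  have E0: "cf (plog ?g) (Expo (xdeg m) (ydeg m) 0) = 0"
    using arg_cong[OF at0, of "\<lambda>F. cf F (Expo (xdeg m) (ydeg m) 0)"] by (simp add: cf_at0)
  have bl: "tbdd (plog ?g)" unfolding plog_def by (intro tbdd_ev tbdd_diff bg tbdd_flat) simp
  have "cf (plog (pexp X * pexp Y)) m = (\<Sum>c\<le>dg m. cf (plog ?g) (Expo (xdeg m) (ydeg m) c))"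
    unfolding at1[symmetric] using m by (simp add: cf_at1)
  also have "\<dots> = (\<Sum>c\<in>{1..N}. cf (plog ?g) (Expo (xdeg m) (ydeg m) c))"
  proof (rule sum.mono_neutral_cong)
    fix i
    show "cf (plog ?g) (Expo (xdeg m) (ydeg m) i) = 0" if "i \<in> {1..N} - {..dg m}"
      using bl that by (auto simp: tbdd_def dg_def)
    show "cf (plog ?g) (Expo (xdeg m) (ydeg m) i) = 0" if "i \<in> {..dg m} - {1..N}"
    proof -
      have "i = 0" using m that by (auto simp: One_nat_def)
      then show ?thesis using E0 by simp
    qed
  qed auto
  also have "\<dots> = (\<Sum>c\<in>{1..N}. \<Sum>k<c. (- 1) ^ k / (of_nat (Suc k) * of_nat c) * cf (word_sum X Y (Suc k) c) m)"
  proof (rule sum.cong[OF refl])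
    fix c assume "c \<in> {1..N}"
    then have "0 < c" by simp
    then show "cf (plog ?g) (Expo (xdeg m) (ydeg m) c) =
        (\<Sum>k<c. (- 1) ^ k / (of_nat (Suc k) * of_nat c) * cf (word_sum X Y (Suc k) c) m)"
      by (rule cf_plog_g[OF X Y m(1)])
  qed
  also have "\<dots> = (\<Sum>c\<in>{1..N}. \<Sum>k<c. \<Sum>ps\<in>words (Suc k) c. dynkin_coeff ps * cf (nbr (dynkin_word X Y ps)) m)"
  proof (intro sum.cong refl)
    fix c k
    have wt: "word_wt ps = 1 / (\<Prod>(r, s)\<leftarrow>ps. fact r * fact s)" for ps
      by (induction ps) (auto simp: word_wt_def block_wt_def)
    show "(- 1) ^ k / (of_nat (Suc k) * of_nat c) * cf (word_sum X Y (Suc k) c) m =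
      (\<Sum>ps\<in>words (Suc k) c. dynkin_coeff ps * cf (nbr (dynkin_word X Y ps)) m)"
      unfolding word_sum_def cf_sum cf_kc_mult sum_distrib_left
      by (rule sum.cong) (auto simp: words_def dynkin_coeff_def wt simp del: of_nat_Suc)
  qed
  also have "\<dots> = (\<Sum>(c, k, ps)\<in>(SIGMA c:{1..N}. SIGMA k:{..<c}. words (Suc k) c). dynkin_coeff ps * cf (nbr (dynkin_word X Y ps)) m)"
    by (simp add: sum.Sigma finite_words)
  also have "\<dots> = (\<Sum>ps\<in>dynkin_index N. dynkin_coeff ps * cf (nbr (dynkin_word X Y ps)) m)"
  proof (rule sum.reindex_bij_witness[of _ "\<lambda>ps. (dynkin_len ps, length ps - 1, ps)" "\<lambda>(c, k, ps). ps"])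
    fix ps assume ps: "ps \<in> dynkin_index N"
    then have "length ps \<le> dynkin_len ps" "0 < length ps"
      by (auto simp: dynkin_index_def intro!: dynkin_len_bounds(1))
    then have "1 \<le> dynkin_len ps" "length ps - 1 < dynkin_len ps" "Suc (length ps - 1) = length ps"
      by linarith+
    then show "(dynkin_len ps, length ps - 1, ps) \<in> (SIGMA c:{1..N}. SIGMA k:{..<c}. words (Suc k) c)"
      using ps by (auto simp: dynkin_index_def words_def)
  qed (auto simp: dynkin_index_def words_def One_nat_def)
  finally show ?thesis by simp
qed

section \<open>The quantum dilogarithm as a power series\<close>

definition scl :: "'a::field_char_0 \<Rightarrow> 'a fps \<Rightarrow> 'a fps" where
  "scl a F = F oo (fps_const a * fps_X)"

lemma scl_nth [simp]: "scl a F $$ n = a ^ n * F $$ n"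
  by (simp add: scl_def fps_compose_linear)

lemma scl_mult: "scl a (F * G) = scl a F * scl a G"
  by (simp add: scl_def fps_compose_mult_distrib)

lemma scl_1 [simp]: "scl 1 F = F"
  by (rule fps_ext) simp

lemma scl_scl [simp]: "scl a (scl b F) = scl (a * b) F"
  by (rule fps_ext) (simp add: power_mult_distrib mult.assoc)

lemma scl_const_mult: "scl a (fps_const c * F) = fps_const c * scl a F"
  by (rule fps_ext) (simp add: mult_ac)

lemma scl_lin: "scl a (1 + fps_const c * fps_X) = 1 + fps_const (a * c) * fps_X"
  and scl_lin': "scl a (1 - fps_const c * fps_X) = 1 - fps_const (a * c) * fps_X"
  by (simp_all add: scl_def fps_compose_add_distrib fps_compose_sub_distrib fps_compose_mult_distrib
      mult_ac flip: fps_const_mult)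

definition fexp :: "'a::field_char_0 fps \<Rightarrow> 'a fps" where
  "fexp A = fps_exp 1 oo A"

lemma fexp_nth_0 [simp]: "A $$ 0 = 0 \<Longrightarrow> fexp A $$ 0 = 1"
  by (simp add: fexp_def)

lemma fps_deriv_fexp: "A $$ 0 = 0 \<Longrightarrow> fps_deriv (fexp A) = fps_deriv A * fexp A"
  unfolding fexp_def by (subst fps_compose_deriv) (simp_all add: mult.commute)

lemma fps_ode_unique:
  fixes F G :: "'a::field_char_0 fps"
  assumes "fps_deriv F = A * F" "fps_deriv G = A * G" "F $$ 0 = G $$ 0"
  shows "F = G"
proof (rule fps_ext)
  fix n
  have "\<forall>i\<le>n. F $$ i = G $$ i"
  proof (induction n)
    case (Suc n)
    have "fps_deriv F $$ n = fps_deriv G $$ n"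
      unfolding assms fps_mult_nth using Suc by simp
    then have "of_nat (Suc n) * F $$ Suc n = of_nat (Suc n) * G $$ Suc n"
      by (simp only: fps_deriv_nth Suc_eq_plus1)
    then have "F $$ Suc n = G $$ Suc n" by (simp del: of_nat_Suc)
    then show ?case using Suc by (auto simp: le_Suc_eq)
  qed (simp add: assms)
  then show "F $$ n = G $$ n" by simp
qed

lemma fexp_add:
  assumes "A $$ 0 = 0" "B $$ 0 = 0"
  shows "fexp (A + B) = fexp A * fexp B"
proof (rule fps_ode_unique)
  show "fps_deriv (fexp (A + B)) = fps_deriv (A + B) * fexp (A + B)"
    by (rule fps_deriv_fexp) (simp add: assms)
  show "fps_deriv (fexp A * fexp B) = fps_deriv (A + B) * (fexp A * fexp B)"
    by (simp add: fps_deriv_fexp assms algebra_simps)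
qed (simp add: assms)

lemma fexp_sum: "(\<And>i. i \<in> I \<Longrightarrow> A i $$ 0 = 0) \<Longrightarrow> fexp (\<Sum>i\<in>I. A i) = (\<Prod>i\<in>I. fexp (A i))"
proof (induction I rule: infinite_finite_induct)
  case (insert i I)
  then show ?case by (simp add: fexp_add fps_sum_nth)
qed (simp_all add: fexp_def)

lemma scl_fexp: "A $$ 0 = 0 \<Longrightarrow> scl a (fexp A) = fexp (scl a A)"
  unfolding scl_def fexp_def by (rule fps_compose_assoc[symmetric]) simp_all

lemma fexp_ln: "fexp (scl a (fps_ln 1)) = 1 + fps_const (a::qfield) * fps_X"
proof -
  have "fexp (fps_ln 1) = 1 + (fps_X :: qfield fps)"
    using fps_ln_compose(2) by (simp add: fexp_def fps_compose_sub_distrib diff_eq_eq add.commute)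
  then have "scl a (fexp (fps_ln 1)) = 1 + fps_const a * fps_X"
    by (simp add: scl_def fps_compose_add_distrib)
  then show ?thesis by (simp add: scl_fexp)
qed

text \<open>The exponent of a quantum dilogarithm with s = q^a; the common factor q - q^-1 of the
  q-numbers is left to \<open>Lam\<close>.\<close>

definition psil :: "qfield \<Rightarrow> qfield fps" where
  "psil s = Abs_fps (\<lambda>j. if j = 0 then 0 else (- 1) ^ (j + 1) / (of_nat j * (s ^ j - inverse (s ^ j))))"

definition psi :: "qfield \<Rightarrow> qfield fps" where
  "psi s = fexp (psil s)"

lemma psil_nth_0 [simp]: "psil s $$ 0 = 0"
  by (simp add: psil_def)

lemma psi_nth_0 [simp]: "psi s $$ 0 = 1"
  by (simp add: psi_def)

definition generic :: "qfield \<Rightarrow> bool" where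
  "generic s \<longleftrightarrow> s \<noteq> 0 \<and> (\<forall>j>0. s ^ j \<noteq> 1)"

lemma generic_v: "0 < k \<Longrightarrow> generic (v ^ k)"
  by (simp add: generic_def power_mult[symmetric])

lemma generic_diff:
  assumes "generic s" "0 < j"
  shows "s ^ j - inverse (s ^ j) \<noteq> 0"
proof
  have s: "s ^ j \<noteq> 0" using assms by (simp add: generic_def)
  assume "s ^ j - inverse (s ^ j) = 0"
  then have "s ^ j * s ^ j = 1" using s by (metis eq_iff_diff_eq_0 right_inverse)
  then have "s ^ (j + j) = 1" by (simp only: power_add)
  then show False using assms by (simp add: generic_def)
qed

text \<open>Scaling by s^2 multiplies the j-th coefficient of the logarithm by s^(2j), and s^(2j) -
  1 = s^j (s^j - s^-j) cancels the denominator. What remains is the logarithm of 1 + sX.\<close>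

lemma psi_functional:
  assumes "generic s"
  shows "scl (s\<^sup>2) (psi s) = (1 + fps_const s * fps_X) * psi s"
proof -
  have "scl (s\<^sup>2) (psil s) = scl s (fps_ln 1) + psil s"
  proof (rule fps_ext)
    fix j
    show "scl (s\<^sup>2) (psil s) $$ j = (scl s (fps_ln 1) + psil s) $$ j"
    proof (cases "j = 0")
      case False
      define t where "t = s ^ j"
      have t: "t \<noteq> 0" "t - inverse t \<noteq> 0"
        using assms False generic_diff[of s j] by (simp_all add: t_def generic_def)
      have e: "t\<^sup>2 - 1 = t * (t - inverse t)" using t by (simp add: power2_eq_square field_simps)
      define r :: qfield where "r = (- 1) ^ (j + 1) / of_nat j"
      have "(s\<^sup>2) ^ j = t\<^sup>2" by (simp add: t_def power_mult[symmetric] mult.commute)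
      moreover have "psil s $$ j = r / (t - inverse t)"
        using False by (simp add: psil_def t_def r_def)
      ultimately have "scl (s\<^sup>2) (psil s) $$ j - psil s $$ j = (t\<^sup>2 - 1) * (r / (t - inverse t))"
        by (simp only: scl_nth left_diff_distrib mult_1_left)
      also have "\<dots> = t * r" using t by (simp add: e)
      also have "\<dots> = scl s (fps_ln 1) $$ j"
        using False by (cases j) (simp_all add: fps_ln_nth t_def r_def One_nat_def)
      finally show ?thesis by (simp add: algebra_simps)
    qed simp
  qed
  then show ?thesis unfolding psi_def by (simp add: scl_fexp fexp_add fexp_ln)
qed

section \<open>The central factor as a series in one variable\<close>

abbreviation u :: qfield where "u \<equiv> v\<^sup>2"

text \<open>The logarithm of \<open>(1-z) \<Prod>\<^sub>k\<^sub>\<ge>\<^sub>1 (1-u\<^bsup>2k\<^esup>z)\<^sup>2\<close>.\<close>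

definition bl :: "qfield fps" where
  "bl = Abs_fps (\<lambda>j. if j = 0 then 0 else (u ^ j + inverse (u ^ j)) / (of_nat j * (u ^ j - inverse (u ^ j))))"

definition fbl :: "qfield fps" where "fbl = fexp bl"

lemma bl_nth_0 [simp]: "bl $$ 0 = 0"
  by (simp add: bl_def)

lemma generic_u: "generic u"
  by (rule generic_v) simp

text \<open>With t = u^j one has (t^2 - 1)(t + t^-1)/(t - t^-1) = t^2 + 1, and (t^2 + 1)/j is the
  j-th coefficient of -log(1 - X) - log(1 - u^2 X).\<close>

lemma fbl_functional:
  "scl (u\<^sup>2) fbl * ((1 - fps_X) * (1 - fps_const (u\<^sup>2) * fps_X)) = fbl"
proof -
  have "scl (u\<^sup>2) bl + (scl (- 1) (fps_ln 1) + scl (- (u\<^sup>2)) (fps_ln 1)) = bl"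
  proof (rule fps_ext)
    fix j
    show "(scl (u\<^sup>2) bl + (scl (- 1) (fps_ln 1) + scl (- (u\<^sup>2)) (fps_ln 1))) $$ j = bl $$ j"
    proof (cases "j = 0")
      case False
      define t where "t = u ^ j"
      have t: "t \<noteq> 0" "t - inverse t \<noteq> 0"
        using False generic_diff[OF generic_u, of j] by (simp_all add: t_def)
      have e: "(t\<^sup>2 - 1) * (t + inverse t) = (t - inverse t) * (t\<^sup>2 + 1)"
        using t by (simp add: power2_eq_square field_simps)
      have T: "(u\<^sup>2) ^ j = t\<^sup>2" by (simp add: t_def power_mult[symmetric] mult.commute)
      have "scl (u\<^sup>2) bl $$ j - bl $$ j = ((t\<^sup>2 - 1) * (t + inverse t)) / (of_nat j * (t - inverse t))"
        using False T by (simp add: bl_def t_def algebra_simps diff_divide_distrib)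
      also have "\<dots> = (t\<^sup>2 + 1) / of_nat j" using t unfolding e by (simp add: mult.commute)
      finally have 1: "scl (u\<^sup>2) bl $$ j - bl $$ j = (t\<^sup>2 + 1) / of_nat j" .
      have ln: "fps_ln 1 $$ j = - ((- 1) ^ j / of_nat j :: qfield)"
        using False by (cases j) (simp_all add: fps_ln_nth One_nat_def)
      have "(- (u\<^sup>2)) ^ j = (- 1) ^ j * t\<^sup>2" using T by (metis power_minus)
      then have "scl (- 1) (fps_ln 1) $$ j + scl (- (u\<^sup>2)) (fps_ln 1) $$ j =
          - (((- 1) ^ j * (- 1) ^ j) * (t\<^sup>2 + 1) / of_nat j)"
        using False by (simp add: ln algebra_simps add_divide_distrib)
      also have "(- 1) ^ j * (- 1) ^ j = (1::qfield)" by (simp add: power_add[symmetric])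
      finally show ?thesis using 1 by (simp add: diff_eq_eq)
    qed simp
  qed
  then have "fexp bl = fexp (scl (u\<^sup>2) bl + (scl (- 1) (fps_ln 1) + scl (- (u\<^sup>2)) (fps_ln 1)))"
    by simp
  also have "\<dots> = scl (u\<^sup>2) fbl * (fexp (scl (- 1) (fps_ln 1)) * fexp (scl (- (u\<^sup>2)) (fps_ln 1)))"
    by (simp add: fexp_add scl_fexp fbl_def)
  finally show ?thesis by (simp add: fbl_def fexp_ln flip: fps_const_neg)
qed

text \<open>These are \<open>f\<close>, \<open>\<phi>(z) = v f(u\<^sup>2z)\<close> and the central factor \<open>M\<close>, which solves \<open>M(u\<^sup>2z) = f(z) M(z)\<close>.\<close>

definition ff :: "qfield fps" where
  "ff = (1 + fps_const u * fps_X) * inverse ((1 - fps_X) * (1 - fps_const (u\<^sup>2) * fps_X))"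

definition fphi :: "qfield fps" where
  "fphi = fps_const v * scl (u\<^sup>2) ff"

definition fm :: "qfield fps" where
  "fm = psi u * fbl"

lemma ff_mult: "ff * ((1 - fps_X) * (1 - fps_const (u\<^sup>2) * fps_X)) = 1 + fps_const u * fps_X"
  unfolding ff_def by (simp add: mult.assoc inverse_mult_eq_1 del: fps_const_power)

lemma ff_nth_0 [simp]: "ff $$ 0 = 1"
  by (simp add: ff_def)

lemma fm_functional: "scl (u\<^sup>2) fm = ff * fm"
proof -
  let ?d = "(1 - fps_X) * (1 - fps_const (u\<^sup>2) * fps_X) :: qfield fps"
  have "scl (u\<^sup>2) fm = (1 + fps_const u * fps_X) * psi u * scl (u\<^sup>2) fbl"
    by (simp only: fm_def scl_mult psi_functional[OF generic_u])
  also have "\<dots> = (ff * ?d) * psi u * scl (u\<^sup>2) fbl" by (simp only: ff_mult)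
  also have "\<dots> = ff * psi u * (scl (u\<^sup>2) fbl * ?d)" by (simp only: mult_ac)
  also have "\<dots> = ff * fm" unfolding fbl_functional fm_def by (simp only: mult.assoc)
  finally show ?thesis .
qed

text \<open>The part of \<open>key_relation\<close> that involves \<open>zz\<close> alone. The
  factors 1 - u^4 X and 1 - X already clear one half of each denominator; multiplying by the shared
  half 1 - u^2 X leaves a polynomial identity.\<close>

lemma ff_identity:
  "scl (u\<^sup>2) ff * (1 - fps_const (u ^ 4) * fps_X) - fps_const u * (ff * (1 - fps_X)) + fps_const (u - 1) = 0"
proof -
  let ?X = "fps_X :: qfield fps"
  let ?b = "1 - fps_const (u\<^sup>2) * ?X"
  have s: "scl (u\<^sup>2) (1 - ?X) = ?b" "scl (u\<^sup>2) ?b = 1 - fps_const (u ^ 4) * ?X"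
    "scl (u\<^sup>2) (1 + fps_const u * ?X) = 1 + fps_const (u ^ 3) * ?X"
    using scl_lin'[of "u\<^sup>2" 1] by (simp_all add: scl_lin scl_lin' flip: power_mult power_add)
  have e1: "scl (u\<^sup>2) ff * (?b * (1 - fps_const (u ^ 4) * ?X)) = 1 + fps_const (u ^ 3) * ?X"
    using arg_cong[OF ff_mult, of "scl (u\<^sup>2)"] by (simp only: scl_mult s)
  have "(scl (u\<^sup>2) ff * (1 - fps_const (u ^ 4) * ?X) - fps_const u * (ff * (1 - ?X)) + fps_const (u - 1)) * ?b =
     scl (u\<^sup>2) ff * (?b * (1 - fps_const (u ^ 4) * ?X)) - fps_const u * (ff * ((1 - ?X) * ?b)) + fps_const (u - 1) * ?b"
    by (simp only: algebra_simps)
  also have "\<dots> = 0"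
    unfolding e1 ff_mult
    by (rule fps_ext) (simp add: algebra_simps power2_eq_square power_eq_if[of _ 3] flip: fps_const_mult)
  finally have z: "(scl (u\<^sup>2) ff * (1 - fps_const (u ^ 4) * ?X) - fps_const u * (ff * (1 - ?X)) + fps_const (u - 1)) * ?b = 0" .
  have "?b $$ 0 \<noteq> 0" by simp
  then have "?b \<noteq> 0" by (metis fps_zero_nth)
  then show ?thesis using z by (metis mult_eq_0_iff)
qed

section \<open>Endomorphisms and difference equations\<close>

definition push :: "(expo \<Rightarrow> expo) \<Rightarrow> qplane \<Rightarrow> qplane" where
  "push h F = Abs_qplane (\<lambda>m. if m \<in> range h then cf F (inv_into UNIV h m) else 0)"

text \<open>Injectivity is what can be had, since the shears are not surjective on nonnegative
  exponents. \<open>h_dg\<close> makes \<open>push h\<close> respect the filtration.\<close>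

locale expo_map =
  fixes h :: "expo \<Rightarrow> expo"
  assumes h_add: "h (m + n) = h m + h n"
    and h_inj: "inj h"
    and h_dg: "dg n \<le> dg (h n)"
    and h_tdeg: "tdeg (h n) = tdeg n"
begin

lemma cf_push [simp]: "cf (push h F) (h n) = cf F n"
  by (simp add: push_def h_inj)

lemma cf_push_outside: "m \<notin> range h \<Longrightarrow> cf (push h F) m = 0"
  by (simp add: push_def)

lemma push_eqI:
  assumes "\<And>n. cf G (h n) = cf F n" "\<And>m. m \<notin> range h \<Longrightarrow> cf G m = 0"
  shows "push h F = G"
proof (rule qplane_eqI)
  fix m show "cf (push h F) m = cf G m"
    by (cases "m \<in> range h") (auto simp: assms cf_push_outside)
qed

lemma push_add: "push h (F + G) = push h F + push h G"
  and push_diff: "push h (F - G) = push h F - push h G"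
  and push_kc: "push h (kc a * F) = kc a * push h F"
  by (rule push_eqI; simp add: cf_push_outside)+

lemma h_zero: "h 0 = 0"
  using h_add[of 0 0] by simp

lemma push_mon: "push h (mon n) = mon (h n)"
  by (rule push_eqI) (use h_inj in \<open>auto simp: cf_mon inj_eq\<close>)

lemma push_one: "push h 1 = 1"
  using push_mon[of 0] by (simp add: h_zero)

lemma push_const: "push h (kc a) = kc a"
  using push_kc[of a 1] by (simp add: push_one)

lemma push_inject: "push h F = push h G \<Longrightarrow> F = G"
  by (metis cf_push qplane_eqI)

lemma ge_push: "ge l F \<Longrightarrow> ge l (push h F)"
  unfolding ge_def
proof (intro allI impI)
  fix m assume F: "\<forall>m. dg m < l \<longrightarrow> cf F m = 0" and m: "dg m < l"
  show "cf (push h F) m = 0"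
  proof (cases "m \<in> range h")
    case True
    then obtain n where n: "m = h n" by blast
    then have "dg n < l" using h_dg[of n] m by simp
    then show ?thesis using F n by simp
  qed (simp add: cf_push_outside)
qed

lemma flat_push: "flat F \<Longrightarrow> flat (push h F)"
  unfolding flat_def
proof (intro allI impI)
  fix m assume "\<forall>m. tdeg m \<noteq> 0 \<longrightarrow> cf F m = 0" "tdeg m \<noteq> 0"
  then show "cf (push h F) m = 0"
    by (cases "m \<in> range h") (auto simp: cf_push_outside h_tdeg)
qed

text \<open>The weight \<open>w\<close> is arbitrary so that homomorphisms and antihomomorphisms
  share the argument.\<close>

lemma sum_decomp_push:
  "(\<Sum>(m1, m2)\<in>decomp (h n). cf (push h F) m1 * cf (push h G) m2 * w m1 m2) =
    (\<Sum>(n1, n2)\<in>decomp n. cf F n1 * cf G n2 * w (h n1) (h n2))"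
proof -
  have "(\<Sum>(m1, m2)\<in>decomp (h n). cf (push h F) m1 * cf (push h G) m2 * w m1 m2) =
     (\<Sum>(m1, m2)\<in>map_prod h h ` decomp n. cf (push h F) m1 * cf (push h G) m2 * w m1 m2)"
  proof (rule sum.mono_neutral_right)
    show "map_prod h h ` decomp n \<subseteq> decomp (h n)" by (auto simp: decomp_def h_add)
    show "\<forall>p\<in>decomp (h n) - map_prod h h ` decomp n.
        (case p of (m1, m2) \<Rightarrow> cf (push h F) m1 * cf (push h G) m2 * w m1 m2) = 0"
    proof
      fix p assume p: "p \<in> decomp (h n) - map_prod h h ` decomp n"
      obtain m1 m2 where m: "p = (m1, m2)" by (cases p)
      have "m1 \<notin> range h \<or> m2 \<notin> range h"
      proof (rule ccontr)
        assume "\<not> (m1 \<notin> range h \<or> m2 \<notin> range h)"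
        then obtain n1 n2 where n: "m1 = h n1" "m2 = h n2" by auto
        then have "h (n1 + n2) = h n" using p m by (simp add: decomp_def h_add)
        then have "(n1, n2) \<in> decomp n" using h_inj by (simp add: decomp_def inj_eq)
        then show False using p m n by (auto simp: image_iff map_prod_def)
      qed
      then show "(case p of (m1, m2) \<Rightarrow> cf (push h F) m1 * cf (push h G) m2 * w m1 m2) = 0"
        by (auto simp: m cf_push_outside)
    qed
  qed simp
  also have "\<dots> = (\<Sum>p\<in>decomp n. (\<lambda>(m1, m2). cf (push h F) m1 * cf (push h G) m2 * w m1 m2) (map_prod h h p))"
    by (rule sum.reindex[unfolded comp_def]) (intro inj_on_subset[OF prod.inj_map] h_inj subset_UNIV)
  also have "\<dots> = (\<Sum>(n1, n2)\<in>decomp n. cf F n1 * cf G n2 * w (h n1) (h n2))"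
    by (simp add: case_prod_unfold)
  finally show ?thesis .
qed

lemma sum_decomp_push_outside:
  assumes "m \<notin> range h"
  shows "(\<Sum>(m1, m2)\<in>decomp m. cf (push h F) m1 * cf (push h G) m2 * w m1 m2) = 0"
proof (rule sum.neutral, clarify)
  fix m1 m2 assume "(m1, m2) \<in> decomp m"
  then have "m1 \<notin> range h \<or> m2 \<notin> range h" using assms by (auto simp: decomp_def h_add[symmetric])
  then show "cf (push h F) m1 * cf (push h G) m2 * w m1 m2 = 0" by (auto simp: cf_push_outside)
qed

end

locale expo_hom = expo_map +
  assumes h_frm: "frm (h m) (h n) = frm m n"
begin

lemma push_mult: "push h (F * G) = push h F * push h G"
  by (rule push_eqI) (simp_all add: cf_mult sum_decomp_push sum_decomp_push_outside h_frm)

lemma push_power: "push h (F ^ k) = push h F ^ k"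
  by (induction k) (simp_all add: push_one push_mult)

lemma push_ev: "ge 1 p \<Longrightarrow> push h (ev F p) = ev F (push h p)"
  by (rule ev_map) (simp_all add: push_add push_kc ge_push push_power)

end

locale expo_antihom = expo_map +
  assumes h_frm: "frm (h m) (h n) = frm n m"
begin

lemma push_mult: "push h (F * G) = push h G * push h F"
proof (rule push_eqI)
  fix n
  have "cf (push h G * push h F) (h n) = (\<Sum>(n1, n2)\<in>decomp n. cf G n1 * cf F n2 * vp (4 * frm n2 n1))"
    by (simp add: cf_mult sum_decomp_push h_frm)
  also have "\<dots> = (\<Sum>(n1, n2)\<in>decomp n. cf G n2 * cf F n1 * vp (4 * frm n1 n2))"
    by (rule sum_decomp_swap)
  finally show "cf (push h G * push h F) (h n) = cf (F * G) n" by (simp add: cf_mult mult.commute)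
qed (simp add: cf_mult sum_decomp_push_outside)

lemma push_power: "push h (F ^ k) = push h F ^ k"
  by (induction k) (simp_all add: push_one push_mult power_commutes)

lemma push_ev: "ge 1 p \<Longrightarrow> push h (ev F p) = ev F (push h p)"
  by (rule ev_map) (simp_all add: push_add push_kc ge_push push_power)

end

text \<open>The shears \<open>x \<mapsto> xy\<close> and \<open>y \<mapsto> xy\<close> preserve the form; the swap \<open>x \<leftrightarrow> y\<close> reverses it and therefore
  induces an anti-automorphism.\<close>

definition hI :: "expo \<Rightarrow> expo" where "hI m = Expo (xdeg m) (xdeg m + ydeg m) (tdeg m)"
definition hG :: "expo \<Rightarrow> expo" where "hG m = Expo (xdeg m + ydeg m) (ydeg m) (tdeg m)"
definition hS :: "expo \<Rightarrow> expo" where "hS m = Expo (ydeg m) (xdeg m) (tdeg m)"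

interpretation io: expo_hom hI
  by unfold_locales (auto simp: hI_def inj_def expo.expand dg_def frm_def algebra_simps)

interpretation ga: expo_hom hG
  by unfold_locales (auto simp: hG_def inj_def expo.expand dg_def frm_def algebra_simps)

interpretation sw: expo_antihom hS
  by unfold_locales (auto simp: hS_def inj_def expo.expand dg_def frm_def algebra_simps)

section \<open>Scaling automorphisms\<close>

definition sc :: "qfield \<Rightarrow> qfield \<Rightarrow> qplane \<Rightarrow> qplane" where
  "sc s t F = Abs_qplane (\<lambda>m. s ^ xdeg m * t ^ ydeg m * cf F m)"

lemma cf_sc: "cf (sc s t F) m = s ^ xdeg m * t ^ ydeg m * cf F m"
  by (simp add: sc_def)

lemma sc_add: "sc s t (F + G) = sc s t F + sc s t G"
  and sc_diff: "sc s t (F - G) = sc s t F - sc s t G"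
  and sc_kc: "sc s t (kc a * F) = kc a * sc s t F"
  and sc_mon: "sc s t (mon m) = kc (s ^ xdeg m * t ^ ydeg m) * mon m"
  and sc_one: "sc s t 1 = 1"
  by (rule qplane_eqI; simp add: cf_sc cf_one cf_mon algebra_simps)+

lemma sc_mult: "sc s t (F * G) = sc s t F * sc s t G"
  by (rule qplane_eqI)
     (auto intro!: sum.cong simp: cf_sc cf_mult sum_distrib_left decomp_def power_add mult_ac)

lemma sc_power: "sc s t (F ^ k) = sc s t F ^ k"
  by (induction k) (simp_all add: sc_one sc_mult)

lemma ge_sc: "ge l F \<Longrightarrow> ge l (sc s t F)"
  by (simp add: ge_def cf_sc)

lemma sc_ev: "ge 1 p \<Longrightarrow> sc s t (ev F p) = ev F (sc s t p)"
  by (rule ev_map) (simp_all add: sc_add sc_kc ge_sc sc_power)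

lemma sc_sc: "sc s t (sc s' t' F) = sc (s * s') (t * t') F"
  by (rule qplane_eqI) (simp add: cf_sc power_mult_distrib mult_ac)

lemma sc_1 [simp]: "sc 1 1 F = F"
  by (rule qplane_eqI) (simp add: cf_sc)

lemma sc_push:
  assumes "expo_map h" "\<And>n. s ^ xdeg (h n) * t ^ ydeg (h n) = s' ^ xdeg n * t' ^ ydeg n"
  shows "sc s t (push h F) = push h (sc s' t' F)"
  by (rule sym, rule expo_map.push_eqI[OF assms(1)])
     (simp_all add: cf_sc assms expo_map.cf_push expo_map.cf_push_outside)

lemma sc_io: "sc s t (push hI F) = push hI (sc (s * t) t F)"
  by (rule sc_push) (simp_all add: io.expo_map_axioms hI_def power_add power_mult_distrib mult_ac)

lemma sc_ga: "sc s t (push hG F) = push hG (sc s (s * t) F)"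
  by (rule sc_push) (simp_all add: ga.expo_map_axioms hG_def power_add power_mult_distrib mult_ac)

lemma sc_sw: "sc s t (push hS F) = push hS (sc t s F)"
  by (rule sc_push) (simp_all add: sw.expo_map_axioms hS_def mult_ac)

abbreviation xx :: qplane where "xx \<equiv> mon (Expo 1 0 0)"
abbreviation yy :: qplane where "yy \<equiv> mon (Expo 0 1 0)"
abbreviation zz :: qplane where "zz \<equiv> mon (Expo 1 1 0)"

lemma ge_gens [simp]: "ge 1 xx" "ge 1 yy" "ge 1 zz"
  by (simp_all add: ge_mon dg_def)

lemma yy_conj: "yy * F = sc (v ^ 8) 1 F * yy"
proof (rule qplane_eqI)
  fix m
  have "cf (sc (v ^ 8) 1 F * yy) m = (\<Sum>(m1, m2)\<in>decomp m. cf (sc (v ^ 8) 1 F) m2 * cf yy m1 * vp (4 * frm m2 m1))"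
    unfolding cf_mult by (rule sum_decomp_swap)
  also have "\<dots> = cf (yy * F) m"
    unfolding cf_mult
  proof (intro sum.cong refl, clarify)
    fix m1 m2
    have "vp (4 * int (xdeg m2)) = v ^ (8 * xdeg m2) * vp (- (4 * int (xdeg m2)))"
      unfolding vp_of_nat[symmetric] vp_add[symmetric] by simp
    then show "cf (sc (v ^ 8) 1 F) m2 * cf yy m1 * vp (4 * frm m2 m1) = cf yy m1 * cf F m2 * vp (4 * frm m1 m2)"
      by (simp add: cf_sc cf_mon frm_def power_mult)
  qed
  finally show "cf (yy * F) m = cf (sc (v ^ 8) 1 F * yy) m" by simp
qed

lemma xx_conj: "F * xx = xx * sc 1 (v ^ 8) F"
proof (rule qplane_eqI)
  fix m
  have "cf (F * xx) m = (\<Sum>(m1, m2)\<in>decomp m. cf F m2 * cf xx m1 * vp (4 * frm m2 m1))"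
    unfolding cf_mult by (rule sum_decomp_swap)
  also have "\<dots> = cf (xx * sc 1 (v ^ 8) F) m"
    unfolding cf_mult
  proof (intro sum.cong refl, clarify)
    fix m1 m2
    have "vp (4 * int (ydeg m2)) = v ^ (8 * ydeg m2) * vp (- (4 * int (ydeg m2)))"
      unfolding vp_of_nat[symmetric] vp_add[symmetric] by simp
    then show "cf F m2 * cf xx m1 * vp (4 * frm m2 m1) = cf xx m1 * cf (sc 1 (v ^ 8) F) m2 * vp (4 * frm m1 m2)"
      by (simp add: cf_sc cf_mon frm_def power_mult)
  qed
  finally show "cf (F * xx) m = cf (xx * sc 1 (v ^ 8) F) m" .
qed

section \<open>Uniqueness and existence for difference equations\<close>

lemma mon_left_cancel: "mon n * F = mon n * G \<Longrightarrow> F = G"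
proof (rule qplane_eqI)
  fix m assume "mon n * F = mon n * G"
  then have "cf (mon n * F) (n + m) = cf (mon n * G) (n + m)" by simp
  then show "cf F m = cf G m" by simp
qed

text \<open>In the lowest degree of \<open>Q\<close> the factor \<open>B\<close> is invisible, so a
  coefficient survives only where its scaling weight equals \<open>a\<close>. Every uniqueness
  argument below reduces to locating these weights.\<close>

lemma sc_eq_zero:
  assumes B: "ge 1 B" and eq: "sc s t Q = kc a * ((1 + B) * Q)"
    and zero: "\<And>m. s ^ xdeg m * t ^ ydeg m = a \<Longrightarrow> cf Q m = 0"
  shows "Q = 0"
proof (rule qplane_eq_ge)
  fix l
  have "ge l Q"
  proof (induction l)
    case (Suc l)
    have g: "ge (Suc l) (B * Q)" using ge_mult[OF B Suc] by (simp add: One_nat_def)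
    have "cf Q m = 0" if "dg m = l" for m
    proof -
      have "s ^ xdeg m * t ^ ydeg m * cf Q m = a * (cf Q m + cf (B * Q) m)"
        using arg_cong[OF eq, of "\<lambda>F. cf F m"] by (simp add: cf_sc distrib_right)
      also have "cf (B * Q) m = 0" using g that by (simp add: ge_def)
      finally have "(s ^ xdeg m * t ^ ydeg m - a) * cf Q m = 0" by (simp add: algebra_simps)
      then show ?thesis using zero[of m] by auto
    qed
    then show ?case using Suc by (auto simp: ge_def less_Suc_eq)
  qed simp
  then show "ge l (Q - 0)" by simp
qed

text \<open>A Neumann series: \<open>L\<close> inverts \<open>sc s t - 1\<close> in positive
  degrees, so the sum of the iterates of F \<mapsto> L (B F) at 1 solves sc C - C = B C.\<close>

lemma sc_exists:
  assumes B: "ge 1 B" "flat B"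
    and nz: "\<And>m. 0 < dg m \<Longrightarrow> s ^ xdeg m * t ^ ydeg m \<noteq> 1"
  shows "\<exists>C. ge 1 (C - 1) \<and> flat C \<and> sc s t C = (1 + B) * C"
proof -
  \<comment> \<open>In degree 0 the weight is 1 and no inverse exists. The default 0 there is
    harmless because \<open>L\<close> is applied only to multiples of \<open>B\<close>, which have
    no such part.\<close>
  define L where "L F = Abs_qplane (\<lambda>m. if dg m = 0 then 0 else cf F m / (s ^ xdeg m * t ^ ydeg m - 1))" for F
  define S where "S k = ((\<lambda>F. L (B * F)) ^^ k) 1" for k
  have cfL: "cf (L F) m = (if dg m = 0 then 0 else cf F m / (s ^ xdeg m * t ^ ydeg m - 1))" for F m
    by (simp add: L_def)
  have S: "S 0 = 1" "S (Suc k) = L (B * S k)" for k by (simp_all add: S_def)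
  have gL: "ge l (L F)" if "ge l F" for l F using that by (simp add: ge_def cfL)
  have gS: "ge k (S k)" for k
  proof (induction k)
    case (Suc k)
    have "ge (Suc k) (B * S k)" using ge_mult[OF B(1) Suc] by (simp add: One_nat_def)
    then show ?case by (simp add: S gL)
  qed (simp add: S)
  have fS: "flat (S k)" for k
  proof (induction k)
    case (Suc k)
    then have "flat (B * S k)" using flat_mult B by blast
    then show ?case by (simp add: S flat_def cfL)
  qed (simp add: S)
  have inv: "sc s t (L F) - L F = F" if "ge 1 F" for F
  proof (rule qplane_eqI)
    fix m
    show "cf (sc s t (L F) - L F) m = cf F m"
    proof (cases "dg m = 0")
      case True
      then show ?thesis using that by (simp add: cf_sc cfL ge_def)
    next
      case False
      then have "s ^ xdeg m * t ^ ydeg m - 1 \<noteq> 0" using nz[of m] by simp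
      moreover have "cf (sc s t (L F) - L F) m = (s ^ xdeg m * t ^ ydeg m - 1) * cf (L F) m"
        by (simp add: cf_sc algebra_simps)
      ultimately show ?thesis using False by (simp add: cfL)
    qed
  qed
  let ?C = "psum S"
  have C: "?C = 1 + psum (\<lambda>k. S (Suc k))" using psum_Suc[OF gS] by (simp add: S)
  have gS1: "ge (Suc k) (S (Suc k))" for k by (rule gS)
  have "sc s t ?C - ?C = psum (\<lambda>k. sc s t (S k) - S k)"
    by (rule psum_map[where \<phi> = "\<lambda>F. sc s t F - F"]) (auto simp: gS sc_add intro!: ge_diff ge_sc)
  also have "\<dots> = (sc s t (S 0) - S 0) + psum (\<lambda>k. sc s t (S (Suc k)) - S (Suc k))"
    by (rule psum_Suc) (intro ge_diff ge_sc gS)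
  also have "\<dots> = psum (\<lambda>k. B * S k)"
  proof -
    have "sc s t (S (Suc k)) - S (Suc k) = B * S k" for k
      unfolding S by (rule inv) (rule ge_mult_right[OF B(1)])
    then show ?thesis by (simp add: S sc_one)
  qed
  also have "\<dots> = B * ?C" by (rule psum_mult_left[OF gS, symmetric])
  finally have "sc s t ?C = (1 + B) * ?C" by (simp add: algebra_simps)
  moreover have "ge 1 (?C - 1)"
    unfolding C by (simp, rule ge_psum; rule ge_mono[OF gS1]; simp)
  moreover have "flat ?C" using fS by (simp add: flat_def psum_def)
  ultimately show ?thesis by blast
qed

section \<open>The left-going product\<close>

lemma v_eq: "u\<^sup>2 = v ^ 4" "u ^ 4 = v ^ 8"
  by (simp_all flip: power_mult)

lemmas fphi_def' = fphi_def[unfolded v_eq]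
lemmas ff_identity' = ff_identity[unfolded v_eq]
lemmas fm_functional' = fm_functional[unfolded v_eq]

lemma weight_neq_1: "0 < dg m \<Longrightarrow> (v ^ 4) ^ xdeg m * u ^ ydeg m \<noteq> 1"
proof -
  assume "0 < dg m"
  then have "v ^ (4 * xdeg m + 2 * ydeg m) \<noteq> 1" by (intro qroot_power_neq_1) (auto simp: dg_def)
  then show ?thesis by (metis power_add power_mult)
qed

lemma ev_kc: "ge 1 p \<Longrightarrow> kc a * ev F p = ev (fps_const a * F) p"
  by (simp add: ev_mult)

lemma sc_ev_xx: "sc s t (ev F xx) = ev (scl s F) xx"
  and sc_ev_yy: "sc s t (ev F yy) = ev (scl t F) yy"
  and sc_ev_zz: "sc s t (ev F zz) = ev (scl (s * t) F) zz"
  by (simp_all add: sc_ev sc_mon ev_scale scl_def)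

lemma xy_zz: "xx * yy = kc (inverse (v ^ 4)) * zz" "yy * xx = kc (v ^ 4) * zz"
proof -
  have "vp 4 = v ^ 4" using vp_of_nat[of 4] by simp
  then show "xx * yy = kc (inverse (v ^ 4)) * zz" "yy * xx = kc (v ^ 4) * zz"
    by (simp_all add: mon_mult frm_def vp_minus)
qed

lemma yy_ev_zz: "yy * ev F zz = ev (scl (v ^ 8) F) zz * yy"
  by (subst yy_conj) (simp add: sc_ev_zz)

lemma yy_ev_xx: "yy * ev F xx = ev (scl (v ^ 8) F) xx * yy"
  by (subst yy_conj) (simp add: sc_ev_xx)

lemma xx_ev_zz: "xx * ev F zz = ev (scl (inverse (v ^ 8)) F) zz * xx"
  by (subst xx_conj) (simp add: sc_ev_zz)

lemma io_gens: "push hI xx = zz" "push hI yy = yy"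
  and ga_gens: "push hG xx = xx" "push hG yy = zz"
  and sw_gens: "push hS xx = yy" "push hS yy = xx" "push hS zz = zz"
  by (simp_all add: io.push_mon ga.push_mon sw.push_mon hI_def hG_def hS_def)

lemma flat_mon [simp]: "flat (mon (Expo a b 0))"
  by (auto simp: flat_def cf_mon)

lemma flat_power: "flat F \<Longrightarrow> flat (F ^ k)"
  by (induction k) (simp_all add: flat_mult)

lemma flat_ev: "flat p \<Longrightarrow> flat (ev F p)"
  using flat_power[of p] by (simp add: flat_def ev_def psum_def)

lemma fphi_nth_0 [simp]: "fphi $$ 0 = v"
  by (simp add: fphi_def)

lemma C0_exists:
  "\<exists>C. ge 1 (C - 1) \<and> flat C \<and> sc (v ^ 4) u C = (1 + ev fphi xx * yy) * C"
proof (rule sc_exists)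
  show "ge 1 (ev fphi xx * yy)" by (simp add: ge_mult_left)
  show "flat (ev fphi xx * yy)" by (simp add: flat_mult flat_ev)
qed (rule weight_neq_1)

text \<open>\<open>C0\<close> lives in the coordinates where \<open>x\<close> stands for \<open>z\<close>, and \<open>CC\<close> in those where \<open>x\<close> stands for \<open>w\<close>;
  each application of \<open>push hI\<close> moves one step towards the original \<open>x\<close>.\<close>

definition C0 :: qplane where
  "C0 = (SOME C. ge 1 (C - 1) \<and> flat C \<and> sc (v ^ 4) u C = (1 + ev fphi xx * yy) * C)"

lemma C0: "ge 1 (C0 - 1)" "flat C0" "sc (v ^ 4) u C0 = (1 + ev fphi xx * yy) * C0"
  using someI_ex[OF C0_exists] by (simp_all add: C0_def)

lemma C0_unique:
  assumes "ge 1 (F - 1)" "sc (v ^ 4) u F = (1 + ev fphi xx * yy) * F"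
  shows "F = C0"
proof -
  have "F - C0 = 0"
  proof (rule sc_eq_zero)
    show "ge 1 (ev fphi xx * yy)" by (simp add: ge_mult_left)
    show "sc (v ^ 4) u (F - C0) = kc 1 * ((1 + ev fphi xx * yy) * (F - C0))"
      unfolding sc_diff C0(3) assms(2) by (simp add: algebra_simps)
    fix m assume m: "(v ^ 4) ^ xdeg m * u ^ ydeg m = 1"
    then have "dg m = 0" using weight_neq_1[of m] by auto
    moreover have "ge 1 (F - C0)" using ge_diff[OF assms(1) C0(1)] by simp
    ultimately show "cf (F - C0) m = 0" by (simp add: ge_def)
  qed
  then show ?thesis by simp
qed

definition CC :: qplane where "CC = push hI C0"

lemma CC: "ge 1 (CC - 1)" "flat CC" "sc u u CC = (1 + ev fphi zz * yy) * CC"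
proof -
  show "ge 1 (CC - 1)" using io.ge_push[OF C0(1)] by (simp add: CC_def io.push_diff io.push_one)
  show "flat CC" using io.flat_push[OF C0(2)] by (simp add: CC_def)
  have "sc u u CC = push hI (sc (v ^ 4) u C0)" by (simp add: CC_def sc_io flip: power_add)
  then show "sc u u CC = (1 + ev fphi zz * yy) * CC"
    unfolding C0(3) by (simp add: io.push_mult io.push_add io.push_one io.push_ev io_gens CC_def)
qed

lemma scl_fphi: "scl (v ^ 4) ff * scl (v ^ 4) fphi = fphi * scl (v ^ 8) ff"
  unfolding fphi_def' by (simp add: scl_const_mult v_eq mult_ac flip: power_add)

text \<open>With H = \<open>ev ff zz + kc v * xx\<close> and N = \<open>1 + ev fphi zz * yy\<close>,
  the left side is \<open>sc u u\<close> of H N and the right side is u N H - (u - 1), in parallel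
  with the value u HH - (u - 1) of \<open>sc u u HH\<close>. The affine terms agree and cancel in
  \<open>CC_intertwine\<close>, which leaves a homogeneous equation there.\<close>

lemma key_relation:
  "(ev (scl (v ^ 4) ff) zz + kc (v * u) * xx) * (1 + kc u * (ev (scl (v ^ 4) fphi) zz * yy)) =
    kc u * ((1 + ev fphi zz * yy) * (ev ff zz + kc v * xx)) - kc (u - 1)"
proof -
  let ?E = "\<lambda>F. ev F zz"
  have 1: "?E (scl (v ^ 4) ff) * (?E (scl (v ^ 4) fphi) * yy) = ?E (fphi * scl (v ^ 8) ff) * yy"
    by (simp add: mult.assoc[symmetric] ev_mult[symmetric] scl_fphi)
  have 2: "xx * (?E (scl (v ^ 4) fphi) * yy) = kc (v * inverse (v ^ 4)) * ?E (ff * fps_X)"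
  proof -
    have "inverse (v ^ 8) * (v ^ 4 * v ^ 4) = 1" by (simp flip: power_add)
    then have "scl (inverse (v ^ 8)) (scl (v ^ 4) fphi) = fps_const v * ff"
      unfolding fphi_def' by (simp add: scl_const_mult mult.assoc)
    then have "xx * (?E (scl (v ^ 4) fphi) * yy) = ?E (fps_const v * ff) * (xx * yy)"
      by (simp add: mult.assoc[symmetric] xx_ev_zz)
    also have "\<dots> = kc (inverse (v ^ 4)) * ?E (fps_const v * ff * fps_X)"
      unfolding xy_zz by (simp add: ev_mult kc_left_commute)
    also have "\<dots> = kc (v * inverse (v ^ 4)) * ?E (ff * fps_X)"
      by (simp add: mult.assoc ev_kc[symmetric] kc_mult_left mult.commute[of v])
    finally show ?thesis .
  qed
  have 3: "?E fphi * yy * ?E ff = ?E (fphi * scl (v ^ 8) ff) * yy"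
    by (simp add: mult.assoc yy_ev_zz ev_mult)
  have 4: "?E fphi * yy * xx = kc (v ^ 4) * ?E (fphi * fps_X)"
    by (simp add: mult.assoc xy_zz kc_left_commute ev_mult)
  have 5: "kc (u * v * u * (v * inverse (v ^ 4))) * ?E (ff * fps_X) = kc u * ?E (ff * fps_X)"
    by (simp add: field_simps numeral_eq_Suc)
  have 6: "kc (u * v * v ^ 4) * ?E (fphi * fps_X) = ?E (fps_const (v ^ 8) * (scl (v ^ 4) ff * fps_X))"
  proof -
    have "u * v * v ^ 4 * v = v ^ 8" by (simp add: numeral_eq_Suc)
    then have "fps_const (u * v * v ^ 4) * (fphi * fps_X) = fps_const (v ^ 8) * (scl (v ^ 4) ff * fps_X)"
      unfolding fphi_def' by (metis (no_types, lifting) fps_const_mult mult.assoc)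
    then show ?thesis by (simp only: ev_kc ge_gens)
  qed
  have 7: "?E (scl (v ^ 4) ff) + kc u * ?E (ff * fps_X) - kc u * ?E ff -
      ?E (fps_const (v ^ 8) * (scl (v ^ 4) ff * fps_X)) + kc (u - 1) = 0"
  proof -
    have "?E (scl (v ^ 4) ff) + kc u * ?E (ff * fps_X) - kc u * ?E ff -
      ?E (fps_const (v ^ 8) * (scl (v ^ 4) ff * fps_X)) + kc (u - 1) =
      ?E (scl (v ^ 4) ff * (1 - fps_const (v ^ 8) * fps_X) - fps_const u * (ff * (1 - fps_X)) + fps_const (u - 1))"
    proof -
      have k: "kc (u - 1) = ?E (fps_const (u - 1))" by simp
      show ?thesis unfolding k
        by (simp add: ev_kc ev_add[symmetric] ev_diff[symmetric] algebra_simps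
          del: ev_const fps_const_sub fps_const_add)
    qed
    also have "\<dots> = 0" unfolding ff_identity' using ev_const[of zz 0] by simp
    finally show ?thesis .
  qed
  have gen1: "(A + kc p * x) * (1 + kc q * W) = A + kc p * x + kc q * (A * W) + kc (p * q) * (x * W)"
    for A W x p q
    by (simp add: distrib_left distrib_right mult.assoc kc_left_commute[of A] kc_left_commute[of x] kc_mult_left)
  have gen2: "kc q * ((1 + W) * (B + kc r * x)) = kc q * B + kc (q * r) * x + kc q * (W * B) + kc (q * r) * (W * x)"
    for W B x q r
    by (simp add: distrib_left distrib_right mult.assoc kc_left_commute[of W] kc_mult_left)
  have gen3: "a + x + y + b = c + x + y + d - e" if "a + b - c - d + e = 0" for a b c d e x y :: qplane
    using that by (simp add: algebra_simps)
  have "v * u = u * v" by simp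
  show ?thesis
    unfolding gen1 gen2 1 2 3 4 kc_mult_left 5 6 \<open>v * u = u * v\<close> by (rule gen3) (rule 7)
qed

abbreviation HH :: qplane where "HH \<equiv> 1 + kc v * xx + kc v * yy"

text \<open>The difference \<open>Q\<close> of the two sides satisfies \<open>\<tau>Q = u (1 + \<phi>(z) y) Q\<close>, so its lowest component has
  degree \<open>1\<close>; but \<open>Q\<close> vanishes in degrees below \<open>2\<close>.\<close>

lemma CC_intertwine: "CC * HH = (ev ff zz + kc v * xx) * sc u u CC"
proof -
  let ?N = "1 + ev fphi zz * yy" and ?Hf = "ev ff zz + kc v * xx"
  define Q where "Q = ?Hf * (?N * CC) - CC * HH"
  have sH: "sc u u HH = kc u * HH - kc (u - 1)"
    by (simp add: sc_add sc_one sc_kc sc_mon kc_mult_left kc_diff algebra_simps)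
  have sHf: "sc u u ?Hf = ev (scl (v ^ 4) ff) zz + kc (v * u) * xx"
    by (simp add: sc_add sc_kc sc_mon sc_ev_zz kc_mult_left flip: power_add)
  have sN: "sc u u ?N = 1 + kc u * (ev (scl (v ^ 4) fphi) zz * yy)"
    by (simp add: sc_add sc_one sc_mult sc_mon sc_ev_zz kc_left_commute flip: power_add)
  have "sc u u Q = (sc u u ?Hf * sc u u ?N) * (?N * CC) - ?N * CC * sc u u HH"
    unfolding Q_def by (simp only: sc_diff sc_mult CC(3) mult.assoc)
  also have "\<dots> = (kc u * (?N * ?Hf) - kc (u - 1)) * (?N * CC) - ?N * CC * (kc u * HH - kc (u - 1))"
    unfolding sHf sN sH key_relation ..
  also have "\<dots> = kc u * (?N * Q)"
  proof -
    have gen: "(kc a * (N * H) - kc b) * M - M * (kc a * H' - kc b) = kc a * (N * (H * M) - M * H')"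
      for a b N H M H'
      by (simp add: left_diff_distrib right_diff_distrib mult.assoc kc_left_commute kc_commute[of M])
    show ?thesis unfolding gen Q_def by (simp only: right_diff_distrib mult.assoc)
  qed
  finally have sQ: "sc u u Q = kc u * (?N * Q)" .
  have gen2: "ge 2 Q"
  proof -
    define a b c d where "a = ?Hf - 1" and "b = ev fphi zz * yy" and "c = CC - 1" and "d = kc v * xx + kc v * yy"
    have zz2: "ge 2 zz" by (simp add: ge_mon dg_def)
    have e1: "ge 2 (ev ff zz - 1)"
    proof -
      have "(ff - 1) $$ 0 = 0" by simp
      then have "ff - 1 = fps_X * fps_shift 1 (ff - 1)"
        by (intro fps_ext) (auto simp: One_nat_def)
      then have "ev (ff - 1) zz = zz * ev (fps_shift 1 (ff - 1)) zz"
        by (metis ev_X ev_mult ge_gens(3))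
      then show ?thesis using ge_mult_right[OF zz2] by (simp add: ev_diff)
    qed
    have e2: "ge 2 (ev fphi zz * yy - kc v * yy)"
    proof -
      have "ge 1 (ev (fphi - fps_const v) zz)" by (rule ge_ev) simp_all
      then have "ge (1 + 1) (ev (fphi - fps_const v) zz * yy)" by (rule ge_mult) simp
      then show ?thesis by (simp add: ev_diff left_diff_distrib)
    qed
    have ab: "ge 1 a" "ge 1 b" "ge 1 c" "ge 1 d"
    proof -
      have "a = (ev ff zz - 1) + kc v * xx" by (simp add: a_def)
      then show "ge 1 a" using ge_add[OF ge_mono[OF e1] ge_kc_mult[OF ge_gens(1)]] by simp
      show "ge 1 b" by (simp add: b_def ge_mult_left)
      show "ge 1 c" using CC(1) by (simp add: c_def)
      show "ge 1 d" unfolding d_def by (intro ge_add ge_kc_mult ge_gens)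
    qed
    have m2: "ge 2 (p * q)" if "ge 1 p" "ge 1 q" for p q using ge_mult[OF that] by simp
    \<comment> \<open>The linear parts cancel: \<open>a\<close> starts with v x, \<open>b\<close>
      with v y, their sum is \<open>d\<close>, and \<open>c\<close> occurs once on each
      side.\<close>
    have "Q = (1 + a) * ((1 + b) * (1 + c)) - (1 + c) * (1 + d)"
      by (simp add: Q_def a_def b_def c_def d_def add.assoc)
    also have "\<dots> = (a + b - d) + (b * c + a * b + a * c + a * (b * c) - c * d)"
      by (simp add: algebra_simps)
    also have "a + b - d = (ev ff zz - 1) + (ev fphi zz * yy - kc v * yy)"
      by (simp add: a_def b_def d_def)
    finally show ?thesis
      using e1 e2 ab ge_mult_left[OF ab(3), of b] by (auto intro!: ge_add ge_diff m2)
  qed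
  have "Q = 0"
  proof (rule sc_eq_zero[OF _ sQ])
    show "ge 1 (ev fphi zz * yy)" by (simp add: ge_mult_left)
    fix m assume "u ^ xdeg m * u ^ ydeg m = u"
    then have m: "v ^ (2 * dg m) = v ^ 2" by (simp add: dg_def power_add power_mult distrib_left)
    have "dg m < 2"
    proof (rule ccontr)
      assume "\<not> dg m < 2"
      then have "2 * dg m = 2 + (2 * dg m - 2)" "0 < 2 * dg m - 2" by simp_all
      then have "v ^ 2 * v ^ (2 * dg m - 2) = v ^ 2 * 1" using m by (simp add: power_add[symmetric] del: power_mult)
      then have "v ^ (2 * dg m - 2) = 1" by simp
      then show False using \<open>0 < 2 * dg m - 2\<close> by (simp del: power_mult)
    qed
    then show "cf Q m = 0" using gen2 by (simp add: ge_def)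
  qed
  then show ?thesis unfolding CC(3) Q_def by simp
qed

text \<open>The relation \<open>CC_intertwine\<close> is pulled back through the injective
  \<open>push hI\<close>. Its term \<open>xx\<close> is not in the image, but \<open>yy * xx\<close>
  is a multiple of \<open>zz\<close>, hence the additional factor \<open>yy\<close> on the left.
  Rescaling by \<open>inverse u\<close> first turns \<open>sc u u CC\<close> back into
  \<open>CC\<close>.\<close>

lemma C0_relation:
  "sc (v ^ 4) (inverse u) C0 * (yy + kc (v * u) * xx + kc (v * inverse u) * (yy * yy)) =
    (ev (scl (v ^ 4) ff) xx * yy + kc (v * u) * xx) * C0"
proof (rule io.push_inject)
  let ?i = "inverse u"
  let ?D = "sc (v ^ 4) ?i C0"
  have vu: "v * ?i * v ^ 4 = v * u" by (simp add: field_simps numeral_eq_Suc)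
  have "sc (v ^ 8) 1 (sc ?i ?i CC) = push hI ?D"
  proof -
    have "v ^ 8 * (?i * ?i) = v ^ 4" by (simp add: field_simps numeral_eq_Suc)
    then show ?thesis by (simp add: CC_def sc_sc sc_io mult.assoc)
  qed
  then have 1: "yy * sc ?i ?i CC = push hI ?D * yy" by (simp add: yy_conj[of "sc ?i ?i CC"])
  have 2: "yy * sc ?i ?i HH = push hI (yy + kc (v * u) * xx + kc (v * ?i) * (yy * yy))"
    by (simp add: sc_add sc_one sc_kc sc_mon distrib_left kc_left_commute[of yy] xy_zz kc_mult_left
        io.push_add io.push_const io.push_mult io_gens vu)
  have 3: "yy * sc ?i ?i (ev ff zz + kc v * xx) = push hI (ev (scl (v ^ 4) ff) xx * yy + kc (v * u) * xx)"
  proof -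
    have "v ^ 8 * (?i * ?i) = v ^ 4" by (simp add: field_simps numeral_eq_Suc)
    then show ?thesis
      by (simp add: sc_add sc_kc sc_mon sc_ev_zz distrib_left kc_left_commute[of yy] xy_zz kc_mult_left
        io.push_add io.push_const io.push_mult io.push_ev io_gens yy_ev_zz vu)
  qed
  have "push hI (?D * (yy + kc (v * u) * xx + kc (v * ?i) * (yy * yy))) = push hI ?D * (yy * sc ?i ?i HH)"
    by (simp only: io.push_mult 2)
  also have "\<dots> = yy * sc ?i ?i (CC * HH)" by (simp only: sc_mult mult.assoc[symmetric] 1)
  also have "\<dots> = (yy * sc ?i ?i (ev ff zz + kc v * xx)) * CC"
  proof -
    have "sc ?i ?i (sc u u CC) = CC" by (simp add: sc_sc)
    then show ?thesis by (simp only: CC_intertwine sc_mult mult.assoc)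
  qed
  also have "\<dots> = push hI ((ev (scl (v ^ 4) ff) xx * yy + kc (v * u) * xx) * C0)"
    by (simp only: 3 io.push_mult CC_def)
  finally show "push hI (?D * (yy + kc (v * u) * xx + kc (v * ?i) * (yy * yy))) =
    push hI ((ev (scl (v ^ 4) ff) xx * yy + kc (v * u) * xx) * C0)" .
qed

section \<open>Self-similarity of the left-going product\<close>

abbreviation mm :: qplane where "mm \<equiv> mon (Expo 1 2 0)"

lemma ge_mm [simp]: "ge 1 mm"
  by (simp add: ge_mon dg_def)

text \<open>After the shear every term of \<open>C0_relation\<close> can be written with a factor
  \<open>x\<close> on the left. Cancelling it gives an equation for \<open>push hG C0\<close> with
  the same left factor as for \<open>C0\<close>, plus a new factor on the right that
  \<open>K0\<close> absorbs.\<close>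

lemma gaC0_relation:
  "sc (v ^ 4) u (push hG C0) * (1 + kc v * yy + kc (v ^ 4) * mm) = (1 + ev fphi xx * yy) * push hG C0"
proof -
  let ?G = "push hG C0" and ?i = "inverse u"
  have ga: "push hG (sc (v ^ 4) ?i C0) = sc (v ^ 4) (?i * inverse (v ^ 4)) ?G"
  proof -
    have "v ^ 4 * (?i * inverse (v ^ 4)) = ?i" by simp
    then show ?thesis by (simp only: sc_ga)
  qed
  have zz: "zz = kc (v ^ 4) * (xx * yy)" by (simp add: xy_zz kc_mult_left)
  have zz2: "zz * zz = kc (v ^ 8) * (xx * mm)"
  proof -
    have "vp (- 8) = inverse (v ^ 8)" using vp_minus[of 8] vp_of_nat[of 8] by simp
    then show ?thesis by (simp add: mon_mult kc_mult_left frm_def numeral_2_eq_2)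
  qed
  let ?T = "sc (v ^ 4) (?i * inverse (v ^ 4)) ?G" and ?E = "ev (scl (v ^ 4) ff) xx"
  have Tx: "?T * xx = xx * sc (v ^ 4) u ?G"
  proof -
    have "v ^ 8 * (?i * inverse (v ^ 4)) = u" by (simp add: field_simps numeral_eq_Suc)
    then show ?thesis by (simp add: xx_conj[of ?T] sc_sc)
  qed
  have rel: "?T * (zz + kc (v * u) * xx + kc (v * ?i) * (zz * zz)) = (?E * zz + kc (v * u) * xx) * ?G"
    using arg_cong[OF C0_relation, of "push hG"]
    by (simp add: ga.push_mult ga.push_add ga.push_const ga.push_ev ga_gens ga)
  have Ex: "?E * xx = xx * ?E" by (rule ev_intertwine[symmetric]) simp_all
  have "xx * (sc (v ^ 4) u ?G * (kc (v ^ 4) * yy + kc (v * u) + kc (v * ?i * v ^ 8) * mm)) =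
     ?T * (xx * (kc (v ^ 4) * yy + kc (v * u) + kc (v * ?i * v ^ 8) * mm))"
    by (simp only: mult.assoc[symmetric] Tx)
  also have "xx * (kc (v ^ 4) * yy + kc (v * u) + kc (v * ?i * v ^ 8) * mm) =
      kc (v ^ 4) * (xx * yy) + kc (v * u) * xx + kc (v * ?i) * (kc (v ^ 8) * (xx * mm))"
    by (simp only: distrib_left kc_left_commute[of xx] kc_commute[of xx] kc_mult_left)
  also have "\<dots> = zz + kc (v * u) * xx + kc (v * ?i) * (zz * zz)"
    by (simp only: zz[symmetric] zz2)
  also have "?T * \<dots> = (?E * zz + kc (v * u) * xx) * ?G" by (rule rel)
  also have "?E * zz = kc (v ^ 4) * (?E * xx * yy)"
    by (subst zz) (simp only: kc_left_commute[of ?E] mult.assoc)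
  also have "(kc (v ^ 4) * (?E * xx * yy) + kc (v * u) * xx) * ?G =
      xx * ((kc (v ^ 4) * (?E * yy) + kc (v * u)) * ?G)"
    unfolding Ex by (simp add: distrib_left distrib_right kc_left_commute[of xx] mult.assoc)
  finally have "xx * (sc (v ^ 4) u ?G * (kc (v ^ 4) * yy + kc (v * u) + kc (v * ?i * v ^ 8) * mm)) =
     xx * ((kc (v ^ 4) * (ev (scl (v ^ 4) ff) xx * yy) + kc (v * u)) * ?G)" .
  then have "sc (v ^ 4) u ?G * (kc (v ^ 4) * yy + kc (v * u) + kc (v * ?i * v ^ 8) * mm) =
     (kc (v ^ 4) * (ev (scl (v ^ 4) ff) xx * yy) + kc (v * u)) * ?G"
    by (rule mon_left_cancel)
  then have eq: "kc (inverse (v * u)) * (sc (v ^ 4) u ?G * (kc (v ^ 4) * yy + kc (v * u) + kc (v * ?i * v ^ 8) * mm)) =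
    kc (inverse (v * u)) * ((kc (v ^ 4) * (?E * yy) + kc (v * u)) * ?G)" by (simp only:)
  have c: "inverse (v * u) * v ^ 4 = v" "inverse (v * u) * (v * u) = 1" "inverse (v * u) * (v * ?i * v ^ 8) = v ^ 4"
    by (simp_all add: field_simps numeral_eq_Suc)
  have "kc (inverse (v * u)) * (sc (v ^ 4) u ?G * (kc (v ^ 4) * yy + kc (v * u) + kc (v * ?i * v ^ 8) * mm)) =
      sc (v ^ 4) u ?G * (kc (inverse (v * u)) * (kc (v ^ 4) * yy + kc (v * u) + kc (v * ?i * v ^ 8) * mm))"
    by (rule kc_left_commute[symmetric])
  also have "kc (inverse (v * u)) * (kc (v ^ 4) * yy + kc (v * u) + kc (v * ?i * v ^ 8) * mm) =
      1 + kc v * yy + kc (v ^ 4) * mm"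
    by (simp only: distrib_left kc_mult_left kc_mult[symmetric] c kc_1 add_ac)
  finally have 1: "sc (v ^ 4) u ?G * (1 + kc v * yy + kc (v ^ 4) * mm) =
      kc (inverse (v * u)) * ((kc (v ^ 4) * (?E * yy) + kc (v * u)) * ?G)"
    using eq by (simp only:)
  have "kc (inverse (v * u)) * ((kc (v ^ 4) * (?E * yy) + kc (v * u)) * ?G) = (kc v * (?E * yy) + 1) * ?G"
  proof -
    have "kc i * ((kc a * W + kc b) * G) = (kc (i * a) * W + kc (i * b)) * G" for i a b W G
      by (simp add: mult.assoc[symmetric] distrib_left kc_mult)
    then show ?thesis by (simp only: c kc_1)
  qed
  also have "kc v * (?E * yy) = ev fphi xx * yy"
    unfolding fphi_def' by (simp add: ev_kc[symmetric] mult.assoc)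
  finally show ?thesis using 1 by (simp add: add.commute)
qed

text \<open>Since \<open>mm\<close> and \<open>yy\<close> q-commute, this ordered product merges the
  separate factors 1 + v^4 mm and 1 + v y of the two functional equations into their sum 1 + v y +
  v^4 mm, the new factor in \<open>gaC0_relation\<close>.\<close>

definition K0 :: qplane where "K0 = ev (psi (v ^ 4)) mm * ev (psi v) yy"

lemma ge_ev_psi: "ge 1 p \<Longrightarrow> ge 1 (ev (psi s) p - 1)"
  using ge_ev[of p "psi s - 1"] by (simp add: ev_diff)

lemma ge_K0: "ge 1 (K0 - 1)"
  unfolding K0_def by (intro ge_mult_one ge_ev_psi) simp_all

lemma scl_psi_v: "scl u (psi v) = (1 + fps_const v * fps_X) * psi v"
  "scl (v ^ 8) (psi (v ^ 4)) = (1 + fps_const (v ^ 4) * fps_X) * psi (v ^ 4)"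
  using psi_functional[OF generic_v[of 1]] psi_functional[OF generic_v[of 4]]
  by (simp_all flip: power_mult)

lemma C0_recursion: "C0 = push hG C0 * K0"
proof (rule C0_unique[unfolded v_eq, symmetric])
  have "ge 1 (push hG C0 - 1)" using ga.ge_push[OF C0(1)] by (simp add: ga.push_diff ga.push_one)
  then show "ge 1 (push hG C0 * K0 - 1)" by (intro ge_mult_one ge_K0)
  let ?P = "ev (psi (v ^ 4)) mm" and ?R = "ev (psi v) yy"
  have sP: "sc (v ^ 4) u ?P = (1 + kc (v ^ 4) * mm) * ?P"
    by (simp add: sc_ev sc_mon ev_scale scl_def[symmetric] scl_psi_v ev_mult ev_add flip: power_mult power_add)
  have sR: "sc (v ^ 4) u ?R = (1 + kc v * yy) * ?R"
    by (simp add: sc_ev_yy scl_psi_v ev_mult ev_add)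
  have yP: "yy * ?P = (1 + kc (v ^ 4) * mm) * ?P * yy"
    by (subst yy_conj) (simp add: sc_ev sc_mon ev_scale scl_def[symmetric] scl_psi_v ev_mult ev_add)
  have sK: "sc (v ^ 4) u K0 = (1 + kc v * yy + kc (v ^ 4) * mm) * K0"
  proof -
    have gen: "W * P * ((1 + kc a * y) * R) = (W + kc a * y) * (P * R)" if "y * P = W * P * y" for W P y R a
    proof -
      have "W * P * ((1 + kc a * y) * R) = W * P * R + kc a * (W * P * y) * R"
        by (simp add: distrib_left distrib_right mult.assoc kc_left_commute[of W] kc_left_commute[of P])
      then show ?thesis unfolding that[symmetric] by (simp add: distrib_right mult.assoc)
    qed
    show ?thesis unfolding K0_def sc_mult sP sR gen[OF yP] by (simp add: add_ac)
  qed
  have "sc (v ^ 4) u (push hG C0 * K0) = sc (v ^ 4) u (push hG C0) * (1 + kc v * yy + kc (v ^ 4) * mm) * K0"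
    by (simp only: sc_mult sK mult.assoc)
  then show "sc (v ^ 4) u (push hG C0 * K0) = (1 + ev fphi xx * yy) * (push hG C0 * K0)"
    unfolding gaC0_relation by (simp only: mult.assoc)
qed

text \<open>\<open>push hG\<close> raises the degree of a monomial by its \<open>y\<close>-degree,
  so it contracts only elements without a part free of \<open>y\<close>; this is what makes the
  iterates of \<open>C0\<close> converge to 1.\<close>

lemma C0_ydeg_0:
  assumes "ydeg m = 0"
  shows "cf (C0 - 1) m = 0"
proof (cases "dg m = 0")
  case True
  then show ?thesis using C0(1) by (simp add: ge_def)
next
  case False
  have "cf (ev fphi xx * yy * C0) m = 0"
  proof -
    have "ev fphi xx * yy * C0 = yy * (ev (scl (inverse (v ^ 8)) fphi) xx * C0)"
      using yy_ev_xx[of "scl (inverse (v ^ 8)) fphi"] by (simp flip: mult.assoc)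
    then show ?thesis using assms by (auto simp: cf_mon_mult)
  qed
  then have "((v ^ 4) ^ xdeg m * u ^ ydeg m) * cf C0 m = cf C0 m"
    using arg_cong[OF C0(3), of "\<lambda>F. cf F m"] by (simp add: cf_sc distrib_right)
  then have "((v ^ 4) ^ xdeg m * u ^ ydeg m - 1) * cf C0 m = 0" by (simp add: left_diff_distrib)
  then have "cf C0 m = 0" using weight_neq_1[of m] False by simp
  then show ?thesis using False by (auto simp: cf_one)
qed

lemma ge_gaC0: "ge k ((push hG ^^ k) C0 - 1)"
proof -
  let ?P = "\<lambda>k F. ge k F \<and> (\<forall>m. ydeg m = 0 \<longrightarrow> cf F m = 0)"
  have one: "(push hG ^^ k) C0 - 1 = (push hG ^^ k) (C0 - 1)" for k
    by (induction k) (simp_all, metis ga.push_diff ga.push_one)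
  have "?P k ((push hG ^^ k) (C0 - 1))"
  proof (induction k)
    case 0
    then show ?case using C0_ydeg_0 by simp
  next
    case (Suc k)
    let ?F = "(push hG ^^ k) (C0 - 1)"
    have "cf (push hG ?F) m = 0" if "dg m < Suc k \<or> ydeg m = 0" for m
    proof (cases "m \<in> range hG")
      case True
      then obtain n where n: "m = hG n" by blast
      then have "dg m = dg n + ydeg n" "ydeg m = ydeg n" by (simp_all add: hG_def dg_def)
      then have "dg n < k \<or> ydeg n = 0" using that by auto
      then show ?thesis using Suc n by (auto simp: ge_def)
    qed (simp add: ga.cf_push_outside)
    then show ?case by (simp add: ge_def)
  qed
  then show ?thesis by (simp add: one)
qed

primrec lpart :: "(nat \<Rightarrow> 'a::monoid_mult) \<Rightarrow> nat \<Rightarrow> 'a" where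
  "lpart F 0 = 1"
| "lpart F (Suc k) = F k * lpart F k"

primrec rpart :: "(nat \<Rightarrow> 'a::monoid_mult) \<Rightarrow> nat \<Rightarrow> 'a" where
  "rpart F 0 = 1"
| "rpart F (Suc k) = rpart F k * F k"

lemma C0_partial: "C0 = (push hG ^^ k) C0 * lpart (\<lambda>p. (push hG ^^ p) K0) k"
proof (induction k)
  case (Suc k)
  have mult: "(push hG ^^ k) (F * G) = (push hG ^^ k) F * (push hG ^^ k) G" for F G
    by (induction k) (simp_all add: ga.push_mult)
  have "(push hG ^^ k) C0 = (push hG ^^ k) (push hG C0 * K0)"
    by (rule arg_cong[OF C0_recursion])
  also have "\<dots> = (push hG ^^ Suc k) C0 * (push hG ^^ k) K0"
    by (simp only: mult funpow_Suc_right comp_apply)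
  finally have "(push hG ^^ k) C0 * lpart (\<lambda>p. (push hG ^^ p) K0) k =
      (push hG ^^ Suc k) C0 * lpart (\<lambda>p. (push hG ^^ p) K0) (Suc k)"
    by (simp only: lpart.simps mult.assoc)
  with Suc show ?case by (rule trans)
qed simp

lemma C0_lpart: "ge k (C0 - lpart (\<lambda>p. (push hG ^^ p) K0) k)"
proof -
  let ?L = "lpart (\<lambda>p. (push hG ^^ p) K0) k"
  have "C0 - ?L = ((push hG ^^ k) C0 - 1) * ?L"
    using C0_partial[of k] by (simp add: left_diff_distrib)
  then show ?thesis using ge_mult_right[OF ge_gaC0] by metis
qed

lemma ga_pow_K0:
  "(push hG ^^ p) K0 = ev (psi (v ^ 4)) (mon (Expo (2 * p + 1) 2 0)) * ev (psi v) (mon (Expo p 1 0))"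
proof (induction p)
  case (Suc p)
  have "hG (Expo (2 * p + 1) 2 0) = Expo (2 * Suc p + 1) 2 0" "hG (Expo p 1 0) = Expo (Suc p) 1 0"
    by (simp_all add: hG_def)
  then show ?case using Suc
    by (simp add: ga.push_mult ga.push_ev ga.push_mon ge_mon dg_def)
qed (simp add: K0_def)

section \<open>The factorisation in the quantum plane\<close>

lemma scl_fm: "scl (v ^ 8) fm = scl (v ^ 4) ff * (ff * fm)"
proof -
  have "scl (v ^ 8) fm = scl (v ^ 4) (scl (v ^ 4) fm)" by (simp flip: power_add)
  then show ?thesis by (simp add: fm_functional' scl_mult)
qed

definition RR :: qplane where "RR = push hS CC * ev fm zz * CC"

lemma fm_nth_0 [simp]: "fm $$ 0 = 1"
  by (simp add: fm_def fbl_def)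

lemma ge_RR: "ge 1 (RR - 1)"
proof -
  have "ge 1 (push hS CC - 1)" using sw.ge_push[OF CC(1)] by (simp add: sw.push_diff sw.push_one)
  moreover have "ge 1 (ev fm zz - 1)" using ge_ev[of zz "fm - 1"] by (simp add: ev_diff)
  ultimately show ?thesis unfolding RR_def by (intro ge_mult_one CC)
qed

text \<open>Scaling \<open>CC\<close> creates 1 + phi(z) y. Passing through M(z) it becomes f(z) + v
  y, and the mirrored intertwining relation carries this through \<open>push hS CC\<close>, where it
  emerges as \<open>HH\<close>.\<close>

lemma RR_functional: "sc u u RR = HH * RR"
proof -
  let ?A = "push hS CC" and ?E = "\<lambda>F. ev F zz"
  \<comment> \<open>The swap fixes \<open>HH\<close> and reverses products, so the intertwining
    relation for \<open>CC\<close> reappears with \<open>HH\<close> on the left.\<close>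
  have swap: "HH * ?A = sc u u ?A * (?E ff + kc v * yy)"
  proof -
    have "push hS (CC * HH) = HH * ?A"
      by (simp add: sw.push_mult sw.push_add sw.push_one sw.push_const sw_gens kc_commute add_ac)
    moreover have "push hS ((?E ff + kc v * xx) * sc u u CC) = sc u u ?A * (?E ff + kc v * yy)"
      by (simp add: sw.push_mult sw.push_add sw.push_const sw.push_ev sw_gens sc_sw kc_commute)
    ultimately show ?thesis using CC_intertwine by simp
  qed
  have sM: "sc u u (?E fm) = ?E (ff * fm)"
    by (simp add: sc_ev_zz fm_functional' flip: power_add)
  have mid: "?E (ff * fm) * (1 + ?E fphi * yy) = (?E ff + kc v * yy) * ?E fm"
  proof -
    have "ff * fm * fphi = fps_const v * scl (v ^ 8) fm"
      unfolding scl_fm fphi_def' by (simp add: mult_ac)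
    then have "?E (ff * fm) * (?E fphi * yy) = kc v * (?E (scl (v ^ 8) fm) * yy)"
      by (simp add: mult.assoc[symmetric] ev_mult[symmetric] ev_kc)
    then show ?thesis by (simp add: distrib_left distrib_right yy_ev_zz ev_mult mult.assoc)
  qed
  have "sc u u RR = sc u u ?A * (?E (ff * fm) * (1 + ?E fphi * yy)) * CC"
    unfolding RR_def by (simp only: sc_mult sM CC(3) mult.assoc)
  also have "\<dots> = HH * RR" unfolding mid RR_def mult.assoc[symmetric] swap ..
  finally show ?thesis .
qed

section \<open>The part free of y, and the identity in the plane\<close>

definition y0 :: "qplane \<Rightarrow> qplane" where
  "y0 F = Abs_qplane (\<lambda>m. if ydeg m = 0 then cf F m else 0)"

lemma cf_y0: "cf (y0 F) m = (if ydeg m = 0 then cf F m else 0)"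
  by (simp add: y0_def)

lemma y0_add: "y0 (F + G) = y0 F + y0 G"
  and y0_diff: "y0 (F - G) = y0 F - y0 G"
  and y0_kc: "y0 (kc a * F) = kc a * y0 F"
  and y0_one: "y0 1 = 1"
  by (rule qplane_eqI; simp add: cf_y0 cf_one)+

lemma y0_mult: "y0 (F * G) = y0 F * y0 G"
proof (rule qplane_eqI)
  fix m
  show "cf (y0 (F * G)) m = cf (y0 F * y0 G) m"
  proof (cases "ydeg m = 0")
    case True
    then show ?thesis unfolding cf_y0[of "F * G"] cf_mult
      by (auto intro!: sum.cong simp: cf_y0 decomp_def)
  next
    case False
    then show ?thesis unfolding cf_y0[of "F * G"] cf_mult
      by (auto intro!: sum.neutral simp: cf_y0 decomp_def)
  qed
qed

lemma y0_power: "y0 (F ^ k) = y0 F ^ k"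
  by (induction k) (simp_all add: y0_one y0_mult)

lemma y0_ev: "ge 1 p \<Longrightarrow> y0 (ev F p) = ev F (y0 p)"
  by (rule ev_map) (simp_all add: y0_add y0_kc ge_def cf_y0 y0_power)

theorem plane_identity:
  "ev (psi v) yy * ev (psi (v ^ 4)) xx =
    ev (psi (v ^ 4)) xx * push hI (push hS CC) * ev fm mm * push hI CC"
proof -
  let ?R = "ev (psi v) yy" and ?P = "ev (psi (v ^ 4)) xx"
  let ?U = "?R * ?P" and ?U' = "?P * push hI RR"
  have "hI (Expo 1 1 0) = Expo 1 2 0" by (simp add: hI_def)
  then have R: "push hI RR = push hI (push hS CC) * ev fm mm * push hI CC"
    by (simp add: RR_def io.push_mult io.push_ev io.push_mon)
  have sP: "sc 1 u ?P = ?P" by (simp add: sc_ev_xx)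
  have yP: "yy * ?P = (1 + kc (v ^ 4) * xx) * ?P * yy"
    by (simp add: yy_ev_xx scl_psi_v ev_mult ev_add)
  have comm: "xx * ?P = ?P * xx" by (rule ev_intertwine) simp_all
  have sU: "sc 1 u ?U = (1 + kc v * yy) * ?U"
    by (simp add: sc_mult sP sc_ev_yy scl_psi_v ev_mult ev_add mult.assoc)
  have "sc 1 u (push hI RR) = (1 + kc v * zz + kc v * yy) * push hI RR"
    by (simp add: sc_io RR_functional io.push_mult io.push_add io.push_one io.push_const io_gens)
  then have "sc 1 u ?U' = ?P * (1 + kc v * zz + kc v * yy) * push hI RR"
    by (simp add: sc_mult sP mult.assoc)
  \<comment> \<open>Commuting \<open>yy\<close> past the dilogarithm in \<open>xx\<close> produces
    precisely the extra monomial \<open>zz\<close>, which is why this dilogarithm stands in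
    front.\<close>
  also have "?P * (1 + kc v * zz + kc v * yy) = (1 + kc v * yy) * ?P"
  proof -
    have zz: "zz = kc (v ^ 4) * (xx * yy)" by (simp add: xy_zz kc_mult_left)
    have "?P * zz = kc (v ^ 4) * (?P * xx * yy)"
      by (subst zz) (simp only: kc_left_commute[of ?P] mult.assoc)
    then have "?P * zz + ?P * yy = yy * ?P"
      unfolding yP comm[symmetric] by (simp add: distrib_right mult.assoc add.commute)
    then have "kc v * (?P * zz) + kc v * (?P * yy) = kc v * (yy * ?P)" by (metis distrib_left)
    then show ?thesis
      by (simp add: distrib_left distrib_right kc_left_commute[of ?P] mult.assoc add.assoc)
  qed
  finally have sU': "sc 1 u ?U' = (1 + kc v * yy) * ?U'" by (simp only: mult.assoc)
  have y0x: "y0 xx = xx" and y0y: "y0 yy = 0"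
    by (rule qplane_eqI; simp add: cf_y0 cf_mon)+
  have "ev F 0 = kc (F $$ 0)" for F :: "qfield fps"
    by (rule qplane_eqI) (simp add: ev_def psum_def power_0_left cf_one cf_kc if_distrib[of "\<lambda>F. cf F _"] cong: if_cong)
  then have y0U: "y0 ?U = ?P" by (simp add: y0_mult y0_ev y0x y0y)
  \<comment> \<open>Under \<open>hI\<close> the \<open>y\<close>-degree of the image is the full
    degree of the argument, so only the constant term can be free of \<open>y\<close>.\<close>
  have "y0 (push hI RR - 1) = 0"
  proof (rule qplane_eqI)
    fix m
    have "cf (push hI (RR - 1)) m = 0" if "ydeg m = 0"
    proof (cases "m \<in> range hI")
      case True
      then obtain n where n: "m = hI n" by blast
      then have "dg n = 0" using that by (simp add: hI_def dg_def)
      then show ?thesis using ge_RR n by (simp add: ge_def)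
    qed (simp add: io.cf_push_outside)
    then show "cf (y0 (push hI RR - 1)) m = cf 0 m"
      by (simp add: cf_y0 io.push_diff io.push_one)
  qed
  then have y0U': "y0 ?U' = ?P" by (simp add: y0_mult y0_ev y0x y0_diff y0_one)
  have "?U - ?U' = 0"
  proof (rule sc_eq_zero)
    show "ge 1 (kc v * yy)" by (simp add: ge_kc_mult)
    show "sc 1 u (?U - ?U') = kc 1 * ((1 + kc v * yy) * (?U - ?U'))"
      unfolding sc_diff sU sU' by (simp only: right_diff_distrib kc_1 mult_1_left)
    fix m assume m: "1 ^ xdeg m * u ^ ydeg m = 1"
    have "ydeg m = 0"
    proof (rule ccontr)
      assume "ydeg m \<noteq> 0"
      then show False using m qroot_power_neq_1[of "2 * ydeg m"] by (simp flip: power_mult)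
    qed
    moreover have "cf (y0 (?U - ?U')) m = 0" by (simp only: y0_diff y0U y0U') simp
    ultimately show "cf (?U - ?U') m = 0" by (simp add: cf_y0)
  qed
  then have "?U = ?U'" by simp
  then show ?thesis unfolding R by (simp only: mult.assoc)
qed

text \<open>The scaling \<open>a\<close> carries only the extra shift of the second parameter; the
  contribution ib + jb' is inserted by \<open>Lam\<close>.\<close>

definition dil :: "qfield \<Rightarrow> qfield \<Rightarrow> nat \<Rightarrow> nat \<Rightarrow> qplane" where
  "dil s a i j = ev (scl a (psi s)) (mon (Expo i j 0))"

lemma dil_one: "dil s 1 i j = ev (psi s) (mon (Expo i j 0))"
  by (simp add: dil_def)

definition Afac :: "nat \<Rightarrow> qplane" where
  "Afac p = dil (v ^ 4) 1 (2 * p + 1) (4 * p) * dil v 1 (p + 1) (2 * p + 1)"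

definition Bfac :: "nat \<Rightarrow> qplane" where
  "Bfac p = dil (u ^ 2 ^ p) (inverse (u ^ 2 ^ p)) (2 ^ p) (2 * 2 ^ p) * dil (u ^ 2 ^ p) (u ^ 2 ^ p) (2 ^ p) (2 * 2 ^ p)"

definition Cfac :: "nat \<Rightarrow> qplane" where
  "Cfac p = dil (v ^ 4) 1 (2 * p + 1) (4 * p + 4) * dil v 1 p (2 * p + 1)"

definition Atot :: qplane where "Atot = ev (psi (v ^ 4)) xx * push hI (push hS CC)"

definition Ctot :: qplane where "Ctot = push hI CC"

section \<open>Approximation by partial products\<close>

lemma io_lpart: "push hI (lpart F k) = lpart (\<lambda>p. push hI (F p)) k"
  by (induction k) (simp_all add: io.push_one io.push_mult)

lemma sw_lpart: "push hS (lpart F k) = rpart (\<lambda>p. push hS (F p)) k"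
  by (induction k) (simp_all add: sw.push_one sw.push_mult)

lemma io_rpart: "push hI (rpart F k) = rpart (\<lambda>p. push hI (F p)) k"
  by (induction k) (simp_all add: io.push_one io.push_mult)

lemma ge_mon_pos: "0 < a + b \<Longrightarrow> ge 1 (mon (Expo a b c))"
  by (auto simp: ge_mon dg_def)

lemma io_ev_mon: "0 < a + b \<Longrightarrow> push hI (ev F (mon (Expo a b 0))) = ev F (mon (Expo a (a + b) 0))"
  by (subst io.push_ev) (simp_all add: ge_mon_pos io.push_mon hI_def)

lemma sw_ev_mon: "0 < a + b \<Longrightarrow> push hS (ev F (mon (Expo a b 0))) = ev F (mon (Expo b a 0))"
  by (subst sw.push_ev) (simp_all add: ge_mon_pos sw.push_mon hS_def)

lemma Ctot_approx: "ge k (Ctot - lpart Cfac k)"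
proof -
  have "push hI (push hI ((push hG ^^ p) K0)) = Cfac p" for p
  proof -
    \<comment> \<open>Two applications of \<open>hI\<close> send the exponents (a, b) to (a, 2a +
      b), hence (2p+1, 2) to (2p+1, 4p+4) and (p, 1) to (p, 2p+1).\<close>
    have r: "push hI (push hI (ev F (mon (Expo a b 0)))) = ev F (mon (Expo a b' 0))"
      if "0 < b" "b' = 2 * a + b" for F a b b'
      using that by (simp add: io_ev_mon mult_2 add.assoc)
    show ?thesis
      unfolding ga_pow_K0 io.push_mult Cfac_def dil_one by (intro arg_cong2[where f = "(*)"] r) simp_all
  qed
  then have "push hI (push hI (C0 - lpart (\<lambda>p. (push hG ^^ p) K0) k)) = Ctot - lpart Cfac k"
    by (simp add: io.push_diff io_lpart Ctot_def CC_def)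
  then show ?thesis using io.ge_push[OF io.ge_push[OF C0_lpart]] by metis
qed

text \<open>The mirror image comes grouped as Q_p P_(p+1), whereas the wanted pairs are P_p Q_p. The
  leading dilogarithm in \<open>xx\<close> is P_0, so regrouping leaves a single surplus P_k at the
  end, which differs from 1 only in degrees at least k.\<close>

lemma Atot_approx: "ge k (Atot - rpart Afac k)"
proof -
  let ?P = "\<lambda>p. dil (v ^ 4) 1 (2 * p + 1) (4 * p)" and ?Q = "\<lambda>p. dil v 1 (p + 1) (2 * p + 1)"
  let ?F = "\<lambda>p. push hI (push hS (push hI ((push hG ^^ p) K0)))"
  have F: "?F p = ?Q p * ?P (Suc p)" for p
  proof -
    have r: "push hI (push hS (push hI (ev F (mon (Expo a b 0))))) = ev F (mon (Expo a' b' 0))"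
      if "0 < b" "a' = a + b" "b' = 2 * a + b" for F a b a' b'
      using that by (simp add: io_ev_mon sw_ev_mon mult_2 add_ac)
    show ?thesis
      unfolding ga_pow_K0 io.push_mult sw.push_mult dil_one by (intro arg_cong2[where f = "(*)"] r) simp_all
  qed
  have shift: "?P 0 * rpart ?F k = rpart Afac k * ?P k" for k
  proof (induction k)
    case (Suc k)
    have "?P 0 * rpart ?F (Suc k) = rpart Afac k * ?P k * (?Q k * ?P (Suc k))"
      using Suc by (simp only: rpart.simps F mult.assoc[symmetric])
    also have "\<dots> = rpart Afac (Suc k) * ?P (Suc k)"
      by (simp only: rpart.simps Afac_def[of k] mult.assoc)
    finally show ?case .
  qed simp
  have P0: "?P 0 = ev (psi (v ^ 4)) xx" by (simp add: dil_one)
  have "push hI (push hS (push hI (C0 - lpart (\<lambda>p. (push hG ^^ p) K0) k))) =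
      push hI (push hS CC) - rpart ?F k"
    by (simp add: io.push_diff sw.push_diff io_lpart sw_lpart io_rpart CC_def)
  then have "ge k (push hI (push hS CC) - rpart ?F k)"
    using io.ge_push[OF sw.ge_push[OF io.ge_push[OF C0_lpart]]] by metis
  then have 1: "ge k (Atot - ?P 0 * rpart ?F k)"
    unfolding Atot_def P0 right_diff_distrib[symmetric] by (rule ge_mult_left)
  have "ge k (?P k - 1)"
  proof -
    let ?m = "mon (Expo (2 * k + 1) (4 * k) 0)"
    have m: "ge 1 ?m" "ge k ?m" by (simp_all add: ge_mon dg_def)
    have "ev (psi (v ^ 4) - 1) ?m = ?m * ev (fps_shift 1 (psi (v ^ 4) - 1)) ?m"
    proof -
      have "psi (v ^ 4) - 1 = fps_X * fps_shift 1 (psi (v ^ 4) - 1)"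
        by (intro fps_ext) (auto simp: One_nat_def)
      then show ?thesis by (metis ev_X ev_mult m(1))
    qed
    then show ?thesis using ge_mult_right[OF m(2)] m(1) by (simp add: ev_diff dil_one)
  qed
  then have 2: "ge k (rpart Afac k * ?P k - rpart Afac k)"
    using ge_mult_left[of k "?P k - 1" "rpart Afac k"] by (simp add: right_diff_distrib)
  have "Atot - rpart Afac k = (Atot - ?P 0 * rpart ?F k) + (rpart Afac k * ?P k - rpart Afac k)"
    unfolding shift by simp
  then show ?thesis using ge_add[OF 1 2] by metis
qed

text \<open>If \<open>m\<close> is odd, only p = 0 contributes. If \<open>m\<close> is even, p = 0
  contributes -1 and the rest is twice the sum for m/2. This collapses the doubling product to the
  single series \<open>fbl\<close>.\<close>

lemma two_power_sum:
  fixes m k :: nat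
  assumes "0 < m" "m < 2 ^ k"
  shows "(\<Sum>p<k. if 2 ^ p dvd m then (- 1) ^ (m div 2 ^ p + 1) * 2 ^ p else (0::qfield)) = 1"
  using assms
proof (induction k arbitrary: m)
  case (Suc k)
  let ?h = "\<lambda>m p. if 2 ^ p dvd m then (- 1) ^ (m div 2 ^ p + 1) * 2 ^ p else (0::qfield)"
  have split: "(\<Sum>p<Suc k. ?h m p) = (- 1) ^ (m + 1) + (\<Sum>p<k. ?h m (Suc p))"
    by (subst sum.lessThan_Suc_shift) simp
  show ?case
  proof (cases "even m")
    case False
    then have "\<not> 2 ^ Suc p dvd m" for p using dvd_trans[of 2 "2 ^ Suc p" m] by auto
    then show ?thesis unfolding split using False by simp
  next
    case True
    then obtain m' where m: "m = 2 * m'" by (elim evenE)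
    then have "?h m (Suc p) = 2 * ?h m' p" for p by simp
    then have "(\<Sum>p<k. ?h m (Suc p)) = 2 * (\<Sum>p<k. ?h m' p)" by (simp only: sum_distrib_left)
    also have "(\<Sum>p<k. ?h m' p) = 1" by (rule Suc.IH) (use Suc.prems m in auto)
    finally show ?thesis unfolding split using m by simp
  qed
qed simp

text \<open>The logarithm of the \<open>p\<close>-th pair of factors of the central product.\<close>

definition blp :: "nat \<Rightarrow> qfield fps" where
  "blp p = Abs_fps (\<lambda>m. if 0 < m \<and> 2 ^ p dvd m
     then (- 1) ^ (m div 2 ^ p + 1) * 2 ^ p * ((u ^ m + inverse (u ^ m)) / (of_nat m * (u ^ m - inverse (u ^ m)))) else 0)"

lemma blp_nth_0 [simp]: "blp p $$ 0 = 0"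
  by (simp add: blp_def)

lemma blp_sum:
  assumes "m < 2 ^ k"
  shows "(\<Sum>p<k. blp p) $$ m = bl $$ m"
proof (cases "m = 0")
  case False
  let ?c = "(u ^ m + inverse (u ^ m)) / (of_nat m * (u ^ m - inverse (u ^ m)))"
  have "(\<Sum>p<k. blp p) $$ m = (\<Sum>p<k. (if 2 ^ p dvd m then (- 1) ^ (m div 2 ^ p + 1) * 2 ^ p else 0) * ?c)"
    unfolding fps_sum_nth by (rule sum.cong) (use False in \<open>auto simp: blp_def\<close>)
  also have "\<dots> = (\<Sum>p<k. (if 2 ^ p dvd m then (- 1) ^ (m div 2 ^ p + 1) * 2 ^ p else 0)) * ?c"
    by (rule sum_distrib_right[symmetric])
  also have "\<dots> = ?c" using two_power_sum[of m k] assms False by simp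
  finally show ?thesis using False by (simp add: bl_def)
qed (simp add: fps_sum_nth)

lemma fps_compose_X_power: "(F oo fps_X ^ P) $$ m = (if P dvd m then F $$ (m div P) else 0)"
  if "0 < P" for F :: "qfield fps"
proof -
  have "(F oo fps_X ^ P) $$ m = (\<Sum>i\<in>{0..m}. if m = P * i then F $$ i else 0)"
    by (simp add: fps_compose_nth power_mult[symmetric] if_distrib cong: if_cong)
  also have "\<dots> = (if P dvd m then F $$ (m div P) else 0)"
  proof (cases "P dvd m")
    case True
    then obtain i where i: "m = P * i" by blast
    have "i \<le> m" using i that by simp
    have "(\<Sum>i'\<in>{0..m}. if m = P * i' then F $$ i' else 0) = (\<Sum>i'\<in>{0..m}. if i' = i then F $$ i else 0)"
      by (rule sum.cong) (use i that in auto)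
    then show ?thesis using \<open>i \<le> m\<close> i that by simp
  next
    case False
    then show ?thesis by (auto intro!: sum.neutral)
  qed
  finally show ?thesis .
qed

text \<open>Both dilogarithms are series in \<open>mm\<close>, so they commute and their logarithms
  add. With w = u^(2^p), the opposite shifts put w^j + w^-j into the numerator, and rewriting 1/j
  for m = 2^p j gives the factor 2^p.\<close>

lemma Bfac_eq: "Bfac p = ev (fexp (blp p)) mm"
proof -
  let ?P = "2 ^ p :: nat"
  let ?w = "u ^ ?P"
  have mon: "mon (Expo ?P (2 * ?P) 0) = mm ^ ?P" by (simp add: mon_power mult.commute)
  have d: "dil s a ?P (2 * ?P) = ev (fexp (scl a (psil s) oo fps_X ^ ?P)) mm" for s a
  proof -
    have "dil s a ?P (2 * ?P) = ev (fexp (scl a (psil s))) (ev (fps_X ^ ?P) mm)"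
      unfolding dil_def mon psi_def by (simp add: scl_fexp ev_power)
    also have "\<dots> = ev (fexp (scl a (psil s)) oo fps_X ^ ?P) mm"
      by (rule ev_compose[symmetric]) simp_all
    also have "fexp (scl a (psil s)) oo fps_X ^ ?P = fexp (scl a (psil s) oo fps_X ^ ?P)"
      unfolding fexp_def by (rule fps_compose_assoc[symmetric]) simp_all
    finally show ?thesis .
  qed
  have "(scl (inverse ?w) (psil ?w) oo fps_X ^ ?P) + (scl ?w (psil ?w) oo fps_X ^ ?P) = blp p"
  proof (rule fps_ext)
    fix m
    show "((scl (inverse ?w) (psil ?w) oo fps_X ^ ?P) + (scl ?w (psil ?w) oo fps_X ^ ?P)) $$ m = blp p $$ m"
    proof (cases "?P dvd m \<and> 0 < m")
      case True
      then obtain j where m: "m = ?P * j" by blast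
      then have j: "0 < j" using True by simp
      have wj: "?w ^ j = u ^ m" by (simp add: m power_mult)
      show ?thesis using True j
        by (simp add: fps_compose_X_power m blp_def psil_def power_inverse wj[unfolded m] add_divide_distrib[symmetric]
            distrib_left[symmetric] add.commute, simp add: algebra_simps)
    qed (auto simp: fps_compose_X_power blp_def)
  qed
  then show ?thesis unfolding Bfac_def d
    by (simp add: ev_mult[symmetric] fexp_add[symmetric])
qed

lemma rpart_commutative: "ge 1 p \<Longrightarrow> rpart (\<lambda>i. ev (F i) p) k = ev (\<Prod>i<k. F i) p"
  by (induction k) (simp_all add: ev_mult)

lemma fexp_cong:
  assumes "A $$ 0 = 0" "B $$ 0 = 0" "\<And>m. m < N \<Longrightarrow> A $$ m = B $$ m" "m < N"
  shows "fexp A $$ m = fexp B $$ (m::nat)"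
proof -
  have e1: "fexp A = fexp B * fexp (A - B)"
    using assms by (simp add: fexp_add[symmetric])
  have e2: "fexp (A - B) $$ i = (if i = 0 then 1 else 0)" if "i < N" for i
  proof -
    have "(A - B) ^ Suc j $$ i = 0" for j
      using that assms(3) by (auto simp: fps_mult_nth intro!: sum.neutral)
    then have "fexp (A - B) $$ i = (\<Sum>j=0..i. if j = 0 then (1::'a fps) $$ i else 0)"
      unfolding fexp_def fps_compose_nth by (intro sum.cong refl) (auto simp: gr0_conv_Suc simp del: power_Suc)
    then show ?thesis by simp
  qed
  have "fexp A $$ m = (\<Sum>i=0..m. if i = m then fexp B $$ m else 0)"
    unfolding e1 fps_mult_nth by (rule sum.cong) (use assms(4) e2 in auto)
  then show ?thesis by simp
qed

lemma B_approx: "ge k (ev fbl mm - rpart Bfac k)"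
proof -
  have r: "rpart Bfac k = ev (fexp (\<Sum>p<k. blp p)) mm"
    using rpart_commutative[of mm "\<lambda>p. fexp (blp p)" k] by (simp add: Bfac_eq[abs_def] fexp_sum)
  have "cf (ev fbl mm) m = cf (ev (fexp (\<Sum>p<k. blp p)) mm) m" if "dg m < k" for m
  proof -
    \<comment> \<open>The first k factors determine all coefficients below 2^k, which is more than
      the k degrees needed.\<close>
    have "k < 2 ^ k" by simp
    then have "dg m < 2 ^ k" using that by linarith
    then have "fbl $$ j = fexp (\<Sum>p<k. blp p) $$ j" if "j \<le> dg m" for j
      unfolding fbl_def
      by (intro fexp_cong[where N = "2 ^ k"]) (use that in \<open>auto simp: fps_sum_nth blp_sum[symmetric]\<close>)
    then show ?thesis by (simp add: ev_def psum_def)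
  qed
  then show ?thesis unfolding r by (simp add: ge_def)
qed

theorem plane_identity':
  "dil v 1 0 1 * dil (v ^ 4) 1 1 0 = Atot * dil u 1 1 2 * ev fbl mm * Ctot"
  using plane_identity by (simp add: dil_one Atot_def Ctot_def fm_def ev_mult mult.assoc)

section \<open>Cosets in the exponential group\<close>

lemma latt_deg_add [simp]: "latt_deg (m + n) = latt_deg m + latt_deg n"
  by (simp add: latt_deg_def sum.distrib)

lemma latt_deg_scale [simp]: "latt_deg (a *s n) = a * latt_deg n"
  by (simp add: latt_deg_def sum_distrib_left)

lemma latt_pos_add: "m \<in> latt_pos \<Longrightarrow> n \<in> latt_pos \<Longrightarrow> m + n \<in> latt_pos"
  by (simp add: latt_pos_def)

lemma latt_pos_deg: "m \<in> latt_pos \<Longrightarrow> 0 < latt_deg m"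
  by (simp add: latt_pos_def)

definition latt_decomp :: "'r::finite latt \<Rightarrow> ('r latt \<times> 'r latt) set" where
  "latt_decomp m = {(n, n'). n \<in> latt_pos \<and> n' \<in> latt_pos \<and> n + n' = m}"

lemma finite_latt_decomp' [simp]: "finite (latt_decomp m)"
  unfolding latt_decomp_def by (rule finite_latt_decomp)

lemma latt_decomp_deg:
  assumes "(n, n') \<in> latt_decomp m"
  shows "latt_deg n < latt_deg m" "latt_deg n' < latt_deg m"
  using assms latt_pos_deg[of n] latt_pos_deg[of n'] by (auto simp: latt_decomp_def)

lemma lie_bracket_alt:
  "lie_bracket \<omega> \<delta> X Y m = (\<Sum>(n, n')\<in>latt_decomp m. X n * Y n' * qnum \<delta> (\<omega> n n'))"
  by (simp add: lie_bracket_def latt_decomp_def)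

lemma lie_bracket_in_lie_hat: "lie_bracket \<omega> \<delta> X Y \<in> lie_hat"
proof -
  have "latt_decomp m = {}" if "m \<notin> latt_pos" for m :: "'a latt"
    using that latt_pos_add by (auto simp: latt_decomp_def)
  then show ?thesis by (simp add: lie_hat_def lie_bracket_alt)
qed

lemma lie_bracket_zero [simp]:
  "lie_bracket \<omega> \<delta> (\<lambda>_. 0) Y = (\<lambda>_. 0)" "lie_bracket \<omega> \<delta> X (\<lambda>_. 0) = (\<lambda>_. 0)"
  by (rule ext, simp add: lie_bracket_alt)+

lemma qnum_uminus: "qnum \<delta> (- a) = - qnum \<delta> a"
  by (simp add: qnum_def minus_divide_left)

lemma lie_bracket_self:
  assumes skew: "\<And>x y. \<omega> x y = - \<omega> y x"
  shows "lie_bracket \<omega> \<delta> X X = (\<lambda>_. 0)"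
proof
  fix m
  let ?S = "\<Sum>(n, n')\<in>latt_decomp m. X n * X n' * qnum \<delta> (\<omega> n n')"
  have "?S = (\<Sum>(n, n')\<in>latt_decomp m. X n' * X n * qnum \<delta> (\<omega> n' n))"
    by (rule sum.reindex_bij_witness[of _ prod.swap prod.swap]) (auto simp: latt_decomp_def add.commute)
  also have "\<dots> = (\<Sum>(n, n')\<in>latt_decomp m. - (X n * X n' * qnum \<delta> (\<omega> n n')))"
  proof (intro sum.cong refl, clarify)
    fix n n'
    have "qnum \<delta> (\<omega> n' n) = - qnum \<delta> (\<omega> n n')" using skew[of n' n] by (simp add: qnum_uminus)
    then show "X n' * X n * qnum \<delta> (\<omega> n' n) = - (X n * X n' * qnum \<delta> (\<omega> n n'))" by simp
  qed
  also have "\<dots> = - ?S" by (simp add: sum_negf case_prod_unfold)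
  finally have "?S = 0" by simp
  then show "lie_bracket \<omega> \<delta> X X m = 0" by (simp add: lie_bracket_alt)
qed

lemma nested_bracket_Cons:
  "ws \<noteq> [] \<Longrightarrow> nested_bracket \<omega> \<delta> (x # ws) = lie_bracket \<omega> \<delta> x (nested_bracket \<omega> \<delta> ws)"
  by (cases ws) simp_all

lemma nested_bracket_in_lie_hat:
  assumes "\<And>x. x \<in> set ws \<Longrightarrow> x \<in> lie_hat"
  shows "nested_bracket \<omega> \<delta> ws \<in> lie_hat"
  using assms
  by (induction ws rule: nested_bracket.induct) (simp_all add: lie_bracket_in_lie_hat, simp add: lie_hat_def)

lemma nested_bracket_local:
  assumes "\<And>i p. latt_deg p \<le> d \<Longrightarrow> f i p = g i p" "latt_deg m \<le> d"
  shows "nested_bracket \<omega> \<delta> (map f ws) m = nested_bracket \<omega> \<delta> (map g ws) m"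
  using assms(2)
proof (induction ws arbitrary: m)
  case (Cons i ws)
  show ?case
  proof (cases "ws = []")
    case False
    have "f i n * nested_bracket \<omega> \<delta> (map f ws) n' * q = g i n * nested_bracket \<omega> \<delta> (map g ws) n' * q"
      if "(n, n') \<in> latt_decomp m" for n n' q
      using latt_decomp_deg[OF that] Cons.prems assms(1)[of n i] Cons.IH[of n'] by simp
    then show ?thesis using False
      by (auto simp: nested_bracket_Cons lie_bracket_alt intro!: sum.cong)
  qed (simp add: Cons.prems assms(1))
qed simp

text \<open>All letters contribute only in positive degrees, so in a bracket of length at least two
  each letter is evaluated strictly below the degree of \<open>m\<close>. The strictness lets an
  equation for \<open>bch\<close> be solved recursively.\<close>

lemma nested_bracket_local_strict:
  assumes "\<And>i p. latt_deg p < latt_deg m \<Longrightarrow> f i p = g i p" "2 \<le> length ws"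
  shows "nested_bracket \<omega> \<delta> (map f ws) m = nested_bracket \<omega> \<delta> (map g ws) m"
proof -
  obtain i ws' where ws: "ws = i # ws'" "ws' \<noteq> []" using assms(2) by (cases ws) (force simp: One_nat_def)+
  have "f i n * nested_bracket \<omega> \<delta> (map f ws') n' * q = g i n * nested_bracket \<omega> \<delta> (map g ws') n' * q"
    if "(n, n') \<in> latt_decomp m" for n n' q
    using latt_decomp_deg[OF that] assms(1)[of n i]
      nested_bracket_local[of "latt_deg m - 1" f g n' \<omega> \<delta> ws'] assms(1) by simp
  then show ?thesis using ws
    by (auto simp: nested_bracket_Cons lie_bracket_alt intro!: sum.cong)
qed

lemma dynkin_word_map: "dynkin_word (f True) (f False) ps = map f (dynkin_word True False ps)"
  by (simp add: dynkin_word_def map_concat comp_def case_prod_unfold)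

text \<open>A word in booleans separates the pattern of letters from their values, so that words
  with different \<open>X\<close> become maps over one list.\<close>

lemma dynkin_word_If: "dynkin_word X Y ps = map (\<lambda>i. if i then X else Y) (dynkin_word True False ps)"
  using dynkin_word_map[of "\<lambda>i. if i then X else Y" ps] by simp

lemma bch_in_lie_hat:
  assumes "X \<in> lie_hat" "Y \<in> lie_hat"
  shows "bch \<omega> \<delta> X Y \<in> lie_hat"
proof -
  have "nested_bracket \<omega> \<delta> (dynkin_word X Y ps) \<in> lie_hat" for ps
    by (rule nested_bracket_in_lie_hat) (use assms in \<open>auto simp: dynkin_word_def split: if_splits\<close>)
  then show ?thesis by (simp add: lie_hat_def bch_def)
qed

definition bch_rest :: "('r::finite latt \<Rightarrow> 'r latt \<Rightarrow> rat) \<Rightarrow> ('r \<Rightarrow> nat) \<Rightarrow> 'r formal \<Rightarrow> 'r formal \<Rightarrow> 'r formal"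
where
  "bch_rest \<omega> \<delta> X Y m = (\<Sum>ps\<in>{ps \<in> dynkin_index (nat (latt_deg m)). 2 \<le> dynkin_len ps}.
     dynkin_coeff ps * nested_bracket \<omega> \<delta> (dynkin_word X Y ps) m)"

lemma dynkin_index_short:
  assumes "0 < d"
  shows "{ps \<in> dynkin_index d. \<not> 2 \<le> dynkin_len ps} = {[(1, 0)], [(0, 1)]}"
proof (intro equalityI subsetI)
  fix ps assume ps: "ps \<in> {ps \<in> dynkin_index d. \<not> 2 \<le> dynkin_len ps}"
  then have "length ps \<le> dynkin_len ps" "ps \<noteq> []"
    by (auto simp: dynkin_index_def intro!: dynkin_len_bounds(1))
  moreover have "dynkin_len ps < 2" using ps by simp
  ultimately have "length ps < 2" "0 < length ps" by auto
  then have "length ps = 1" by linarith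
  then obtain r s where rs: "ps = [(r, s)]" by (auto simp: One_nat_def length_Suc_conv)
  then have "r + s = 1" using ps by (auto simp: dynkin_index_def dynkin_len_def)
  then have "(r, s) = (1, 0) \<or> (r, s) = (0, 1)" by auto
  then show "ps \<in> {[(1, 0)], [(0, 1)]}" using rs by auto
next
  fix ps assume "ps \<in> {[(1, 0)], [(0, 1)] :: (nat \<times> nat) list}"
  then show "ps \<in> {ps \<in> dynkin_index d. \<not> 2 \<le> dynkin_len ps}"
    using assms by (auto simp: dynkin_index_def dynkin_len_def)
qed

lemma bch_split:
  assumes "0 < latt_deg m"
  shows "bch \<omega> \<delta> X Y m = X m + Y m + bch_rest \<omega> \<delta> X Y m"
proof -
  let ?D = "dynkin_index (nat (latt_deg m))"
  let ?h = "\<lambda>ps. dynkin_coeff ps * nested_bracket \<omega> \<delta> (dynkin_word X Y ps) m"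
  have "sum ?h ?D = sum ?h {ps \<in> ?D. 2 \<le> dynkin_len ps} + sum ?h {ps \<in> ?D. \<not> 2 \<le> dynkin_len ps}"
    by (subst sum.union_disjoint[symmetric]) (auto simp: finite_dynkin_index intro!: sum.cong)
  also have "sum ?h {ps \<in> ?D. \<not> 2 \<le> dynkin_len ps} = X m + Y m"
    using assms by (subst dynkin_index_short)
      (simp_all add: dynkin_coeff_def dynkin_len_def dynkin_word_def One_nat_def)
  finally show ?thesis by (simp add: bch_def bch_rest_def)
qed

lemma bch_rest_local:
  assumes "\<And>p. latt_deg p < latt_deg m \<Longrightarrow> X p = X' p"
  shows "bch_rest \<omega> \<delta> X Y m = bch_rest \<omega> \<delta> X' Y m"
  unfolding bch_rest_def
proof (intro sum.cong refl)
  fix ps assume "ps \<in> {ps \<in> dynkin_index (nat (latt_deg m)). 2 \<le> dynkin_len ps}"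
  then have "2 \<le> length (dynkin_word True False ps)"
    by (simp add: length_dynkin_word)
  then have "nested_bracket \<omega> \<delta> (dynkin_word X Y ps) m = nested_bracket \<omega> \<delta> (dynkin_word X' Y ps) m"
    unfolding dynkin_word_If[of X] dynkin_word_If[of X'] by (intro nested_bracket_local_strict) (use assms in auto)
  then show "dynkin_coeff ps * nested_bracket \<omega> \<delta> (dynkin_word X Y ps) m =
      dynkin_coeff ps * nested_bracket \<omega> \<delta> (dynkin_word X' Y ps) m" by simp
qed

text \<open>The innermost bracket of a word of length at least two is either taken with zero or is
  [Y, Y].\<close>

lemma bch_rest_zero:
  assumes skew: "\<And>x y. \<omega> x y = - \<omega> y x"
  shows "bch_rest \<omega> \<delta> (\<lambda>_. 0) Y m = 0"
proof -
  let ?f = "\<lambda>i. if i then (\<lambda>_. 0) else Y"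
  have z: "nested_bracket \<omega> \<delta> (map ?f ws) = (\<lambda>_. 0)" if "2 \<le> length ws" for ws
    using that
  proof (induction ws)
    case (Cons i ws)
    show ?case
    proof (cases "2 \<le> length ws")
      case True
      then have "ws \<noteq> []" by auto
      then show ?thesis using Cons.IH[OF True] by (simp add: nested_bracket_Cons)
    next
      case False
      then have "length ws = 1" using Cons.prems by simp
      then obtain j where "ws = [j]" by (auto simp: One_nat_def length_Suc_conv)
      then show ?thesis by (auto simp: lie_bracket_self[OF skew])
    qed
  qed simp
  have "2 \<le> length (dynkin_word True False ps)" if "2 \<le> dynkin_len ps" for ps
    using that by (simp add: length_dynkin_word)
  then show ?thesis unfolding bch_rest_def dynkin_word_If[of "\<lambda>_. 0"] by (simp add: z)
qed

text \<open>For the inclusion from right to left, \<open>bch h a = X\<close> is solved for \<open>h\<close> degree by degree.\<close>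

lemma coset_exp_group_gt:
  assumes skew: "\<And>x y. \<omega> x y = - \<omega> y x" and a: "a \<in> lie_hat"
  shows "exp_group_gt l #>\<^bsub>exp_group \<omega> \<delta>\<^esub> a = {X \<in> lie_hat. \<forall>m. latt_deg m \<le> int l \<longrightarrow> X m = a m}"
proof (intro equalityI subsetI)
  fix X assume "X \<in> exp_group_gt l #>\<^bsub>exp_group \<omega> \<delta>\<^esub> a"
  then obtain h where h: "h \<in> exp_group_gt l" "X = bch \<omega> \<delta> h a"
    by (auto simp: r_coset_def exp_group_def)
  have "X \<in> lie_hat" using h a by (auto simp: exp_group_gt_def intro: bch_in_lie_hat)
  moreover have "X m = a m" if "latt_deg m \<le> int l" for m
  proof (cases "m \<in> latt_pos")
    case True
    have "bch_rest \<omega> \<delta> h a m = bch_rest \<omega> \<delta> (\<lambda>_. 0) a m"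
      by (rule bch_rest_local) (use h that in \<open>auto simp: exp_group_gt_def\<close>)
    then show ?thesis
      using h that bch_split[OF latt_pos_deg[OF True], of \<omega> \<delta> h a]
      by (simp add: bch_rest_zero[OF skew] exp_group_gt_def)
  next
    case False
    then show ?thesis using \<open>X \<in> lie_hat\<close> a by (simp add: lie_hat_def)
  qed
  ultimately show "X \<in> {X \<in> lie_hat. \<forall>m. latt_deg m \<le> int l \<longrightarrow> X m = a m}" by blast
next
  fix X assume "X \<in> {X \<in> lie_hat. \<forall>m. latt_deg m \<le> int l \<longrightarrow> X m = a m}"
  then have X: "X \<in> lie_hat" "\<And>m. latt_deg m \<le> int l \<Longrightarrow> X m = a m" by auto
  define step where "step h = (\<lambda>m. if m \<in> latt_pos then X m - a m - bch_rest \<omega> \<delta> h a m else 0)" for h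
  define H where "H i = (step ^^ i) (\<lambda>_. 0)" for i
  have H: "H 0 = (\<lambda>_. 0)" "H (Suc i) = step (H i)" for i by (simp_all add: H_def)
  have stable: "H (Suc i) m = H i m" if "latt_deg m \<le> int i" for i m
    using that
  proof (induction i arbitrary: m)
    case 0
    then have "m \<notin> latt_pos" using latt_pos_deg[of m] by auto
    then show ?case by (simp add: H step_def)
  next
    case (Suc i)
    have "bch_rest \<omega> \<delta> (H (Suc i)) a m = bch_rest \<omega> \<delta> (H i) a m"
      by (rule bch_rest_local) (use Suc in auto)
    then show ?case by (simp add: H(2)[of "Suc i"] H(2)[of i] step_def)
  qed
  \<comment> \<open>A diagonal choice: by \<open>stable\<close> the iterate with index deg m no
    longer changes at \<open>m\<close>.\<close>
  define h where "h m = H (nat (latt_deg m)) m" for m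
  have hH: "h m = H i m" if "latt_deg m \<le> int i" for i m
  proof -
    have "nat (latt_deg m) \<le> i" using that by simp
    then show ?thesis unfolding h_def
    proof (induction i rule: dec_induct)
      case (step i)
      then have "latt_deg m \<le> int i" by simp
      then show ?case using step stable by simp
    qed simp
  qed
  have hfix: "h m = step h m" for m
  proof -
    let ?i = "nat (latt_deg m)"
    have "bch_rest \<omega> \<delta> h a m = bch_rest \<omega> \<delta> (H ?i) a m"
      by (rule bch_rest_local) (rule hH, simp)
    moreover have "h m = H (Suc ?i) m" by (rule hH) simp
    ultimately show ?thesis by (simp add: H step_def)
  qed
  have h_hat: "h \<in> lie_hat" unfolding lie_hat_def
  proof (intro CollectI allI impI)
    fix m :: "'a latt" assume "m \<notin> latt_pos"
    then show "h m = 0" using hfix[of m] by (simp add: step_def)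
  qed
  have "bch \<omega> \<delta> h a = X"
  proof
    fix m
    show "bch \<omega> \<delta> h a m = X m"
    proof (cases "m \<in> latt_pos")
      case True
      then show ?thesis using bch_split[OF latt_pos_deg[OF True], of \<omega> \<delta> h a] hfix[of m] by (simp add: step_def)
    next
      case False
      then show ?thesis using bch_in_lie_hat[OF h_hat a] X by (simp add: lie_hat_def)
    qed
  qed
  moreover have "h m = 0" if "latt_deg m \<le> int l" for m
    using that
  proof (induction "nat (latt_deg m)" arbitrary: m rule: less_induct)
    case less
    show ?case
    proof (cases "m \<in> latt_pos")
      case True
      have "bch_rest \<omega> \<delta> h a m = bch_rest \<omega> \<delta> (\<lambda>_. 0) a m"
        by (rule bch_rest_local) (use less latt_pos_deg[OF True] in auto)
      then show ?thesis using hfix[of m] X(2)[OF less.prems] by (simp add: step_def bch_rest_zero[OF skew])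
    next
      case False
      then show ?thesis using h_hat by (simp add: lie_hat_def)
    qed
  qed
  ultimately show "X \<in> exp_group_gt l #>\<^bsub>exp_group \<omega> \<delta>\<^esub> a"
    using h_hat by (auto simp: r_coset_def exp_group_def exp_group_gt_def)
qed

text \<open>By \<open>coset_exp_group_gt\<close>, equality of cosets is agreement of coefficients up
  to degree l, so convergence amounts to coefficientwise stabilisation.\<close>

lemma exp_group_limI:
  assumes skew: "\<And>x y. \<omega> x y = - \<omega> y x" and g: "g \<in> lie_hat" and P: "\<And>k. P k \<in> lie_hat"
    and lim: "\<And>k m. latt_deg m < int k \<Longrightarrow> P k m = g m"
  shows "exp_group_lim \<omega> \<delta> P g"
  unfolding exp_group_lim_def
proof (intro conjI allI)
  show "g \<in> carrier (exp_group \<omega> \<delta>)" using g by (simp add: exp_group_def)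
  fix l
  show "\<forall>\<^sub>F k in sequentially. exp_group_gt l #>\<^bsub>exp_group \<omega> \<delta>\<^esub> P k = exp_group_gt l #>\<^bsub>exp_group \<omega> \<delta>\<^esub> g"
    using eventually_gt_at_top[of l]
  proof eventually_elim
    case (elim k)
    then have "P k m = g m" if "latt_deg m \<le> int l" for m using lim[of m k] that by simp
    then show ?case
      unfolding coset_exp_group_gt[OF skew g] coset_exp_group_gt[OF skew P] by auto
  qed
qed

section \<open>From the quantum plane to the Lie algebra\<close>

text \<open>The field endomorphism \<open>qroot \<mapsto> qroot\<^sup>k\<close>.\<close>

definition theta :: "nat \<Rightarrow> qfield \<Rightarrow> qfield" where
  "theta k x = (SOME y. \<exists>a b. b \<noteq> 0 \<and> x = Fract a b \<and> y = Fract (pcompose a (monom 1 k)) (pcompose b (monom 1 k)))"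

context
  fixes k :: nat
  assumes k: "0 < k"
begin

lemma pcompose_monom_eq_0: "pcompose (p :: rat poly) (monom 1 k) = 0 \<longleftrightarrow> p = 0"
  using k by (intro pcompose_eq_0_iff) (simp add: degree_monom_eq)

lemma theta_Fract:
  assumes "b \<noteq> 0"
  shows "theta k (Fract a b) = Fract (pcompose a (monom 1 k)) (pcompose b (monom 1 k))"
proof -
  let ?P = "\<lambda>y. \<exists>a' b'. b' \<noteq> 0 \<and> Fract a b = Fract a' b' \<and> y = Fract (pcompose a' (monom 1 k)) (pcompose b' (monom 1 k))"
  have "?P (theta k (Fract a b))" unfolding theta_def by (rule someI_ex) (use assms in blast)
  then obtain a' b' where ab: "b' \<noteq> 0" "Fract a b = Fract a' b'"
      "theta k (Fract a b) = Fract (pcompose a' (monom 1 k)) (pcompose b' (monom 1 k))" by blast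
  then have "a * b' = a' * b" using assms by (simp add: eq_fract)
  then have "pcompose a (monom 1 k) * pcompose b' (monom 1 k) = pcompose a' (monom 1 k) * pcompose b (monom 1 k)"
    by (simp add: pcompose_mult[symmetric])
  then show ?thesis using ab assms by (simp add: eq_fract pcompose_monom_eq_0)
qed

lemma theta_mult: "theta k (x * y) = theta k x * theta k y"
  by (cases x; cases y) (simp add: theta_Fract pcompose_mult)

lemma theta_add: "theta k (x + y) = theta k x + theta k y"
  by (cases x; cases y) (simp add: theta_Fract pcompose_mult pcompose_add pcompose_monom_eq_0)

lemma theta_1 [simp]: "theta k 1 = 1"
  by (simp add: One_fract_def theta_Fract pcompose_1)

lemma theta_0 [simp]: "theta k 0 = 0"
  using theta_add[of 0 0] by simp

lemma theta_uminus: "theta k (- x) = - theta k x"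
  using theta_add[of x "- x"] by (simp add: eq_neg_iff_add_eq_0 add.commute)

lemma theta_diff: "theta k (x - y) = theta k x - theta k y"
  using theta_add[of x "- y"] by (simp add: theta_uminus)

lemma theta_inverse: "theta k (inverse x) = inverse (theta k x)"
proof (cases "x = 0")
  case False
  then have "theta k x * theta k (inverse x) = 1" by (simp add: theta_mult[symmetric])
  then show ?thesis by (metis inverse_unique)
qed simp

lemma theta_divide: "theta k (x / y) = theta k x / theta k y"
  by (simp add: divide_inverse theta_mult theta_inverse)

lemma theta_power: "theta k (x ^ j) = theta k x ^ j"
  by (induction j) (simp_all add: theta_mult)

lemma theta_of_nat [simp]: "theta k (of_nat j) = of_nat j"
  by (induction j) (simp_all add: theta_add)

lemma theta_fact [simp]: "theta k (fact j) = fact j"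
  using theta_of_nat[of "fact j"] by simp

lemma theta_sum: "theta k (\<Sum>i\<in>I. f i) = (\<Sum>i\<in>I. theta k (f i))"
  by (induction I rule: infinite_finite_induct) (simp_all add: theta_add)

lemma theta_qroot: "theta k qroot = qroot ^ k"
  by (simp add: qroot_def theta_Fract pcompose_pCons pcompose_1 qroot_power[unfolded qroot_def])

lemma theta_vp: "theta k (vp i) = qroot powi (int k * i)"
proof -
  have "theta k (vp i) = theta k qroot powi i"
    unfolding vp_def by (cases i) (simp_all add: power_int_def theta_power theta_inverse)
  then show ?thesis by (simp add: theta_qroot power_int_mult)
qed

lemma theta_dynkin_coeff: "theta k (dynkin_coeff ps) = dynkin_coeff ps"
proof -
  have "theta k (\<Prod>(r, s)\<leftarrow>ps. fact r * fact s) = (\<Prod>(r, s)\<leftarrow>ps. fact r * fact s)"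
    by (induction ps) (auto simp: theta_mult)
  then show ?thesis
    by (simp add: dynkin_coeff_def theta_divide theta_mult theta_power theta_uminus)
qed

end

section \<open>The cone spanned by n and n'\<close>

locale transport =
  fixes \<omega> :: "'r::finite latt \<Rightarrow> 'r latt \<Rightarrow> rat" and \<delta> :: "'r \<Rightarrow> nat"
    and n n' :: "'r latt" and c b b' :: rat
  assumes fd: "fixed_data \<omega> \<delta>"
    and n_pos: "n \<in> latt_pos" "n' \<in> latt_pos"
    and c: "\<omega> n' n = c" "0 < c" "c / 4 \<in> frac_ints \<delta>"
    and b: "b \<in> frac_ints \<delta>" "b' \<in> frac_ints \<delta>"
begin

lemma skew: "\<omega> x y = - \<omega> y x"
  using fd[unfolded fixed_data_def, THEN conjunct2, THEN conjunct2, THEN conjunct1] by (rule allE) (erule allE)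

lemma om_add: "\<omega> (x + y) z = \<omega> x z + \<omega> y z" "\<omega> x (y + z) = \<omega> x y + \<omega> x z"
  using fd[unfolded fixed_data_def, THEN conjunct1]
    fd[unfolded fixed_data_def, THEN conjunct2, THEN conjunct1] by simp_all

lemma om_zero: "\<omega> 0 z = 0" "\<omega> z 0 = 0"
  using om_add(1)[of 0 0 z] om_add(2)[of z 0 0] by simp_all

lemma om_scale: "\<omega> (int j *s x) y = of_nat j * \<omega> x y" "\<omega> x (int j *s y) = of_nat j * \<omega> x y"
proof -
  have s: "int (Suc j) *s z = int j *s z + z" for j and z :: "'r latt"
    by (simp add: vec_eq_iff algebra_simps)
  have z: "int 0 *s z = 0" for z :: "'r latt" by (simp add: vec_eq_iff)
  show "\<omega> (int j *s x) y = of_nat j * \<omega> x y" "\<omega> x (int j *s y) = of_nat j * \<omega> x y"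
    by (induction j) (simp_all only: s z om_zero om_add, simp_all add: algebra_simps)
qed

lemma om_self [simp]: "\<omega> x x = 0"
  using skew[of x x] by simp

lemma delta0_pos: "0 < delta0 \<delta>"
proof -
  have "\<forall>i. 0 < \<delta> i"
    using fd[unfolded fixed_data_def, THEN conjunct2, THEN conjunct2, THEN conjunct2, THEN conjunct1] .
  then have "0 \<notin> range \<delta>" by (metis imageE less_irrefl)
  then have "Lcm (range \<delta>) \<noteq> 0" by (metis Lcm_0_iff finite finite_imageI)
  then show ?thesis unfolding delta0_def by (rule neq0_conv[THEN iffD1])
qed

lemma qpow_eq: "a * of_nat (delta0 \<delta>) = of_int i \<Longrightarrow> qpow \<delta> a = qroot powi i"
  by (simp add: qpow_def)

lemma frac_add: "x \<in> frac_ints \<delta> \<Longrightarrow> y \<in> frac_ints \<delta> \<Longrightarrow> x + y \<in> frac_ints \<delta>"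
  and frac_uminus: "x \<in> frac_ints \<delta> \<Longrightarrow> - x \<in> frac_ints \<delta>"
  and frac_of_nat: "x \<in> frac_ints \<delta> \<Longrightarrow> of_nat j * x \<in> frac_ints \<delta>"
  by (simp_all add: frac_ints_def distrib_right mult.assoc)

lemma qpow_add:
  assumes "x \<in> frac_ints \<delta>" "y \<in> frac_ints \<delta>"
  shows "qpow \<delta> (x + y) = qpow \<delta> x * qpow \<delta> y"
proof -
  obtain i j where ij: "x * of_nat (delta0 \<delta>) = of_int i" "y * of_nat (delta0 \<delta>) = of_int j"
    using assms by (auto simp: frac_ints_def elim!: Ints_cases)
  then have "(x + y) * of_nat (delta0 \<delta>) = of_int (i + j)" by (simp add: distrib_right)
  then show ?thesis using ij by (simp add: qpow_eq power_int_add del: of_int_add)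
qed

lemma qpow_0 [simp]: "qpow \<delta> 0 = 1"
  by (simp add: qpow_def)

lemma qpow_nonzero [simp]: "qpow \<delta> x \<noteq> 0"
  by (simp add: qpow_def)

lemma qpow_uminus: "x \<in> frac_ints \<delta> \<Longrightarrow> qpow \<delta> (- x) = inverse (qpow \<delta> x)"
  using qpow_add[of x "- x"] by (simp add: frac_uminus inverse_unique)

lemma qpow_of_nat: "x \<in> frac_ints \<delta> \<Longrightarrow> qpow \<delta> (of_nat j * x) = qpow \<delta> x ^ j"
  by (induction j) (simp_all add: distrib_right qpow_add frac_of_nat)

definition kk :: nat where "kk = nat \<lfloor>c / 4 * of_nat (delta0 \<delta>)\<rfloor>"

lemma kk: "of_nat kk = c / 4 * of_nat (delta0 \<delta>)" "0 < kk"
proof -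
  obtain i where i: "c / 4 * of_nat (delta0 \<delta>) = of_int i" using c by (auto simp: frac_ints_def elim!: Ints_cases)
  have "0 < c / 4 * of_nat (delta0 \<delta>)" using c delta0_pos by simp
  then have "0 < i" unfolding i by simp
  then show "of_nat kk = c / 4 * of_nat (delta0 \<delta>)" "0 < kk"
    unfolding kk_def i by simp_all
qed

abbreviation th :: "qfield \<Rightarrow> qfield" where "th \<equiv> theta kk"

lemmas th_simps = theta_mult[OF kk(2)] theta_add[OF kk(2)] theta_diff[OF kk(2)] theta_uminus[OF kk(2)]
  theta_divide[OF kk(2)] theta_inverse[OF kk(2)] theta_power[OF kk(2)] theta_1[OF kk(2)] theta_0[OF kk(2)]
  theta_of_nat[OF kk(2)] theta_sum[OF kk(2)]

lemma th_vp: "th (vp (4 * i)) = qpow \<delta> (c * of_int i)"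
proof -
  have "c * of_int i * of_nat (delta0 \<delta>) = of_int (int kk * (4 * i))" using kk(1) by simp
  then show ?thesis by (simp only: theta_vp[OF kk(2)] qpow_eq)
qed

lemma th_v: "th v = qpow \<delta> (c / 4)"
proof -
  have "c / 4 * of_nat (delta0 \<delta>) = of_int (int kk)" using kk(1) by simp
  from qpow_eq[OF this] show ?thesis by (simp add: theta_qroot[OF kk(2)])
qed

definition pt :: "nat \<Rightarrow> nat \<Rightarrow> 'r latt" where
  "pt i j = int i *s n + int j *s n'"

lemma pt_add: "pt i j + pt i' j' = pt (i + i') (j + j')"
  by (simp add: pt_def vec_eq_iff algebra_simps)

lemma om_pt: "\<omega> (pt i j) (pt i' j') = c * (of_nat j * of_nat i' - of_nat i * of_nat j')"
proof -
  have "\<omega> n n' = - c" using skew[of n n'] c by simp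
  then show ?thesis using c by (simp add: pt_def om_add om_scale algebra_simps)
qed

text \<open>Pairing with n and with n' recovers the two coordinates because c is nonzero; the same
  fact makes n and n' linearly independent.\<close>

lemma pt_inj:
  assumes "pt i j = pt i' j'"
  shows "i = i' \<and> j = j'"
proof -
  have "\<omega> (pt i j) (pt 1 0) = \<omega> (pt i' j') (pt 1 0)" "\<omega> (pt 0 1) (pt i j) = \<omega> (pt 0 1) (pt i' j')"
    using assms by simp_all
  then show ?thesis unfolding om_pt using c by simp
qed

lemma pt_deg: "latt_deg (pt i j) = int i * latt_deg n + int j * latt_deg n'"
  by (simp add: pt_def)

lemma pt_deg_ge: "int (i + j) \<le> latt_deg (pt i j)"
proof -
  have "1 \<le> latt_deg n" "1 \<le> latt_deg n'" using n_pos latt_pos_deg by fastforce+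
  then have "int i * 1 \<le> int i * latt_deg n" "int j * 1 \<le> int j * latt_deg n'"
    by (intro mult_left_mono; simp)+
  then show ?thesis by (simp add: pt_deg)
qed

lemma pt_pos: "pt i j \<in> latt_pos \<longleftrightarrow> 0 < i + j"
proof
  assume "pt i j \<in> latt_pos"
  then have "0 < latt_deg (pt i j)" by (rule latt_pos_deg)
  then show "0 < i + j" by (cases "i = 0"; cases "j = 0") (auto simp: pt_deg)
next
  assume ij: "0 < i + j"
  then have "0 < latt_deg (pt i j)" using pt_deg_ge[of i j] by linarith
  then show "pt i j \<in> latt_pos" using n_pos by (auto simp: latt_pos_def pt_def)
qed

definition qd :: qfield where "qd = qpow \<delta> 1 - qpow \<delta> (- 1)"

lemma qd_nonzero: "qd \<noteq> 0"
proof
  assume "qd = 0"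
  moreover have "qpow \<delta> 1 = qroot ^ delta0 \<delta>" "qpow \<delta> (- 1) = inverse (qroot ^ delta0 \<delta>)"
    by (simp_all add: qpow_def floor_minus power_int_minus)
  ultimately have "qroot ^ delta0 \<delta> = inverse (qroot ^ delta0 \<delta>)" by (simp add: qd_def)
  then have "qroot ^ delta0 \<delta> * qroot ^ delta0 \<delta> = 1" by (metis qroot_nonzero power_not_zero right_inverse)
  then have "qroot ^ (delta0 \<delta> + delta0 \<delta>) = 1" by (simp only: power_add)
  then show False using delta0_pos by simp
qed

definition wt :: "nat \<Rightarrow> nat \<Rightarrow> qfield" where
  "wt i j = qd * qpow \<delta> (of_nat i * b + of_nat j * b')"

lemma wt_mult: "wt i j * wt i' j' = qd * wt (i + i') (j + j')"
proof -
  have f: "of_nat i * b + of_nat j * b' \<in> frac_ints \<delta>" for i j by (intro frac_add frac_of_nat b)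
  have "of_nat (i + i') * b + of_nat (j + j') * b' = (of_nat i * b + of_nat j * b') + (of_nat i' * b + of_nat j' * b')"
    by (simp add: algebra_simps)
  then show ?thesis by (simp add: wt_def qpow_add[OF f f])
qed

text \<open>\<open>Lam\<close> maps \<open>e\<^bsub>(i,j)\<^esub>\<close> to \<open>(q - q\<^sup>-\<^sup>1) q\<^bsup>ib+jb'\<^esup> X\<^bsub>in+jn'\<^esub>\<close>; the first factor turns commutators into
  brackets, the second absorbs the parameters \<open>b\<close> and \<open>b'\<close>.\<close>

definition Lam :: "qplane \<Rightarrow> 'r formal" where
  "Lam F = (\<lambda>m. if \<exists>i j. 0 < i + j \<and> m = pt i j
     then let (i, j) = (THE (i, j). m = pt i j) in wt i j * th (cf F (Expo i j 0)) else 0)"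

lemma Lam_pt: "0 < i + j \<Longrightarrow> Lam F (pt i j) = wt i j * th (cf F (Expo i j 0))"
proof -
  assume ij: "0 < i + j"
  have the: "(THE (i', j'). pt i j = pt i' j') = (i, j)"
    by (rule the_equality) (auto dest: pt_inj)
  have "\<exists>i' j'. 0 < i' + j' \<and> pt i j = pt i' j'" using ij by blast
  then show ?thesis by (simp only: Lam_def if_True the Let_def prod.case)
qed

lemma Lam_outside: "(\<And>i j. 0 < i + j \<Longrightarrow> m \<noteq> pt i j) \<Longrightarrow> Lam F m = 0"
  by (auto simp: Lam_def)

lemma Lam_cases:
  obtains i j where "m = pt i j" "0 < i + j" | "\<And>i j. 0 < i + j \<Longrightarrow> m \<noteq> pt i j"
  by blast

lemma Lam_in_lie_hat: "Lam F \<in> lie_hat"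
  unfolding lie_hat_def
proof (intro CollectI allI impI)
  fix m :: "'r latt" assume m: "m \<notin> latt_pos"
  show "Lam F m = 0" by (rule Lam_outside) (use m pt_pos in auto)
qed

text \<open>A lattice point may split into points outside the cone, where \<open>Lam\<close>
  vanishes, and an exponent may split with a zero part, where \<open>F\<close> or \<open>G\<close>
  vanishes. What is left on the two sides corresponds bijectively.\<close>

lemma sum_latt_decomp:
  assumes F: "ge 1 F" and G: "ge 1 G" and ij: "0 < i + j"
  shows "(\<Sum>(p, p')\<in>latt_decomp (pt i j). Lam F p * Lam G p' * q p p') =
    (\<Sum>(m1, m2)\<in>decomp (Expo i j 0). wt (xdeg m1) (ydeg m1) * th (cf F m1) * (wt (xdeg m2) (ydeg m2) * th (cf G m2)) *
       q (pt (xdeg m1) (ydeg m1)) (pt (xdeg m2) (ydeg m2)))"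
proof -
  define pm where "pm m = pt (xdeg m) (ydeg m)" for m
  let ?D = "{(m1, m2)\<in>decomp (Expo i j 0). 0 < dg m1 \<and> 0 < dg m2}"
  let ?h = "\<lambda>p. case p of (p, p') \<Rightarrow> Lam F p * Lam G p' * q p p'"
  have t0: "tdeg m1 = 0" "tdeg m2 = 0" if "(m1, m2) \<in> decomp (Expo i j 0)" for m1 m2
    using that by (auto simp: decomp_def plus_expo_def)
  have inj: "inj_on (map_prod pm pm) ?D"
  proof (rule inj_onI)
    fix x y assume "x \<in> ?D" "y \<in> ?D" "map_prod pm pm x = map_prod pm pm y"
    then show "x = y"
      using t0 by (cases x; cases y) (auto simp: pm_def expo.expand dest!: pt_inj)
  qed
  have "sum ?h (latt_decomp (pt i j)) = sum ?h (map_prod pm pm ` ?D)"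
  proof (rule sum.mono_neutral_right)
    show "map_prod pm pm ` ?D \<subseteq> latt_decomp (pt i j)"
    proof (rule image_subsetI)
      fix x assume x: "x \<in> ?D"
      obtain m1 m2 where x': "x = (m1, m2)" by (cases x)
      have m: "(m1, m2) \<in> decomp (Expo i j 0)" "0 < dg m1" "0 < dg m2" using x x' by simp_all
      then have "xdeg m1 + xdeg m2 = i" "ydeg m1 + ydeg m2 = j" by (auto simp: decomp_def plus_expo_def)
      then show "map_prod pm pm x \<in> latt_decomp (pt i j)"
        using m x' by (simp add: latt_decomp_def pm_def pt_pos pt_add dg_def)
    qed
    show "\<forall>p\<in>latt_decomp (pt i j) - map_prod pm pm ` ?D. ?h p = 0"
    proof
      fix x assume x: "x \<in> latt_decomp (pt i j) - map_prod pm pm ` ?D"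
      obtain p p' where x': "x = (p, p')" by (cases x)
      have p: "(p, p') \<in> latt_decomp (pt i j)" "(p, p') \<notin> map_prod pm pm ` ?D" using x x' by simp_all
      show "?h x = 0"
      proof (rule ccontr)
        assume "?h x \<noteq> 0"
        then have "Lam F p * Lam G p' * q p p' \<noteq> 0" using x' by simp
        then have "Lam F p \<noteq> 0" "Lam G p' \<noteq> 0" by auto
        then obtain i1 j1 i2 j2 where e: "p = pt i1 j1" "0 < i1 + j1" "p' = pt i2 j2" "0 < i2 + j2"
          using Lam_outside by metis
        then have "pt (i1 + i2) (j1 + j2) = pt i j" using p by (simp add: latt_decomp_def pt_add)
        then have "i1 + i2 = i" "j1 + j2 = j" by (auto dest: pt_inj)
        then have "(Expo i1 j1 0, Expo i2 j2 0) \<in> ?D" using e by (simp add: decomp_def dg_def)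
        then have "map_prod pm pm (Expo i1 j1 0, Expo i2 j2 0) \<in> map_prod pm pm ` ?D" by (rule imageI)
        then show False using p e by (simp add: pm_def)
      qed
    qed
  qed simp
  also have "\<dots> = sum (?h \<circ> map_prod pm pm) ?D" by (rule sum.reindex[OF inj])
  also have "\<dots> = (\<Sum>(m1, m2)\<in>decomp (Expo i j 0). wt (xdeg m1) (ydeg m1) * th (cf F m1) * (wt (xdeg m2) (ydeg m2) * th (cf G m2)) *
       q (pt (xdeg m1) (ydeg m1)) (pt (xdeg m2) (ydeg m2)))"
  proof (rule sum.mono_neutral_cong_left)
    show "\<forall>p\<in>decomp (Expo i j 0) - ?D. (case p of (m1, m2) \<Rightarrow> wt (xdeg m1) (ydeg m1) * th (cf F m1) * (wt (xdeg m2) (ydeg m2) * th (cf G m2)) *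
       q (pt (xdeg m1) (ydeg m1)) (pt (xdeg m2) (ydeg m2))) = 0"
      using F G by (auto simp: ge_def th_simps)
    fix p assume p: "p \<in> ?D"
    obtain m1 m2 where m: "p = (m1, m2)" by (cases p)
    have E: "Expo (xdeg m1) (ydeg m1) 0 = m1" "Expo (xdeg m2) (ydeg m2) 0 = m2"
      using p m t0[of m1 m2] by (simp_all add: expo.expand)
    show "(?h \<circ> map_prod pm pm) p = (case p of (m1, m2) \<Rightarrow> wt (xdeg m1) (ydeg m1) * th (cf F m1) * (wt (xdeg m2) (ydeg m2) * th (cf G m2)) *
       q (pt (xdeg m1) (ydeg m1)) (pt (xdeg m2) (ydeg m2)))"
      using p m E by (simp add: pm_def Lam_pt dg_def)
  qed auto
  finally show ?thesis by simp
qed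

lemma Lam_br:
  assumes F: "ge 1 F" and G: "ge 1 G"
  shows "lie_bracket \<omega> \<delta> (Lam F) (Lam G) = Lam (br F G)"
proof
  fix m
  show "lie_bracket \<omega> \<delta> (Lam F) (Lam G) m = Lam (br F G) m"
  proof (cases m rule: Lam_cases)
    case (1 i j)
    have q: "qnum \<delta> (\<omega> (pt (xdeg m1) (ydeg m1)) (pt (xdeg m2) (ydeg m2))) =
        (th (vp (4 * frm m1 m2)) - th (vp (4 * frm m2 m1))) / qd" for m1 m2
    proof -
      have "\<omega> (pt (xdeg m1) (ydeg m1)) (pt (xdeg m2) (ydeg m2)) = c * of_int (frm m1 m2)"
        by (simp add: om_pt frm_def)
      then show ?thesis unfolding th_vp qnum_def qd_def frm_swap[of m2 m1] by simp
    qed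
    have "lie_bracket \<omega> \<delta> (Lam F) (Lam G) m =
      (\<Sum>(m1, m2)\<in>decomp (Expo i j 0). wt i j * (th (cf F m1) * th (cf G m2) * (th (vp (4 * frm m1 m2)) - th (vp (4 * frm m2 m1)))))"
      unfolding lie_bracket_alt 1(1) sum_latt_decomp[OF F G 1(2)]
    proof (intro sum.cong refl, clarify)
      fix m1 m2 assume "(m1, m2) \<in> decomp (Expo i j 0)"
      then have "xdeg m1 + xdeg m2 = i" "ydeg m1 + ydeg m2 = j" by (auto simp: decomp_def plus_expo_def)
      then have w: "wt (xdeg m1) (ydeg m1) * wt (xdeg m2) (ydeg m2) = qd * wt i j" by (simp add: wt_mult)
      have e: "wt (xdeg m1) (ydeg m1) * th (cf F m1) * (wt (xdeg m2) (ydeg m2) * th (cf G m2)) * Q =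
        (wt (xdeg m1) (ydeg m1) * wt (xdeg m2) (ydeg m2)) * (th (cf F m1) * th (cf G m2) * Q)" for Q
        by (simp add: mult_ac)
      show "wt (xdeg m1) (ydeg m1) * th (cf F m1) * (wt (xdeg m2) (ydeg m2) * th (cf G m2)) *
          qnum \<delta> (\<omega> (pt (xdeg m1) (ydeg m1)) (pt (xdeg m2) (ydeg m2))) =
        wt i j * (th (cf F m1) * th (cf G m2) * (th (vp (4 * frm m1 m2)) - th (vp (4 * frm m2 m1))))"
        unfolding e w q using qd_nonzero by simp
    qed
    also have "\<dots> = wt i j * th (cf (br F G) (Expo i j 0))"
    proof -
      have "cf (G * F) (Expo i j 0) = (\<Sum>(m1, m2)\<in>decomp (Expo i j 0). cf G m2 * cf F m1 * vp (4 * frm m2 m1))"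
        unfolding cf_mult by (rule sum_decomp_swap)
      then have "cf (br F G) (Expo i j 0) = (\<Sum>(m1, m2)\<in>decomp (Expo i j 0). cf F m1 * cf G m2 * (vp (4 * frm m1 m2) - vp (4 * frm m2 m1)))"
        by (simp add: br_def cf_mult case_prod_unfold sum_subtractf[symmetric] right_diff_distrib mult_ac)
      then show ?thesis by (simp add: th_simps sum_distrib_left case_prod_unfold)
    qed
    finally show ?thesis using 1 by (simp add: Lam_pt)
  next
    case 2
    have "Lam F p * Lam G p' * qnum \<delta> (\<omega> p p') = 0" if "(p, p') \<in> latt_decomp m" for p p'
    proof (rule ccontr)
      assume "Lam F p * Lam G p' * qnum \<delta> (\<omega> p p') \<noteq> 0"
      then have "Lam F p \<noteq> 0" "Lam G p' \<noteq> 0" by auto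
      then obtain i1 j1 i2 j2 where e: "p = pt i1 j1" "0 < i1 + j1" "p' = pt i2 j2" "0 < i2 + j2"
        using Lam_outside by metis
      then have mpt: "m = pt (i1 + i2) (j1 + j2)" using that by (auto simp: latt_decomp_def pt_add)
      have "0 < (i1 + i2) + (j1 + j2)" using e by linarith
      from 2[OF this] mpt show False by (rule notE)
    qed
    then have "lie_bracket \<omega> \<delta> (Lam F) (Lam G) m = 0"
      unfolding lie_bracket_alt by (auto intro!: sum.neutral)
    then show ?thesis by (simp only: Lam_outside[OF 2])
  qed
qed

lemma Lam_nbr:
  assumes "\<And>x. x \<in> set ws \<Longrightarrow> ge 1 x" "ws \<noteq> []"
  shows "nested_bracket \<omega> \<delta> (map Lam ws) = Lam (nbr ws)"
  using assms
proof (induction ws)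
  case (Cons x ws)
  show ?case
  proof (cases "ws = []")
    case False
    then have "ge (length ws) (nbr ws)" using Cons.prems by (intro ge_nbr) auto
    then have "ge 1 (nbr ws)" by (rule ge_mono) (use False in \<open>cases ws; simp\<close>)
    then show ?thesis using False Cons by (simp add: nested_bracket_Cons nbr_Cons Lam_br)
  qed simp
qed simp

section \<open>Group-like elements, their logarithms and limits\<close>

definition grp :: "qplane \<Rightarrow> bool" where
  "grp g \<longleftrightarrow> ge 1 (g - 1) \<and> flat g"

definition LL :: "qplane \<Rightarrow> 'r formal" where
  "LL g = Lam (plog g)"

lemma grp_mult: "grp g \<Longrightarrow> grp h \<Longrightarrow> grp (g * h)"
  by (simp add: grp_def ge_mult_one flat_mult)

lemma grp_one: "grp 1"
  by (simp add: grp_def)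

lemma flat_plog: "flat g \<Longrightarrow> flat (plog g)"
  unfolding plog_def by (intro flat_ev flat_diff) simp_all

text \<open>\<open>Lam\<close> respects brackets on elements of positive order, so it carries each
  Dynkin word to the corresponding one, and the rational coefficients are fixed by
  \<open>th\<close>. Summation is \<open>dynkin_formula\<close> with the lattice degree as
  cutoff.\<close>

lemma LL_mult:
  assumes g: "grp g" and h: "grp h"
  shows "bch \<omega> \<delta> (LL g) (LL h) = LL (g * h)"
proof
  fix m
  let ?X = "plog g" and ?Y = "plog h"
  have X: "ge 1 ?X" "flat ?X" "pexp ?X = g" using g by (simp_all add: grp_def ge_plog flat_plog pexp_plog)
  have Y: "ge 1 ?Y" "flat ?Y" "pexp ?Y = h" using h by (simp_all add: grp_def ge_plog flat_plog pexp_plog)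
  have word: "nested_bracket \<omega> \<delta> (dynkin_word (Lam ?X) (Lam ?Y) ps) = Lam (nbr (dynkin_word ?X ?Y ps))"
    if "ps \<in> dynkin_index N" for ps N
  proof -
    have w: "dynkin_word (Lam ?X) (Lam ?Y) ps = map Lam (dynkin_word ?X ?Y ps)"
      by (simp add: dynkin_word_def map_concat comp_def case_prod_unfold)
    have ne: "dynkin_word ?X ?Y ps \<noteq> []"
      using that by (cases ps) (auto simp: dynkin_index_def dynkin_word_def)
    have gx: "ge 1 x" if "x \<in> set (dynkin_word ?X ?Y ps)" for x
      using that set_dynkin_word[of ?X ?Y ps] X Y by auto
    show ?thesis unfolding w by (rule Lam_nbr[OF gx ne])
  qed
  show "bch \<omega> \<delta> (LL g) (LL h) m = LL (g * h) m"
  proof (cases m rule: Lam_cases)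
    case (1 i j)
    let ?N = "nat (latt_deg m)"
    have "bch \<omega> \<delta> (LL g) (LL h) m = (\<Sum>ps\<in>dynkin_index ?N. dynkin_coeff ps * Lam (nbr (dynkin_word ?X ?Y ps)) m)"
      unfolding bch_def LL_def by (intro sum.cong refl) (simp add: word)
    also have "\<dots> = wt i j * th (\<Sum>ps\<in>dynkin_index ?N. dynkin_coeff ps * cf (nbr (dynkin_word ?X ?Y ps)) (Expo i j 0))"
      using 1 by (simp add: Lam_pt th_simps theta_dynkin_coeff[OF kk(2)] sum_distrib_left mult_ac)
    also have "(\<Sum>ps\<in>dynkin_index ?N. dynkin_coeff ps * cf (nbr (dynkin_word ?X ?Y ps)) (Expo i j 0)) =
        cf (plog (pexp ?X * pexp ?Y)) (Expo i j 0)"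
    proof (rule dynkin_formula)
      have "int (i + j) \<le> latt_deg m" using 1 pt_deg_ge by simp
      then show "dg (Expo i j 0) \<le> ?N" by (simp add: dg_def)
    qed (use X Y in simp_all)
    finally show ?thesis using 1 X Y by (simp add: LL_def Lam_pt)
  next
    case 2
    then have z: "Lam F m = 0" for F by (intro Lam_outside)
    show ?thesis unfolding LL_def bch_def z by (rule sum.neutral) (simp add: word z)
  qed
qed

lemma plog_one: "plog 1 = 0"
  by (rule qplane_eqI) (auto simp: plog_def ev_def psum_def power_0_left intro!: sum.neutral)

lemma LL_one: "LL 1 = (\<lambda>_. 0)"
  by (rule ext) (simp add: LL_def plog_one Lam_def th_simps case_prod_unfold Let_def)

lemma LL_in_lie_hat: "LL g \<in> lie_hat"
  by (simp add: LL_def Lam_in_lie_hat)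

text \<open>The lattice degree dominates the degree in the plane, and the powers entering the
  logarithm agree wherever \<open>g\<close> and \<open>h\<close> do.\<close>

lemma LL_local:
  assumes g: "grp g" and h: "grp h" and gh: "ge N (g - h)" and m: "latt_deg m < int N"
  shows "LL g m = LL h m"
proof (cases m rule: Lam_cases)
  case (1 i j)
  have "ge N ((g - 1) ^ k - (h - 1) ^ k)" for k
  proof (induction k)
    case (Suc k)
    have "(g - 1) ^ Suc k - (h - 1) ^ Suc k = (g - h) * (g - 1) ^ k + (h - 1) * ((g - 1) ^ k - (h - 1) ^ k)"
      by (simp add: algebra_simps)
    then show ?case using ge_add[OF ge_mult_right[OF gh] ge_mult_left[OF Suc]] by metis
  qed simp
  moreover have "dg (Expo i j 0) < N" using m 1 pt_deg_ge[of i j] by (simp add: dg_def)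
  ultimately have "cf ((g - 1) ^ k) (Expo i j 0) = cf ((h - 1) ^ k) (Expo i j 0)" for k
    by (simp add: ge_def)
  then have "cf (plog g) (Expo i j 0) = cf (plog h) (Expo i j 0)"
    by (simp add: plog_def ev_def psum_def)
  then show ?thesis using 1 by (simp add: LL_def Lam_pt)
next
  case 2
  then show ?thesis by (simp only: LL_def Lam_outside[OF 2])
qed

lemma rprod_LL:
  assumes "\<And>p. grp (F p)" "\<And>p. f p = LL (F p)"
  shows "rprod (exp_group \<omega> \<delta>) f k = LL (rpart F k) \<and> grp (rpart F k)"
  by (induction k) (simp_all add: exp_group_def LL_one grp_one LL_mult grp_mult assms)

lemma lprod_LL:
  assumes "\<And>p. grp (F p)" "\<And>p. f p = LL (F p)"
  shows "lprod (exp_group \<omega> \<delta>) f k = LL (lpart F k) \<and> grp (lpart F k)"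
  by (induction k) (simp_all add: exp_group_def LL_one grp_one LL_mult grp_mult assms)

lemma has_rprod_LL:
  assumes "\<And>p. grp (F p)" "\<And>p. f p = LL (F p)" "grp g" "\<And>k. ge k (g - rpart F k)"
  shows "has_rprod \<omega> \<delta> f (LL g)"
  unfolding has_rprod_def
proof (rule exp_group_limI[OF skew])
  fix k and m :: "'r latt"
  show "rprod (exp_group \<omega> \<delta>) f k \<in> lie_hat" by (simp add: rprod_LL[OF assms(1,2)] LL_in_lie_hat)
  assume m: "latt_deg m < int k"
  show "rprod (exp_group \<omega> \<delta>) f k m = LL g m"
    using LL_local[OF assms(3) conjunct2[OF rprod_LL[OF assms(1,2)]] assms(4) m]
      conjunct1[OF rprod_LL[OF assms(1,2)]] by simp
qed (rule LL_in_lie_hat)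

lemma has_lprod_LL:
  assumes "\<And>p. grp (F p)" "\<And>p. f p = LL (F p)" "grp g" "\<And>k. ge k (g - lpart F k)"
  shows "has_lprod \<omega> \<delta> f (LL g)"
  unfolding has_lprod_def
proof (rule exp_group_limI[OF skew])
  fix k and m :: "'r latt"
  show "lprod (exp_group \<omega> \<delta>) f k \<in> lie_hat" by (simp add: lprod_LL[OF assms(1,2)] LL_in_lie_hat)
  assume m: "latt_deg m < int k"
  show "lprod (exp_group \<omega> \<delta>) f k m = LL g m"
    using LL_local[OF assms(3) conjunct2[OF lprod_LL[OF assms(1,2)]] assms(4) m]
      conjunct1[OF lprod_LL[OF assms(1,2)]] by simp
qed (rule LL_in_lie_hat)

end

section \<open>Images of the dilogarithms\<close>

lemma plog_dil:
  assumes "0 < i + j"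
  shows "plog (dil s a i j) = ev (scl a (psil s)) (mon (Expo i j 0))"
proof -
  let ?p = "mon (Expo i j 0)"
  have p: "ge 1 ?p" using assms by (rule ge_mon_pos)
  have "dil s a i j = pexp (ev (scl a (psil s)) ?p)"
  proof -
    have "scl a (psi s) = fps_exp 1 oo scl a (psil s)"
      unfolding psi_def by (subst scl_fexp) (simp_all add: fexp_def)
    then show ?thesis unfolding dil_def pexp_def by (simp add: ev_compose p)
  qed
  then show ?thesis by (simp add: plog_pexp ge_ev p)
qed

context transport
begin

lemma grp_dil: "0 < i + j \<Longrightarrow> grp (dil s a i j)"
  using ge_ev[OF ge_mon_pos, of i j "scl a (psi s) - 1"]
  by (simp add: grp_def dil_def ev_diff ge_mon_pos flat_ev)

text \<open>The factor \<open>qd\<close> in \<open>wt\<close> completes the denominators s^l - s^-l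
  to q-numbers, and the powers of q coming from \<open>wt\<close> and from \<open>a\<close> combine
  to \<open>B\<close>.\<close>

lemma LL_dil:
  assumes ij: "0 < i + j" and s: "th s = qpow \<delta> A" "A \<in> frac_ints \<delta>"
    and a: "th a = qpow \<delta> \<beta>" "\<beta> \<in> frac_ints \<delta>" and B: "B = of_nat i * b + of_nat j * b' + \<beta>"
  shows "LL (dil s a i j) = qdilog \<delta> (pt i j) A B"
proof
  fix m
  have scale: "int l *s pt i j = pt (l * i) (l * j)" for l
    by (simp add: pt_def vec_eq_iff algebra_simps)
  have cfm: "cf (mon (Expo i j 0) ^ l) (Expo i' j' 0) = (if i' = l * i \<and> j' = l * j then 1 else 0)" for l i' j'
    by (simp add: mon_power cf_mon)
  have f: "of_nat i * b + of_nat j * b' \<in> frac_ints \<delta>" by (intro frac_add frac_of_nat b)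
  show "LL (dil s a i j) m = qdilog \<delta> (pt i j) A B m"
  proof (cases "\<exists>l\<ge>1. m = int l *s pt i j")
    case True
    then obtain l where l: "1 \<le> l" "m = int l *s pt i j" by blast
    have pos: "0 < l * i + l * j" using l ij by auto
    have "cf (plog (dil s a i j)) (Expo (l * i) (l * j) 0) =
        (\<Sum>k\<le>dg (Expo (l * i) (l * j) 0). if k = l then a ^ l * psil s $$ l else 0)"
      unfolding plog_dil[OF ij] ev_def psum_def cf_Abs
    proof (intro sum.cong refl)
      fix k
      have "l * i = k * i \<and> l * j = k * j \<longleftrightarrow> k = l" using ij by auto
      then show "cf (kc (scl a (psil s) $$ k) * mon (Expo i j 0) ^ k) (Expo (l * i) (l * j) 0) =
        (if k = l then a ^ l * psil s $$ l else 0)" by (simp add: cfm)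
    qed
    also have "\<dots> = a ^ l * psil s $$ l"
    proof -
      have "l * 1 \<le> l * (i + j)" using ij by (intro mult_left_mono) auto
      then have "l \<le> dg (Expo (l * i) (l * j) 0)" by (simp add: dg_def distrib_left)
      then show ?thesis by simp
    qed
    finally have "LL (dil s a i j) m = wt (l * i) (l * j) * th (a ^ l * psil s $$ l)"
      using pos by (simp add: LL_def l(2) scale Lam_pt)
    also have "th (a ^ l * psil s $$ l) =
        qpow \<delta> \<beta> ^ l * ((- 1) ^ (l + 1) / (of_nat l * (qpow \<delta> A ^ l - inverse (qpow \<delta> A ^ l))))"
      using l by (simp add: psil_def th_simps s a)
    also have "wt (l * i) (l * j) = qd * qpow \<delta> (of_nat i * b + of_nat j * b') ^ l"
      unfolding qpow_of_nat[OF f, symmetric] by (simp add: wt_def algebra_simps)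
    also have "qd * qpow \<delta> (of_nat i * b + of_nat j * b') ^ l *
        (qpow \<delta> \<beta> ^ l * ((- 1) ^ (l + 1) / (of_nat l * (qpow \<delta> A ^ l - inverse (qpow \<delta> A ^ l))))) =
      (- 1) ^ (l + 1) / (of_nat l * ((qpow \<delta> A ^ l - inverse (qpow \<delta> A ^ l)) / qd)) *
        (qpow \<delta> (of_nat i * b + of_nat j * b') * qpow \<delta> \<beta>) ^ l"
      using qd_nonzero by (simp add: power_mult_distrib divide_simps)
    also have "qpow \<delta> (of_nat i * b + of_nat j * b') * qpow \<delta> \<beta> = qpow \<delta> B"
      unfolding B by (rule qpow_add[OF f a(2), symmetric])
    also have "qpow \<delta> B ^ l = qpow \<delta> (of_nat l * B)"
      unfolding B by (rule qpow_of_nat[OF frac_add[OF f a(2)], symmetric])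
    also have "(qpow \<delta> A ^ l - inverse (qpow \<delta> A ^ l)) / qd = qnum \<delta> (of_nat l * A)"
      unfolding qnum_def qd_def qpow_uminus[OF frac_of_nat[OF s(2)]] qpow_of_nat[OF s(2)] ..
    also have "(- 1) ^ (l + 1) / (of_nat l * qnum \<delta> (of_nat l * A)) * qpow \<delta> (of_nat l * B) = qdilog \<delta> (pt i j) A B m"
      unfolding l(2) by (rule qdilog_scale[symmetric]) (use l ij pt_pos in simp_all)
    finally show ?thesis .
  next
    case False
    then have "qdilog \<delta> (pt i j) A B m = 0" unfolding qdilog_def by (intro sum.neutral) auto
    moreover have "LL (dil s a i j) m = 0"
    proof (cases m rule: Lam_cases)
      case (1 i' j')
      have "cf (kc q * mon (Expo i j 0) ^ k) (Expo i' j' 0) = 0" for k q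
      proof (cases "k = 0")
        case True
        then show ?thesis using 1 by (auto simp: cf_kc)
      next
        case k: False
        have "\<not> (i' = k * i \<and> j' = k * j)"
        proof
          assume "i' = k * i \<and> j' = k * j"
          then have "m = int k *s pt i j" using 1 scale by simp
          moreover have "1 \<le> k" using k by simp
          ultimately show False using False by blast
        qed
        then show ?thesis by (auto simp: cfm)
      qed
      then have "cf (plog (dil s a i j)) (Expo i' j' 0) = 0"
        unfolding plog_dil[OF ij] ev_def psum_def cf_Abs by (intro sum.neutral ballI)
      then show ?thesis using 1 by (simp add: LL_def Lam_pt th_simps)
    next
      case 2
      then show ?thesis unfolding LL_def by (intro Lam_outside)
    qed
    ultimately show ?thesis by simp
  qed
qed

lemma c_frac: "c \<in> frac_ints \<delta>" "c / 2 \<in> frac_ints \<delta>" "0 \<in> frac_ints \<delta>"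
  using frac_of_nat[OF c(3), of 4] frac_of_nat[OF c(3), of 2] by (simp_all add: frac_ints_def)

lemma th_v4: "th (v ^ 4) = qpow \<delta> c"
  using qpow_of_nat[OF c(3), of 4] by (simp add: th_simps th_v)

lemma th_u: "th u = qpow \<delta> (c / 2)"
  using qpow_of_nat[OF c(3), of 2] by (simp add: th_simps th_v)

lemma frac_two_power: "2 ^ p * c / 2 \<in> frac_ints \<delta>"
  using frac_of_nat[OF c_frac(2), of "2 ^ p"] by simp

lemma th_u_power: "th (u ^ 2 ^ p) = qpow \<delta> (2 ^ p * c / 2)"
  using qpow_of_nat[OF c_frac(2), of "2 ^ p"] by (simp add: theta_power[OF kk(2)] th_u[symmetric])

lemma th_one: "th 1 = qpow \<delta> 0"
  by (simp add: th_simps)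

lemma LL_dil_v: "0 < i + j \<Longrightarrow> LL (dil v 1 i j) = qdilog \<delta> (pt i j) (c / 4) (of_nat i * b + of_nat j * b')"
  by (rule LL_dil[OF _ th_v c(3) th_one c_frac(3)]) simp_all

lemma LL_dil_v4: "0 < i + j \<Longrightarrow> LL (dil (v ^ 4) 1 i j) = qdilog \<delta> (pt i j) c (of_nat i * b + of_nat j * b')"
  by (rule LL_dil[OF _ th_v4 c_frac(1) th_one c_frac(3)]) simp_all

lemma LL_dil_u: "0 < i + j \<Longrightarrow> LL (dil u 1 i j) = qdilog \<delta> (pt i j) (c / 2) (of_nat i * b + of_nat j * b')"
  by (rule LL_dil[OF _ th_u c_frac(2) th_one c_frac(3)]) simp_all

lemma flat_CC_images: "flat (push hI CC)" "flat (push hI (push hS CC))"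
  by (intro io.flat_push sw.flat_push CC(2))+

lemma grp_tot: "grp Atot" "grp Ctot" "grp (ev fbl mm)"
proof -
  have C: "ge 1 (push hI F - 1)" if "ge 1 (F - 1)" for F
    using io.ge_push[OF that] by (simp add: io.push_diff io.push_one)
  have S: "ge 1 (push hS F - 1)" if "ge 1 (F - 1)" for F
    using sw.ge_push[OF that] by (simp add: sw.push_diff sw.push_one)
  have "ge 1 (Atot - 1)" unfolding Atot_def by (intro ge_mult_one ge_ev_psi C S CC ge_gens)
  moreover have "flat Atot" unfolding Atot_def by (intro flat_mult flat_ev flat_CC_images flat_mon)
  ultimately show "grp Atot" by (simp add: grp_def)
  show "grp Ctot" unfolding Ctot_def by (simp add: grp_def C CC flat_CC_images)
  have "ge 1 (ev (fbl - 1) mm)" by (rule ge_ev) (simp_all add: fbl_def)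
  then show "grp (ev fbl mm)" by (simp add: grp_def ev_diff flat_ev)
qed

lemma grp_fac: "grp (Afac p)" "grp (Bfac p)" "grp (Cfac p)"
  unfolding Afac_def Bfac_def Cfac_def by (intro grp_mult grp_dil; simp)+

lemma mult_LL: "grp g \<Longrightarrow> grp h \<Longrightarrow> LL g \<otimes>\<^bsub>exp_group \<omega> \<delta>\<^esub> LL h = LL (g * h)"
  by (simp add: exp_group_def LL_mult)

theorem dilog_identity:
  "\<exists>A B C.
     has_rprod \<omega> \<delta> (\<lambda>p.
       qdilog \<delta> (int (2 * p + 1) *s n + int (4 * p) *s n')
         c (of_nat (2 * p + 1) * b + of_nat (4 * p) * b')
       \<otimes>\<^bsub>exp_group \<omega> \<delta>\<^esub>
       qdilog \<delta> (int (p + 1) *s n + int (2 * p + 1) *s n')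
         (c / 4) (of_nat (p + 1) * b + of_nat (2 * p + 1) * b')) A \<and>
     has_rprod \<omega> \<delta> (\<lambda>p.
       qdilog \<delta> (2 ^ p *s (n + 2 *s n'))
         (2 ^ p * c / 2) (2 ^ p * (b + 2 * b') - 2 ^ p * c / 2)
       \<otimes>\<^bsub>exp_group \<omega> \<delta>\<^esub>
       qdilog \<delta> (2 ^ p *s (n + 2 *s n'))
         (2 ^ p * c / 2) (2 ^ p * (b + 2 * b') + 2 ^ p * c / 2)) B \<and>
     has_lprod \<omega> \<delta> (\<lambda>p.
       qdilog \<delta> (int (2 * p + 1) *s n + int (4 * p + 4) *s n')
         c (of_nat (2 * p + 1) * b + of_nat (4 * p + 4) * b')
       \<otimes>\<^bsub>exp_group \<omega> \<delta>\<^esub>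
       qdilog \<delta> (int p *s n + int (2 * p + 1) *s n')
         (c / 4) (of_nat p * b + of_nat (2 * p + 1) * b')) C \<and>
     qdilog \<delta> n' (c / 4) b' \<otimes>\<^bsub>exp_group \<omega> \<delta>\<^esub> qdilog \<delta> n c b =
     A \<otimes>\<^bsub>exp_group \<omega> \<delta>\<^esub> qdilog \<delta> (n + 2 *s n') (c / 2) (b + 2 * b')
       \<otimes>\<^bsub>exp_group \<omega> \<delta>\<^esub> B \<otimes>\<^bsub>exp_group \<omega> \<delta>\<^esub> C"
proof (intro exI conjI)
  show "has_rprod \<omega> \<delta> (\<lambda>p.
       qdilog \<delta> (int (2 * p + 1) *s n + int (4 * p) *s n')
         c (of_nat (2 * p + 1) * b + of_nat (4 * p) * b')
       \<otimes>\<^bsub>exp_group \<omega> \<delta>\<^esub>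
       qdilog \<delta> (int (p + 1) *s n + int (2 * p + 1) *s n')
         (c / 4) (of_nat (p + 1) * b + of_nat (2 * p + 1) * b')) (LL Atot)"
  proof (rule has_rprod_LL[OF grp_fac(1) _ grp_tot(1) Atot_approx])
    fix p
    show "qdilog \<delta> (int (2 * p + 1) *s n + int (4 * p) *s n')
         c (of_nat (2 * p + 1) * b + of_nat (4 * p) * b')
       \<otimes>\<^bsub>exp_group \<omega> \<delta>\<^esub>
       qdilog \<delta> (int (p + 1) *s n + int (2 * p + 1) *s n')
         (c / 4) (of_nat (p + 1) * b + of_nat (2 * p + 1) * b') = LL (Afac p)"
      unfolding pt_def[symmetric] Afac_def
      by (subst mult_LL[symmetric]) (simp_all only: grp_dil LL_dil_v LL_dil_v4 add_gr_0 zero_less_one simp_thms)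
  qed
  show "has_lprod \<omega> \<delta> (\<lambda>p.
       qdilog \<delta> (int (2 * p + 1) *s n + int (4 * p + 4) *s n')
         c (of_nat (2 * p + 1) * b + of_nat (4 * p + 4) * b')
       \<otimes>\<^bsub>exp_group \<omega> \<delta>\<^esub>
       qdilog \<delta> (int p *s n + int (2 * p + 1) *s n')
         (c / 4) (of_nat p * b + of_nat (2 * p + 1) * b')) (LL Ctot)"
  proof (rule has_lprod_LL[OF grp_fac(3) _ grp_tot(2) Ctot_approx])
    fix p
    show "qdilog \<delta> (int (2 * p + 1) *s n + int (4 * p + 4) *s n')
         c (of_nat (2 * p + 1) * b + of_nat (4 * p + 4) * b')
       \<otimes>\<^bsub>exp_group \<omega> \<delta>\<^esub>
       qdilog \<delta> (int p *s n + int (2 * p + 1) *s n')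
         (c / 4) (of_nat p * b + of_nat (2 * p + 1) * b') = LL (Cfac p)"
      unfolding pt_def[symmetric] Cfac_def
      by (subst mult_LL[symmetric]) (simp_all only: grp_dil LL_dil_v LL_dil_v4 add_gr_0 zero_less_one simp_thms)
  qed
  show "has_rprod \<omega> \<delta> (\<lambda>p.
       qdilog \<delta> (2 ^ p *s (n + 2 *s n'))
         (2 ^ p * c / 2) (2 ^ p * (b + 2 * b') - 2 ^ p * c / 2)
       \<otimes>\<^bsub>exp_group \<omega> \<delta>\<^esub>
       qdilog \<delta> (2 ^ p *s (n + 2 *s n'))
         (2 ^ p * c / 2) (2 ^ p * (b + 2 * b') + 2 ^ p * c / 2)) (LL (ev fbl mm))"
  proof (rule has_rprod_LL[OF grp_fac(2) _ grp_tot(3) B_approx])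
    fix p
    let ?P = "2 ^ p :: nat"
    let ?w = "u ^ ?P"
    have e: "2 ^ p *s (n + 2 *s n') = pt ?P (2 * ?P)"
      by (simp add: pt_def vec_eq_iff algebra_simps)
    have inv: "th (inverse ?w) = qpow \<delta> (- (2 ^ p * c / 2))"
      by (simp only: theta_inverse[OF kk(2)] th_u_power qpow_uminus[OF frac_two_power])
    have 1: "LL (dil ?w (inverse ?w) ?P (2 * ?P)) = qdilog \<delta> (pt ?P (2 * ?P)) (2 ^ p * c / 2) (2 ^ p * (b + 2 * b') - 2 ^ p * c / 2)"
      by (rule LL_dil[OF _ th_u_power frac_two_power inv frac_uminus[OF frac_two_power]])
         (simp_all add: algebra_simps)
    have 2: "LL (dil ?w ?w ?P (2 * ?P)) = qdilog \<delta> (pt ?P (2 * ?P)) (2 ^ p * c / 2) (2 ^ p * (b + 2 * b') + 2 ^ p * c / 2)"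
      by (rule LL_dil[OF _ th_u_power frac_two_power th_u_power frac_two_power])
         (simp_all add: algebra_simps)
    have g: "grp (dil s a ?P (2 * ?P))" for s a by (rule grp_dil) simp
    show "qdilog \<delta> (2 ^ p *s (n + 2 *s n')) (2 ^ p * c / 2) (2 ^ p * (b + 2 * b') - 2 ^ p * c / 2)
       \<otimes>\<^bsub>exp_group \<omega> \<delta>\<^esub>
       qdilog \<delta> (2 ^ p *s (n + 2 *s n')) (2 ^ p * c / 2) (2 ^ p * (b + 2 * b') + 2 ^ p * c / 2) = LL (Bfac p)"
      unfolding e 1[symmetric] 2[symmetric] Bfac_def mult_LL[OF g g] ..
  qed
  have n: "n' = pt 0 1" "n = pt 1 0" "n + 2 *s n' = pt 1 2" by (simp_all add: pt_def vec_eq_iff)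
  have "qdilog \<delta> n' (c / 4) b' = LL (dil v 1 0 1)" "qdilog \<delta> n c b = LL (dil (v ^ 4) 1 1 0)"
      "qdilog \<delta> (n + 2 *s n') (c / 2) (b + 2 * b') = LL (dil u 1 1 2)"
    using LL_dil_v[of 0 1] LL_dil_v4[of 1 0] LL_dil_u[of 1 2] n by simp_all
  moreover have "grp (dil v 1 0 1)" "grp (dil (v ^ 4) 1 1 0)" "grp (dil u 1 1 2)"
    by (simp_all add: grp_dil)
  ultimately show "qdilog \<delta> n' (c / 4) b' \<otimes>\<^bsub>exp_group \<omega> \<delta>\<^esub> qdilog \<delta> n c b =
     LL Atot \<otimes>\<^bsub>exp_group \<omega> \<delta>\<^esub> qdilog \<delta> (n + 2 *s n') (c / 2) (b + 2 * b')
       \<otimes>\<^bsub>exp_group \<omega> \<delta>\<^esub> LL (ev fbl mm) \<otimes>\<^bsub>exp_group \<omega> \<delta>\<^esub> LL Ctot"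
    using plane_identity' by (simp only: mult_LL grp_tot grp_mult)
qed

end

lemma basis_vec_pos: "basis_vec i \<in> latt_pos"
proof -
  have "latt_deg (basis_vec i) = 1" by (simp add: latt_deg_def basis_vec_def axis_def)
  then show ?thesis by (simp add: latt_pos_def) (simp add: basis_vec_def axis_def)
qed

theorem theoremA7:
  fixes \<omega> :: "'r::finite latt \<Rightarrow> 'r latt \<Rightarrow> rat"
    and \<delta> :: "'r \<Rightarrow> nat"
  assumes "fixed_data \<omega> \<delta>"
  shows
    "(\<forall>n n' c b b'.
        n \<in> latt_pos \<and> n' \<in> latt_pos \<and> \<omega> n' n = c \<and> 0 < c \<and> c / 4 \<in> frac_ints \<delta> \<and>
        b \<in> frac_ints \<delta> \<and> b' \<in> frac_ints \<delta> \<longrightarrow>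
        (\<exists>A B C.
           has_rprod \<omega> \<delta> (\<lambda>p.
             qdilog \<delta> (int (2 * p + 1) *s n + int (4 * p) *s n')
               c (of_nat (2 * p + 1) * b + of_nat (4 * p) * b')
             \<otimes>\<^bsub>exp_group \<omega> \<delta>\<^esub>
             qdilog \<delta> (int (p + 1) *s n + int (2 * p + 1) *s n')
               (c / 4) (of_nat (p + 1) * b + of_nat (2 * p + 1) * b')) A \<and>
           has_rprod \<omega> \<delta> (\<lambda>p.
             qdilog \<delta> (2 ^ p *s (n + 2 *s n'))
               (2 ^ p * c / 2) (2 ^ p * (b + 2 * b') - 2 ^ p * c / 2)
             \<otimes>\<^bsub>exp_group \<omega> \<delta>\<^esub>
             qdilog \<delta> (2 ^ p *s (n + 2 *s n'))
               (2 ^ p * c / 2) (2 ^ p * (b + 2 * b') + 2 ^ p * c / 2)) B \<and>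
           has_lprod \<omega> \<delta> (\<lambda>p.
             qdilog \<delta> (int (2 * p + 1) *s n + int (4 * p + 4) *s n')
               c (of_nat (2 * p + 1) * b + of_nat (4 * p + 4) * b')
             \<otimes>\<^bsub>exp_group \<omega> \<delta>\<^esub>
             qdilog \<delta> (int p *s n + int (2 * p + 1) *s n')
               (c / 4) (of_nat p * b + of_nat (2 * p + 1) * b')) C \<and>
           qdilog \<delta> n' (c / 4) b' \<otimes>\<^bsub>exp_group \<omega> \<delta>\<^esub> qdilog \<delta> n c b =
           A \<otimes>\<^bsub>exp_group \<omega> \<delta>\<^esub> qdilog \<delta> (n + 2 *s n') (c / 2) (b + 2 * b')
             \<otimes>\<^bsub>exp_group \<omega> \<delta>\<^esub> B \<otimes>\<^bsub>exp_group \<omega> \<delta>\<^esub> C))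
     \<and>
     (\<forall>i1 i2.
        (UNIV :: 'r set) = {i1, i2} \<and> i1 \<noteq> i2 \<and> \<delta> i1 = 1 \<and> \<delta> i2 = 4 \<and>
        \<omega> (basis_vec i2) (basis_vec i1) = 1 \<longrightarrow>
        (\<exists>A B C.
           has_rprod \<omega> \<delta> (\<lambda>p.
             qdilog \<delta> (int (2 * p + 1) *s basis_vec i1 + int (4 * p) *s basis_vec i2) 1 0
             \<otimes>\<^bsub>exp_group \<omega> \<delta>\<^esub>
             qdilog \<delta> (int (p + 1) *s basis_vec i1 + int (2 * p + 1) *s basis_vec i2) (1 / 4) 0) A \<and>
           has_rprod \<omega> \<delta> (\<lambda>j.
             qdilog \<delta> (2 ^ j *s (basis_vec i1 + 2 *s basis_vec i2)) (2 ^ j / 2) (- (2 ^ j / 2))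
             \<otimes>\<^bsub>exp_group \<omega> \<delta>\<^esub>
             qdilog \<delta> (2 ^ j *s (basis_vec i1 + 2 *s basis_vec i2)) (2 ^ j / 2) (2 ^ j / 2)) B \<and>
           has_lprod \<omega> \<delta> (\<lambda>p.
             qdilog \<delta> (int (2 * p + 1) *s basis_vec i1 + int (4 * p + 4) *s basis_vec i2) 1 0
             \<otimes>\<^bsub>exp_group \<omega> \<delta>\<^esub>
             qdilog \<delta> (int p *s basis_vec i1 + int (2 * p + 1) *s basis_vec i2) (1 / 4) 0) C \<and>
           qdilog \<delta> (basis_vec i2) (1 / 4) 0 \<otimes>\<^bsub>exp_group \<omega> \<delta>\<^esub> qdilog \<delta> (basis_vec i1) 1 0 =
           A \<otimes>\<^bsub>exp_group \<omega> \<delta>\<^esub> qdilog \<delta> (basis_vec i1 + 2 *s basis_vec i2) (1 / 2) 0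
             \<otimes>\<^bsub>exp_group \<omega> \<delta>\<^esub> B \<otimes>\<^bsub>exp_group \<omega> \<delta>\<^esub> C))"
proof ((intro conjI allI impI; elim conjE), goal_cases)
  case (1 n n' c b b')
  then interpret transport \<omega> \<delta> n n' c b b' using assms by unfold_locales
  show ?case by (rule dilog_identity)
next
  case (2 i1 i2)
  \<comment> \<open>Here \<open>delta0\<close> is 4, so c = 1 meets the requirement that c/4 be a
    multiple of 1/4.\<close>
  then have "range \<delta> = {1, 4}" by auto
  then have "delta0 \<delta> = 4" by (simp add: delta0_def)
  then interpret transport \<omega> \<delta> "basis_vec i1" "basis_vec i2" 1 0 0
    using assms 2 by unfold_locales (simp_all add: basis_vec_pos frac_ints_def)
  show ?case
    using dilog_identity by (simp only: mult_zero_right mult_1_right add_0_left diff_0)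
qed

end
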